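(* Let $(n,d)=(n_k,d_k)$ be any sequence with $n\to\infty$ and $d\to\infty$, let the samples satisfy assumptions A1 and A2 of the context, and let the bandwidth of the Gaussian kernel satisfy $\gamma=\Omega(\sqrt d)$. Fix $\alpha\in(0,1)$, and consider the test which rejects $H_0:\mu_P=\mu_Q$ if and only if $\sqrt n\,\mathrm{MMD}^2_l/\sqrt v>z_\alpha$. Suppose the signal to noise ratio $\Psi=\|\delta\|/\sigma>0$ satisfies $\Psi=o(d^{1/2})$. Then the power goes to $1$ at the rate of $\Phi(\sqrt n\,\Psi^2/\sqrt d)$, in the sense that there are constants $0<c\le C<\infty$ and numbers $c_k\in[c,C]$ such that $$\Pr(\text{reject }H_0)-\Phi\left(c_k\frac{\sqrt n\,\Psi^2}{\sqrt d}-z_\alpha\right)\to0;$$ in particular the power tends to $1$ whenever $\sqrt n\,\Psi^2/\sqrt d\to\infty$.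
   Context: All quantities may depend on the index $k$ of the sequence $(n,d)=(n_k,d_k)$, which is suppressed; $n$ is even. Assumption A1: the data are $x_i=Us_i+\mu_P\in\mathbb R^d$ (samples from $P$) and $y_i=Ut_i+\mu_Q\in\mathbb R^d$ (samples from $Q$), $i=1,\dots,n$, where $U$ is a $d\times d$ orthogonal matrix ($UU^T=I$), $\mu_P,\mu_Q\in\mathbb R^d$, and $s_1,\dots,s_n,t_1,\dots,t_n$ are i.i.d. random vectors, each having $d$ i.i.d. zero-mean coordinates with a common law on $\mathbb R$ not depending on $(n,d)$. Assumption A2: the $k$-th central moments of each coordinate of $s_i,t_i$ exist (are finite) for $2\le k\le 6$. The variance of each coordinate is $\sigma^2>0$. Notation: $\delta:=\mu_P-\mu_Q$; $\|\cdot\|$ is the Euclidean norm; the signal to noise ratio is $\Psi:=\|\delta\|/\sigma$; $\Phi$ is the standard normal cdf and $z_\alpha$ its $(1-\alpha)$ quantile. $\gamma=\Omega(\sqrt d)$ means there is a constant $c'>0$ with $\gamma\ge c'\sqrt d$ along the sequence. The Gaussian kernel is $k(x,y)=\exp(-\|x-y\|^2/\gamma^2)$. With $z_i=(x_i,y_i)$, let $$h(z_i,z_j)=k(x_i,x_j)+k(y_i,y_j)-k(x_i,y_j)-k(x_j,y_i),\qquad \mathrm{MMD}^2_l=\frac1{n/2}\sum_{i=1}^{n/2}h(z_{2i-1},z_{2i}).$$ $v$ is twice the empirical variance of the $n/2$ values $h(z_{2i-1},z_{2i})$, i.e. $v=2\cdot\frac{1}{n/2}\sum_{i=1}^{n/2}\big(h(z_{2i-1},z_{2i})-\mathrm{MMD}^2_l\big)^2$.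 The power is the rejection probability when $\delta\ne0$. *)

theory Defs
  imports "HOL-Probability.Probability" "HOL-Library.Landau_Symbols"
begin

text \<open>The dimension \<open>d\<close> varies along a sequence, so a vector in \<open>d\<close>-dimensional real space is a
  function \<^typ>\<open>nat \<Rightarrow> real\<close> of which only the coordinates in \<open>{..<d}\<close> are used, with Euclidean norm
  \<open>L2_set v {..<d}\<close>, and a square matrix is a function \<^typ>\<open>nat \<Rightarrow> nat \<Rightarrow> real\<close>.\<close>

definition orthogonal_mat :: "nat \<Rightarrow> (nat \<Rightarrow> nat \<Rightarrow> real) \<Rightarrow> bool" where
  "orthogonal_mat d U \<longleftrightarrow>
     (\<forall>i<d. \<forall>j<d. (\<Sum>l<d. U i l * U j l) = (if i = j then 1 else 0))"

definition std_normal_cdf :: "real \<Rightarrow> real" where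
  "std_normal_cdf = cdf std_normal_distribution"

definition normal_upper_quantile :: "real \<Rightarrow> real" where
  "normal_upper_quantile \<alpha> = Inf {x. std_normal_cdf x \<ge> 1 - \<alpha>}"

definition signal_to_noise :: "nat \<Rightarrow> real \<Rightarrow> (nat \<Rightarrow> real) \<Rightarrow> (nat \<Rightarrow> real) \<Rightarrow> real" where
  "signal_to_noise d \<sigma> \<mu>P \<mu>Q = L2_set (\<lambda>j. \<mu>P j - \<mu>Q j) {..<d} / \<sigma>"

definition gauss_kernel :: "nat \<Rightarrow> real \<Rightarrow> (nat \<Rightarrow> real) \<Rightarrow> (nat \<Rightarrow> real) \<Rightarrow> real" where
  "gauss_kernel d \<gamma> x y = exp (- (L2_set (\<lambda>j. x j - y j) {..<d})\<^sup>2 / \<gamma>\<^sup>2)"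

definition mmd_h ::
  "nat \<Rightarrow> real \<Rightarrow> (nat \<Rightarrow> real) \<times> (nat \<Rightarrow> real) \<Rightarrow> (nat \<Rightarrow> real) \<times> (nat \<Rightarrow> real) \<Rightarrow> real" where
  "mmd_h d \<gamma> = (\<lambda>(x, y) (x', y').
     gauss_kernel d \<gamma> x x' + gauss_kernel d \<gamma> y y' - gauss_kernel d \<gamma> x y' - gauss_kernel d \<gamma> x' y)"

text \<open>Samples are indexed by \<open>1, \<dots>, n\<close> with \<open>n\<close> even, so that the pairs \<open>(2i - 1, 2i)\<close> with
  \<open>1 \<le> i \<le> n/2\<close> exhaust them.\<close>

definition mmd_linear ::
  "nat \<Rightarrow> nat \<Rightarrow> real \<Rightarrow> (nat \<Rightarrow> nat \<Rightarrow> real) \<Rightarrow> (nat \<Rightarrow> nat \<Rightarrow> real) \<Rightarrow> real" where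
  "mmd_linear n d \<gamma> x y =
     1 / (real n / 2) * (\<Sum>i = 1..n div 2. mmd_h d \<gamma> (x (2*i - 1), y (2*i - 1)) (x (2*i), y (2*i)))"

definition mmd_variance ::
  "nat \<Rightarrow> nat \<Rightarrow> real \<Rightarrow> (nat \<Rightarrow> nat \<Rightarrow> real) \<Rightarrow> (nat \<Rightarrow> nat \<Rightarrow> real) \<Rightarrow> real" where
  "mmd_variance n d \<gamma> x y =
     2 * (1 / (real n / 2) * (\<Sum>i = 1..n div 2.
       (mmd_h d \<gamma> (x (2*i - 1), y (2*i - 1)) (x (2*i), y (2*i)) - mmd_linear n d \<gamma> x y)\<^sup>2))"

text \<open>If the empirical variance vanishes, the statistic below is \<open>0\<close> by the convention for division
  by zero.\<close>

definition mmd_rejects ::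
  "real \<Rightarrow> nat \<Rightarrow> nat \<Rightarrow> real \<Rightarrow> (nat \<Rightarrow> nat \<Rightarrow> real) \<Rightarrow> (nat \<Rightarrow> nat \<Rightarrow> real) \<Rightarrow> bool" where
  "mmd_rejects \<alpha> n d \<gamma> x y \<longleftrightarrow>
     sqrt (real n) * mmd_linear n d \<gamma> x y / sqrt (mmd_variance n d \<gamma> x y) > normal_upper_quantile \<alpha>"

definition mmd_rejection_prob ::
  "'a measure \<Rightarrow> real \<Rightarrow> nat \<Rightarrow> nat \<Rightarrow> real \<Rightarrow>
   (nat \<Rightarrow> 'a \<Rightarrow> nat \<Rightarrow> real) \<Rightarrow> (nat \<Rightarrow> 'a \<Rightarrow> nat \<Rightarrow> real) \<Rightarrow> real" where
  "mmd_rejection_prob M \<alpha> n d \<gamma> x y =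
     measure M {\<omega> \<in> space M. mmd_rejects \<alpha> n d \<gamma> (\<lambda>i. x i \<omega>) (\<lambda>i. y i \<omega>)}"

text \<open>The \<open>2n\<close> random vectors \<open>s\<^sub>i, t\<^sub>i\<close> are independent (\<open>Inl i\<close> labels \<open>s\<^sub>i\<close>, \<open>Inr i\<close> labels
  \<open>t\<^sub>i\<close>), and each of them has \<open>d\<close> independent coordinates of law \<open>\<nu>\<close>; in particular they all have
  the same distribution. Measurability is part of \<open>indep_vars\<close>.\<close>

definition iid_noise ::
  "'a measure \<Rightarrow> real measure \<Rightarrow> nat \<Rightarrow> nat \<Rightarrow>
   (nat \<Rightarrow> 'a \<Rightarrow> nat \<Rightarrow> real) \<Rightarrow> (nat \<Rightarrow> 'a \<Rightarrow> nat \<Rightarrow> real) \<Rightarrow> bool" where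
  "iid_noise M \<nu> n d s t \<longleftrightarrow>
     prob_space.indep_vars M (\<lambda>_. PiM {..<d} (\<lambda>_. borel)) (case_sum s t) ({1..n} <+> {1..n}) \<and>
     (\<forall>i\<in>{1..n}. \<forall>w\<in>{s i, t i}.
        prob_space.indep_vars M (\<lambda>_. borel) (\<lambda>j \<omega>. w \<omega> j) {..<d} \<and>
        (\<forall>j<d. distr M borel (\<lambda>\<omega>. w \<omega> j) = \<nu>))"

end

theory Submission
  imports Defs
begin

text \<open>After rotating by the transpose of \<open>U\<close>, the quantity \<open>h\<close> of a pair of observations depends only
  on the noise vectors \<open>s, t, s', t'\<close> and on \<open>e = U\<^sup>T (\<mu>\<^sub>P - \<mu>\<^sub>Q)\<close>, whose norm is \<open>\<sigma> \<Psi>\<close>. Put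
  \<open>g = 1 / \<gamma>\<^sup>2\<close>; the bandwidth condition says that \<open>g d\<close> stays below a constant \<open>K\<close>.

  Fluctuations. Each squared distance in \<open>h\<close> is \<open>2 d \<sigma>\<^sup>2\<close> (plus \<open>\<parallel>e\<parallel>\<^sup>2\<close> for the two mixed pairs) up to
  an error of order \<open>\<surd>d\<close>, or \<open>\<parallel>e\<parallel>\<close> for the part linear in \<open>e\<close>. Multiplied by \<open>g\<close> this error is small,
  so the exponentials can be linearised. In the linear term the squares cancel and a bilinear form
  remains: \<open>h = E h + 2 g \<tau> \<langle>s - t, s' - t'\<rangle> + \<dots>\<close> with \<open>\<tau> = exp (- 2 g d \<sigma>\<^sup>2)\<close>. The form has standard
  deviation \<open>2 \<sigma>\<^sup>2 \<surd>d\<close>, and the omitted terms are of smaller order in \<open>L\<^sup>2\<close>, because \<open>\<parallel>e\<parallel>\<^sup>2 = o(d)\<close> and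
  because the centred squared norm \<open>\<Sum> (D\<^sub>j\<^sup>2 - 2 \<sigma>\<^sup>2)\<close> of a difference \<open>D\<close> of two noise vectors has third
  absolute moment \<open>O(d\<^bsup>3/2\<^esup>)\<close>, which controls the Taylor remainders; this is where six moments of the
  coordinates are used. The lemma \<open>remainder2\<close> collects these estimates.

  Mean. By independence of the coordinates \<open>E h = 2 (\<psi>(0)\<^sup>d - \<Prod>\<psi>(e\<^sub>j))\<close>, where
  \<open>\<psi>(a) = E exp (- g (D + a)\<^sup>2)\<close> for the difference \<open>D\<close> of two independent coordinates. The law of \<open>D\<close> is
  symmetric, and this gives \<open>exp (- g a\<^sup>2) \<le> \<psi>(a) / \<psi>(0) \<le> exp (- g a\<^sup>2 / 2)\<close> once \<open>g\<close> and
  \<open>g a\<^sup>2\<close> are small. Hence \<open>E h\<close> lies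
  between constant multiples of \<open>g \<parallel>e\<parallel>\<^sup>2\<close> (\<open>mmd_mean_bounds\<close>), and the ratio of \<open>E h\<close> to the standard
  deviation \<open>4 g \<tau> \<sigma>\<^sup>2 \<surd>d\<close> of its leading part lies between constant multiples of \<open>\<Psi>\<^sup>2 / \<surd>d\<close>.

  Normal limit. The standardised values of \<open>h\<close> form an array, independent within each row, that
  differs in \<open>L\<^sup>2\<close> by a null sequence from an array with unit variances and bounded fourth moments. For such
  arrays the sums are asymptotically normal, the empirical variance is consistent, and the probability
  that the studentized mean plus an offset \<open>\<theta>\<^sub>k\<close> exceeds \<open>z\<close> is \<open>\<Phi>(\<theta>\<^sub>k - z) + o(1)\<close>
  (\<open>studentized_limit\<close>). The offset is allowed to diverge, which is why the distribution functions must
  converge uniformly. With \<open>\<theta>\<^sub>k = \<surd>(n/2) E h / (4 g \<tau> \<sigma>\<^sup>2 \<surd>d)\<close> this is the claim.\<close>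

section \<open>Moments of sums of independent variables\<close>

lemma (in prob_space) integrable_abs_le_power:
  fixes X :: "'a \<Rightarrow> real"
  assumes X: "random_variable borel X" and int: "integrable M (\<lambda>\<omega>. \<bar>X \<omega>\<bar> ^ m)" and "l \<le> m"
  shows "integrable M (\<lambda>\<omega>. \<bar>X \<omega>\<bar> ^ l)"
proof -
  note [measurable] = X
  have "\<bar>x\<bar> ^ l \<le> 1 + \<bar>x\<bar> ^ m" for x :: real
  proof (cases "\<bar>x\<bar> \<le> 1")
    case True
    then have "\<bar>x\<bar> ^ l \<le> 1" by (intro power_le_one) auto
    then show ?thesis by (rule order_trans) simp
  next
    case False
    then have "\<bar>x\<bar> ^ l \<le> \<bar>x\<bar> ^ m" using \<open>l \<le> m\<close> by (intro power_increasing) auto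
    then show ?thesis by simp
  qed
  then have *: "\<bar>\<bar>x\<bar> ^ l\<bar> \<le> \<bar>1 + \<bar>x\<bar> ^ m\<bar>" for x :: real
    by (simp add: abs_of_nonneg add_nonneg_nonneg)
  have "integrable M (\<lambda>\<omega>. 1 + \<bar>X \<omega>\<bar> ^ m)" using int by simp
  then show ?thesis
    by (rule Bochner_Integration.integrable_bound) (use * in auto)
qed

lemma (in prob_space) integrable_power_le_abs:
  fixes X :: "'a \<Rightarrow> real"
  assumes X: "random_variable borel X" and int: "integrable M (\<lambda>\<omega>. \<bar>X \<omega>\<bar> ^ m)" and "l \<le> m"
  shows "integrable M (\<lambda>\<omega>. X \<omega> ^ l)"
  using integrable_abs_le_power[OF assms]
  by (rule Bochner_Integration.integrable_bound) (use X in \<open>auto simp: power_abs\<close>)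

text \<open>For inductions over the number of summands: a partial sum is independent of the next term.\<close>

lemma (in prob_space) indep_vars_sum_Suc:
  fixes X :: "nat \<Rightarrow> 'a \<Rightarrow> real"
  assumes "indep_vars (\<lambda>_. borel) X {..<Suc n}"
  shows "indep_var borel (\<lambda>\<omega>. \<Sum>j<n. X j \<omega>) borel (X n)"
proof -
  have "indep_var
    borel ((\<lambda>f. \<Sum>j<n. f j) \<circ> (\<lambda>\<omega>. restrict (\<lambda>j. X j \<omega>) {..<n}))
    borel ((\<lambda>f. f n) \<circ> (\<lambda>\<omega>. restrict (\<lambda>j. X j \<omega>) {n}))"
    by (intro indep_var_compose[OF indep_var_restrict[OF assms]]) auto
  then show ?thesis by (simp add: o_def)
qed

lemma (in prob_space)
  fixes X :: "'i \<Rightarrow> 'a \<Rightarrow> real"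
  assumes "finite I" "indep_vars (\<lambda>_. borel) X I"
    and "\<And>i. i \<in> I \<Longrightarrow> integrable M (\<lambda>\<omega>. (X i \<omega>)\<^sup>2)" "\<And>i. i \<in> I \<Longrightarrow> expectation (X i) = 0"
  shows integrable_sum_power2: "integrable M (\<lambda>\<omega>. (\<Sum>i\<in>I. X i \<omega>)\<^sup>2)"
    and expectation_sum_power2: "expectation (\<lambda>\<omega>. (\<Sum>i\<in>I. X i \<omega>)\<^sup>2) = (\<Sum>i\<in>I. expectation (\<lambda>\<omega>. (X i \<omega>)\<^sup>2))"
proof -
  have "integrable M (\<lambda>\<omega>. (\<Sum>i\<in>I. X i \<omega>)\<^sup>2) \<and>
     expectation (\<lambda>\<omega>. (\<Sum>i\<in>I. X i \<omega>)\<^sup>2) = (\<Sum>i\<in>I. expectation (\<lambda>\<omega>. (X i \<omega>)\<^sup>2))" using assms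
  proof (induction I rule: finite_induct)
    case (insert a I)
    let ?S = "\<lambda>\<omega>. \<Sum>i\<in>I. X i \<omega>"
    have rv[measurable]: "random_variable borel (X i)" if "i \<in> insert a I" for i
      using insert.prems(1) that by (auto simp: indep_vars_def2)
    have [measurable]: "random_variable borel (X a)" "random_variable borel ?S" by (auto intro!: borel_measurable_sum rv)
    have "indep_vars (\<lambda>_. borel) X I" using insert.prems(1) by (rule indep_vars_subset) auto
    then have IH: "integrable M (\<lambda>\<omega>. (?S \<omega>)\<^sup>2)"
      "expectation (\<lambda>\<omega>. (?S \<omega>)\<^sup>2) = (\<Sum>i\<in>I. expectation (\<lambda>\<omega>. (X i \<omega>)\<^sup>2))"
      using insert.IH insert.prems(2,3) by auto
    have X2: "integrable M (\<lambda>\<omega>. (X a \<omega>)\<^sup>2)" and X1: "integrable M (X a)" and S1: "integrable M ?S"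
      using insert.prems(2) IH(1) by (auto intro: square_integrable_imp_integrable)
    note ind = indep_vars_sum[OF insert.hyps(1,2) insert.prems(1)]
    have cr: "integrable M (\<lambda>\<omega>. X a \<omega> * ?S \<omega>)" "expectation (\<lambda>\<omega>. X a \<omega> * ?S \<omega>) = 0"
      using indep_var_integrable[OF ind X1 S1] indep_var_lebesgue_integral[OF ind X1 S1] insert.prems(3) by auto
    have eq: "(\<Sum>i\<in>insert a I. X i \<omega>)\<^sup>2 = (X a \<omega>)\<^sup>2 + 2 * (X a \<omega> * ?S \<omega>) + (?S \<omega>)\<^sup>2" for \<omega>
      using insert.hyps by (simp add: power2_eq_square algebra_simps)
    show ?case unfolding eq using IH X2 cr insert.hyps by simp
  qed simp
  then show "integrable M (\<lambda>\<omega>. (\<Sum>i\<in>I. X i \<omega>)\<^sup>2)"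
    "expectation (\<lambda>\<omega>. (\<Sum>i\<in>I. X i \<omega>)\<^sup>2) = (\<Sum>i\<in>I. expectation (\<lambda>\<omega>. (X i \<omega>)\<^sup>2))" by auto
qed

text \<open>A second-order Taylor bound for the cube of the absolute value. Its linear term is a product whose
  expectation vanishes when \<open>x\<close> is centred and independent of \<open>s\<close>, so third absolute moments of sums
  can be estimated by induction on the number of summands.\<close>

lemma abs_cube_add_le:
  fixes s x :: real
  shows "\<bar>s + x\<bar> ^ 3 \<le> \<bar>s\<bar> ^ 3 + 3 * (s * \<bar>s\<bar>) * x + 3 * \<bar>s\<bar> * x\<^sup>2 + \<bar>x\<bar> ^ 3"
proof -
  have pos: "\<bar>s + x\<bar> ^ 3 \<le> \<bar>s\<bar> ^ 3 + 3 * (s * \<bar>s\<bar>) * x + 3 * \<bar>s\<bar> * x\<^sup>2 + \<bar>x\<bar> ^ 3" if "0 \<le> s" for s x :: real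
  proof (cases "0 \<le> s + x")
    case True
    have "x ^ 3 \<le> \<bar>x\<bar> ^ 3" by (metis abs_ge_self power_abs)
    then show ?thesis using True that by (simp add: power3_eq_cube power2_eq_square algebra_simps)
  next
    case False
    define y where "y = - x"
    have y: "s < y" "x = - y" "0 < y" using False that by (auto simp: y_def)
    have "0 \<le> s * ((s - 3 / 2 * y)\<^sup>2 + 3 / 4 * y\<^sup>2)" using that by (intro mult_nonneg_nonneg) auto
    then show ?thesis using y that by (simp add: power3_eq_cube power2_eq_square algebra_simps)
  qed
  show ?thesis
  proof (cases "0 \<le> s")
    case True then show ?thesis by (rule pos)
  next
    case False
    have "\<bar>- s + - x\<bar> = \<bar>s + x\<bar>" by simp
    then show ?thesis using pos[of "- s" "- x"] False by simp
  qed
qed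

lemma (in prob_space) expectation_abs_le_sqrt:
  fixes X :: "'a \<Rightarrow> real"
  assumes [measurable]: "random_variable borel X" and X2: "integrable M (\<lambda>\<omega>. (X \<omega>)\<^sup>2)"
  shows "expectation (\<lambda>\<omega>. \<bar>X \<omega>\<bar>) \<le> sqrt (expectation (\<lambda>\<omega>. (X \<omega>)\<^sup>2))"
proof -
  have i: "integrable M (\<lambda>\<omega>. \<bar>X \<omega>\<bar>)" using square_integrable_imp_integrable[OF _ X2] by auto
  have "0 \<le> variance (\<lambda>\<omega>. \<bar>X \<omega>\<bar>)" by simp
  also have "variance (\<lambda>\<omega>. \<bar>X \<omega>\<bar>) = expectation (\<lambda>\<omega>. (X \<omega>)\<^sup>2) - (expectation (\<lambda>\<omega>. \<bar>X \<omega>\<bar>))\<^sup>2"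
    using variance_eq[OF i] X2 by simp
  finally show ?thesis by (intro real_le_rsqrt) simp
qed

text \<open>The third absolute moment of a centred sum has order \<open>n\<^bsup>3/2\<^esup>\<close>. Adding one summand costs
  \<open>3 E \<bar>S\<bar> E X\<^sup>2 + E \<bar>X\<bar>\<^sup>3\<close>, and \<open>E \<bar>S\<bar>\<close> is at most the standard deviation of the sum.\<close>

lemma (in prob_space)
  fixes X :: "nat \<Rightarrow> 'a \<Rightarrow> real"
  assumes "indep_vars (\<lambda>_. borel) X {..<n}"
    and "\<And>j. j < n \<Longrightarrow> integrable M (\<lambda>\<omega>. \<bar>X j \<omega>\<bar> ^ 3)" "\<And>j. j < n \<Longrightarrow> expectation (X j) = 0"
    and "\<And>j. j < n \<Longrightarrow> expectation (\<lambda>\<omega>. (X j \<omega>)\<^sup>2) \<le> v"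
      "\<And>j. j < n \<Longrightarrow> expectation (\<lambda>\<omega>. \<bar>X j \<omega>\<bar> ^ 3) \<le> \<kappa>" and v: "0 \<le> v"
  shows integrable_sum_abs3: "integrable M (\<lambda>\<omega>. \<bar>\<Sum>j<n. X j \<omega>\<bar> ^ 3)"
    and expectation_sum_abs3_le:
      "expectation (\<lambda>\<omega>. \<bar>\<Sum>j<n. X j \<omega>\<bar> ^ 3) \<le> n * (3 * sqrt (n * v) * v + \<kappa>)"
proof -
  have "integrable M (\<lambda>\<omega>. \<bar>\<Sum>j<m. X j \<omega>\<bar> ^ 3) \<and>
      expectation (\<lambda>\<omega>. \<bar>\<Sum>j<m. X j \<omega>\<bar> ^ 3) \<le> m * (3 * sqrt (n * v) * v + \<kappa>)" if "m \<le> n" for m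
    using that
  proof (induction m)
    case (Suc m)
    let ?S = "\<lambda>\<omega>. \<Sum>j<m. X j \<omega>"
    have rv[measurable]: "random_variable borel (X j)" if "j < Suc m" for j
      using assms(1) that Suc.prems by (auto simp: indep_vars_def2)
    have [measurable]: "random_variable borel (X m)" "random_variable borel ?S" by (auto intro!: borel_measurable_sum rv)
    have pw: "integrable M (\<lambda>\<omega>. \<bar>X j \<omega>\<bar> ^ 2)" "integrable M (\<lambda>\<omega>. (X j \<omega>)\<^sup>2)" "integrable M (X j)" if "j < Suc m" for j
      using integrable_abs_le_power[of "X j" 3 2] integrable_power_le_abs[of "X j" 3 1] assms(2) that Suc.prems rv[OF that] by auto
    have indS: "indep_vars (\<lambda>_. borel) X {..<Suc m}"
      using assms(1) by (rule indep_vars_subset) (use Suc.prems in auto)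
    have indm: "indep_vars (\<lambda>_. borel) X {..<m}"
      using assms(1) by (rule indep_vars_subset) (use Suc.prems in auto)
    have IH: "integrable M (\<lambda>\<omega>. \<bar>?S \<omega>\<bar> ^ 3)" "expectation (\<lambda>\<omega>. \<bar>?S \<omega>\<bar> ^ 3) \<le> m * (3 * sqrt (n * v) * v + \<kappa>)"
      using Suc by auto
    have S2: "integrable M (\<lambda>\<omega>. (?S \<omega>)\<^sup>2)" and "expectation (\<lambda>\<omega>. (?S \<omega>)\<^sup>2) = (\<Sum>j<m. expectation (\<lambda>\<omega>. (X j \<omega>)\<^sup>2))"
      using integrable_sum_power2[OF _ indm] expectation_sum_power2[OF _ indm] pw assms(3) Suc.prems by auto
    note this(2)
    also have "\<dots> \<le> (\<Sum>j<m. v)" using assms(4) Suc.prems by (intro sum_mono) auto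
    also have "\<dots> \<le> n * v" using Suc.prems v by (simp add: mult_right_mono)
    finally have ES: "expectation (\<lambda>\<omega>. \<bar>?S \<omega>\<bar>) \<le> sqrt (n * v)"
      by (intro order_trans[OF expectation_abs_le_sqrt] S2 real_sqrt_le_mono) auto
    have ind: "indep_var borel ?S borel (X m)" by (rule indep_vars_sum_Suc[OF indS])
    have "integrable M ?S" by (rule square_integrable_imp_integrable[OF _ S2]) simp
    then have S1: "integrable M ?S" "integrable M (\<lambda>\<omega>. \<bar>?S \<omega>\<bar>)" by simp_all
    have S3: "integrable M (\<lambda>\<omega>. ?S \<omega> * \<bar>?S \<omega>\<bar>)"
      by (rule Bochner_Integration.integrable_bound[OF S2]) (auto simp: abs_mult power2_eq_square)
    have i1: "indep_var borel (\<lambda>\<omega>. ?S \<omega> * \<bar>?S \<omega>\<bar>) borel (X m)"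
      by (rule indep_var_compose[OF ind, of "\<lambda>s. s * \<bar>s\<bar>" borel "\<lambda>x. x" borel, unfolded o_def]) measurable
    have i2: "indep_var borel (\<lambda>\<omega>. \<bar>?S \<omega>\<bar>) borel (\<lambda>\<omega>. (X m \<omega>)\<^sup>2)"
      by (rule indep_var_compose[OF ind, of "\<lambda>s. \<bar>s\<bar>" borel "\<lambda>x. x\<^sup>2" borel, unfolded o_def]) measurable
    have c1: "integrable M (\<lambda>\<omega>. (?S \<omega> * \<bar>?S \<omega>\<bar>) * X m \<omega>)" "expectation (\<lambda>\<omega>. (?S \<omega> * \<bar>?S \<omega>\<bar>) * X m \<omega>) = 0"
      using indep_var_integrable[OF i1 S3] indep_var_lebesgue_integral[OF i1 S3] pw assms(3) Suc.prems by auto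
    have c2: "integrable M (\<lambda>\<omega>. \<bar>?S \<omega>\<bar> * (X m \<omega>)\<^sup>2)"
      "expectation (\<lambda>\<omega>. \<bar>?S \<omega>\<bar> * (X m \<omega>)\<^sup>2) = expectation (\<lambda>\<omega>. \<bar>?S \<omega>\<bar>) * expectation (\<lambda>\<omega>. (X m \<omega>)\<^sup>2)"
      using indep_var_integrable[OF i2 S1(2)] indep_var_lebesgue_integral[OF i2 S1(2)] pw by auto
    have c2': "expectation (\<lambda>\<omega>. \<bar>?S \<omega>\<bar>) * expectation (\<lambda>\<omega>. (X m \<omega>)\<^sup>2) \<le> sqrt (n * v) * v"
      using ES assms(4)[of m] Suc.prems v by (intro mult_mono) auto
    let ?B = "\<lambda>\<omega>. \<bar>?S \<omega>\<bar> ^ 3 + 3 * ((?S \<omega> * \<bar>?S \<omega>\<bar>) * X m \<omega>) + 3 * (\<bar>?S \<omega>\<bar> * (X m \<omega>)\<^sup>2) + \<bar>X m \<omega>\<bar> ^ 3"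
    have ptw: "\<bar>\<Sum>j<Suc m. X j \<omega>\<bar> ^ 3 \<le> ?B \<omega>" for \<omega>
      using abs_cube_add_le[of "?S \<omega>" "X m \<omega>"] by (simp add: mult.assoc)
    have Bint: "integrable M ?B" using IH c1 c2 assms(2) Suc.prems by simp
    have int: "integrable M (\<lambda>\<omega>. \<bar>\<Sum>j<Suc m. X j \<omega>\<bar> ^ 3)"
      by (rule Bochner_Integration.integrable_bound[OF Bint]) (use ptw in \<open>auto intro!: order_trans[OF _ abs_ge_self]\<close>)
    have "expectation (\<lambda>\<omega>. \<bar>\<Sum>j<Suc m. X j \<omega>\<bar> ^ 3) \<le> expectation ?B"
      by (intro integral_mono int Bint ptw)
    also have "\<dots> = expectation (\<lambda>\<omega>. \<bar>?S \<omega>\<bar> ^ 3) + 3 * (expectation (\<lambda>\<omega>. \<bar>?S \<omega>\<bar>) * expectation (\<lambda>\<omega>. (X m \<omega>)\<^sup>2))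
        + expectation (\<lambda>\<omega>. \<bar>X m \<omega>\<bar> ^ 3)"
      using IH c1 c2 assms(2)[of m] Suc.prems by simp
    also have "\<dots> \<le> m * (3 * sqrt (n * v) * v + \<kappa>) + 3 * (sqrt (n * v) * v) + \<kappa>"
      using IH(2) c2' assms(5)[of m] Suc.prems by (intro add_mono mult_left_mono) auto
    finally show ?case using int by (simp add: algebra_simps)
  qed simp
  from this[of n] show "integrable M (\<lambda>\<omega>. \<bar>\<Sum>j<n. X j \<omega>\<bar> ^ 3)"
    "expectation (\<lambda>\<omega>. \<bar>\<Sum>j<n. X j \<omega>\<bar> ^ 3) \<le> n * (3 * sqrt (n * v) * v + \<kappa>)" by auto
qed

text \<open>Of the mixed terms in the expansion of \<open>(S + X)\<^sup>4\<close> only \<open>6 E S\<^sup>2 E X\<^sup>2\<close> survives, so the fourth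
  moment of a centred sum has order \<open>n\<^sup>2\<close>.\<close>

lemma (in prob_space)
  fixes X :: "nat \<Rightarrow> 'a \<Rightarrow> real"
  assumes "indep_vars (\<lambda>_. borel) X {..<n}"
    and "\<And>j. j < n \<Longrightarrow> integrable M (\<lambda>\<omega>. X j \<omega> ^ 4)" "\<And>j. j < n \<Longrightarrow> expectation (X j) = 0"
    and "\<And>j. j < n \<Longrightarrow> expectation (\<lambda>\<omega>. (X j \<omega>)\<^sup>2) \<le> v"
      "\<And>j. j < n \<Longrightarrow> expectation (\<lambda>\<omega>. X j \<omega> ^ 4) \<le> \<kappa>" and v: "0 \<le> v"
  shows integrable_sum_power4: "integrable M (\<lambda>\<omega>. (\<Sum>j<n. X j \<omega>) ^ 4)"
    and expectation_sum_power4_le: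
      "expectation (\<lambda>\<omega>. (\<Sum>j<n. X j \<omega>) ^ 4) \<le> n * (6 * (n * v) * v + \<kappa>)"
proof -
  have "integrable M (\<lambda>\<omega>. (\<Sum>j<m. X j \<omega>) ^ 4) \<and>
      expectation (\<lambda>\<omega>. (\<Sum>j<m. X j \<omega>) ^ 4) \<le> m * (6 * (n * v) * v + \<kappa>)" if "m \<le> n" for m
    using that
  proof (induction m)
    case (Suc m)
    let ?S = "\<lambda>\<omega>. \<Sum>j<m. X j \<omega>"
    have rv[measurable]: "random_variable borel (X j)" if "j < Suc m" for j
      using assms(1) that Suc.prems by (auto simp: indep_vars_def2)
    have rS[measurable]: "random_variable borel (X m)" "random_variable borel ?S" by (auto intro!: borel_measurable_sum rv)
    have pw: "integrable M (\<lambda>\<omega>. X j \<omega> ^ l)" if "j < Suc m" "l \<le> 4" for j l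
      using integrable_power_le_abs[of "X j" 4 l] assms(2) that Suc.prems rv[OF that(1)] by (auto simp: power_even_abs)
    note pw1 = pw[of _ 1, simplified]
    have indS: "indep_vars (\<lambda>_. borel) X {..<Suc m}"
      using assms(1) by (rule indep_vars_subset) (use Suc.prems in auto)
    have indm: "indep_vars (\<lambda>_. borel) X {..<m}"
      using assms(1) by (rule indep_vars_subset) (use Suc.prems in auto)
    have IH: "integrable M (\<lambda>\<omega>. ?S \<omega> ^ 4)" "expectation (\<lambda>\<omega>. ?S \<omega> ^ 4) \<le> m * (6 * (n * v) * v + \<kappa>)"
      using Suc by auto
    have Sl: "integrable M (\<lambda>\<omega>. ?S \<omega> ^ l)" if "l \<le> 4" for l
      using integrable_power_le_abs[of ?S 4 l] IH(1) that rS(2) by (auto simp: power_even_abs)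
    note S1 = Sl[of 1, simplified]
    have "expectation (\<lambda>\<omega>. (?S \<omega>)\<^sup>2) = (\<Sum>j<m. expectation (\<lambda>\<omega>. (X j \<omega>)\<^sup>2))"
      using expectation_sum_power2[OF _ indm] pw assms(3) Suc.prems by auto
    also have "\<dots> \<le> (\<Sum>j<m. v)" using assms(4) Suc.prems by (intro sum_mono) auto
    also have "\<dots> \<le> n * v" using Suc.prems v by (simp add: mult_right_mono)
    finally have ES: "expectation (\<lambda>\<omega>. (?S \<omega>)\<^sup>2) \<le> n * v" .
    have ES1: "expectation ?S = 0" using pw1 assms(3) Suc.prems by simp
    have ind: "indep_var borel ?S borel (X m)" by (rule indep_vars_sum_Suc[OF indS])
    have ic: "indep_var borel (\<lambda>\<omega>. ?S \<omega> ^ a) borel (\<lambda>\<omega>. X m \<omega> ^ b)" for a b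
      by (rule indep_var_compose[OF ind, of "\<lambda>s. s ^ a" borel "\<lambda>x. x ^ b" borel, unfolded o_def]) measurable
    have c: "integrable M (\<lambda>\<omega>. ?S \<omega> ^ a * X m \<omega> ^ b)"
      "expectation (\<lambda>\<omega>. ?S \<omega> ^ a * X m \<omega> ^ b) = expectation (\<lambda>\<omega>. ?S \<omega> ^ a) * expectation (\<lambda>\<omega>. X m \<omega> ^ b)"
      if "a \<le> 4" "b \<le> 4" for a b
      using indep_var_integrable[OF ic Sl pw] indep_var_lebesgue_integral[OF ic Sl pw] that by auto
    have c2': "expectation (\<lambda>\<omega>. (?S \<omega>)\<^sup>2) * expectation (\<lambda>\<omega>. (X m \<omega>)\<^sup>2) \<le> (n * v) * v"
      using ES assms(4)[of m] Suc.prems v by (intro mult_mono) auto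
    have eq: "(\<Sum>j<Suc m. X j \<omega>) ^ 4 = ?S \<omega> ^ 4 + 4 * (?S \<omega> ^ 3 * X m \<omega> ^ 1) + 6 * (?S \<omega> ^ 2 * X m \<omega> ^ 2)
        + 4 * (?S \<omega> ^ 1 * X m \<omega> ^ 3) + X m \<omega> ^ 4" for \<omega>
      by (simp add: power4_eq_xxxx power3_eq_cube power2_eq_square algebra_simps)
    have int: "integrable M (\<lambda>\<omega>. (\<Sum>j<Suc m. X j \<omega>) ^ 4)"
      unfolding eq using IH(1) c(1)[of 3 1] c(1)[of 2 2] c(1)[of 1 3] assms(2)[of m] Suc.prems
      by (intro Bochner_Integration.integrable_add integrable_mult_right) linarith+
    have "expectation (\<lambda>\<omega>. (\<Sum>j<Suc m. X j \<omega>) ^ 4) = expectation (\<lambda>\<omega>. ?S \<omega> ^ 4)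
        + 4 * expectation (\<lambda>\<omega>. ?S \<omega> ^ 3 * X m \<omega> ^ 1) + 6 * expectation (\<lambda>\<omega>. ?S \<omega> ^ 2 * X m \<omega> ^ 2)
        + 4 * expectation (\<lambda>\<omega>. ?S \<omega> ^ 1 * X m \<omega> ^ 3) + expectation (\<lambda>\<omega>. X m \<omega> ^ 4)"
      unfolding eq using IH c(1)[of 3 1] c(1)[of 2 2] c(1)[of 1 3] assms(2)[of m] Suc.prems
      by (simp add: Bochner_Integration.integral_add Bochner_Integration.integrable_add del: power_one_right)
    also have "\<dots> = expectation (\<lambda>\<omega>. ?S \<omega> ^ 4) + 6 * (expectation (\<lambda>\<omega>. ?S \<omega> ^ 2) * expectation (\<lambda>\<omega>. X m \<omega> ^ 2))
        + expectation (\<lambda>\<omega>. X m \<omega> ^ 4)"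
      using c(2)[of 3 1] c(2)[of 2 2] c(2)[of 1 3] ES1 assms(3)[of m] Suc.prems by simp
    also have "\<dots> \<le> m * (6 * (n * v) * v + \<kappa>) + 6 * ((n * v) * v) + \<kappa>"
      using IH(2) c2' assms(5)[of m] Suc.prems by (intro add_mono mult_left_mono) auto
    finally show ?case using int by (simp add: algebra_simps)
  qed simp
  from this[of n] show "integrable M (\<lambda>\<omega>. (\<Sum>j<n. X j \<omega>) ^ 4)"
    "expectation (\<lambda>\<omega>. (\<Sum>j<n. X j \<omega>) ^ 4) \<le> n * (6 * (n * v) * v + \<kappa>)" by auto
qed

section \<open>Uniform convergence to the normal distribution function\<close>

lemma std_normal_cdf_lipschitz:
  assumes "u \<le> v"
  shows "std_normal_cdf v - std_normal_cdf u \<le> v - u"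
proof -
  interpret N: real_distribution std_normal_distribution by (rule real_dist_normal_dist)
  have dens: "std_normal_density x \<le> 1" for x
  proof -
    have "exp (- x\<^sup>2 / 2) \<le> 1" by simp
    moreover have "1 \<le> sqrt (2 * pi)" using pi_ge_two by simp
    ultimately have "exp (- x\<^sup>2 / 2) \<le> sqrt (2 * pi)" by (rule order_trans)
    then show ?thesis unfolding std_normal_density_def by (simp add: divide_le_eq)
  qed
  have "emeasure std_normal_distribution {u<..v}
      = (\<integral>\<^sup>+x. ennreal (std_normal_density x) * indicator {u<..v} x \<partial>lborel)"
    by (subst emeasure_density) auto
  also have "\<dots> \<le> (\<integral>\<^sup>+x. indicator {u<..v} x \<partial>lborel)"
    by (intro nn_integral_mono) (auto simp: indicator_def dens)
  also have "\<dots> = ennreal (v - u)" using assms by simp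
  finally have "measure std_normal_distribution {u<..v} \<le> v - u"
    using assms by (simp add: N.emeasure_eq_measure)
  then show ?thesis
    using N.cdf_diff_eq[of u v] assms unfolding std_normal_cdf_def by (cases "u = v") auto
qed

lemma std_normal_cdf_mono: "u \<le> v \<Longrightarrow> std_normal_cdf u \<le> std_normal_cdf v"
proof -
  interpret N: real_distribution std_normal_distribution by (rule real_dist_normal_dist)
  show "u \<le> v \<Longrightarrow> ?thesis" unfolding std_normal_cdf_def by (rule N.cdf_nondecreasing)
qed

lemma std_normal_cdf_at_top: "(std_normal_cdf \<longlongrightarrow> 1) at_top"
proof -
  interpret N: real_distribution std_normal_distribution by (rule real_dist_normal_dist)
  show ?thesis unfolding std_normal_cdf_def by (rule N.cdf_lim_at_top_prob)
qed

lemma std_normal_cdf_at_bot: "(std_normal_cdf \<longlongrightarrow> 0) at_bot"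
proof -
  interpret N: real_distribution std_normal_distribution by (rule real_dist_normal_dist)
  show ?thesis unfolding std_normal_cdf_def by (rule N.cdf_lim_at_bot)
qed

text \<open>Polya's theorem for the normal limit: it suffices to control the distribution functions on a grid so
  fine that the Lipschitz function \<open>\<Phi>\<close> grows by little between neighbours, and so wide that little mass
  lies outside; monotonicity does the rest.\<close>

lemma std_normal_weak_conv_uniform:
  assumes D: "\<And>k. real_distribution (D k)"
    and conv: "weak_conv_m D std_normal_distribution" and "0 < \<epsilon>"
  shows "\<forall>\<^sub>F k in sequentially. \<forall>u. \<bar>cdf (D k) u - std_normal_cdf u\<bar> \<le> \<epsilon>"
proof -
  interpret N: real_distribution std_normal_distribution by (rule real_dist_normal_dist)
  define h where "h = \<epsilon> / 2"
  have h: "0 < h" "2 * h = \<epsilon>" using \<open>0 < \<epsilon>\<close> by (auto simp: h_def)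
  have ptw: "(\<lambda>k. cdf (D k) u) \<longlonglongrightarrow> std_normal_cdf u" for u
  proof -
    have "isCont (cdf std_normal_distribution) u"
    proof -
      have "AE x in lborel. x \<in> {u} \<longrightarrow> ennreal (std_normal_density x) = 0"
        using AE_lborel_singleton[of u] by (rule eventually_mono) simp
      then have "{u} \<in> null_sets std_normal_distribution"
        by (intro null_sets_density_iff[THEN iffD2] conjI) auto
      then show ?thesis unfolding N.isCont_cdf by (auto simp: measure_def null_sets_def)
    qed
    then show ?thesis using conv unfolding weak_conv_m_def weak_conv_def std_normal_cdf_def by auto
  qed
  obtain a where a: "std_normal_cdf a < h"
  proof -
    have "\<forall>\<^sub>F x in at_bot. std_normal_cdf x < h"
      using order_tendstoD(2)[OF std_normal_cdf_at_bot] h by auto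
    then show ?thesis using that eventually_happens'[OF trivial_limit_at_bot_linorder] by blast
  qed
  obtain b where b: "1 - h < std_normal_cdf b"
  proof -
    have "\<forall>\<^sub>F x in at_top. 1 - h < std_normal_cdf x"
      using order_tendstoD(1)[OF std_normal_cdf_at_top, of "1 - h"] h by auto
    then show ?thesis using that eventually_happens'[OF trivial_limit_at_top_linorder] by blast
  qed
  define m where "m = nat \<lceil>(b - a) / h\<rceil>"
  define p where "p i = a + real i * h" for i
  have pm: "b \<le> p m"
  proof -
    have "(b - a) / h \<le> real m" unfolding m_def by linarith
    then show ?thesis unfolding p_def using h by (simp add: field_simps)
  qed
  have "\<forall>\<^sub>F k in sequentially. \<forall>i\<in>{..m}. \<bar>cdf (D k) (p i) - std_normal_cdf (p i)\<bar> < h"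
  proof (rule eventually_ball_finite)
    show "\<forall>i\<in>{..m}. \<forall>\<^sub>F k in sequentially. \<bar>cdf (D k) (p i) - std_normal_cdf (p i)\<bar> < h"
    proof
      fix i show "\<forall>\<^sub>F k in sequentially. \<bar>cdf (D k) (p i) - std_normal_cdf (p i)\<bar> < h"
        using tendstoD[OF ptw \<open>0 < h\<close>] by (simp add: dist_real_def)
    qed
  qed simp
  then show ?thesis
  proof eventually_elim
    case (elim k)
    interpret Dk: real_distribution "D k" by (rule D)
    have mono: "cdf (D k) u \<le> cdf (D k) v" if "u \<le> v" for u v
      using that by (rule Dk.cdf_nondecreasing)
    have rng: "0 \<le> cdf (D k) u" "cdf (D k) u \<le> 1" "0 \<le> std_normal_cdf u" "std_normal_cdf u \<le> 1" for u
      using Dk.cdf_nonneg Dk.cdf_bounded_prob N.cdf_nonneg N.cdf_bounded_prob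
      by (auto simp: std_normal_cdf_def)
    have close: "\<bar>cdf (D k) (p i) - std_normal_cdf (p i)\<bar> < h" if "i \<le> m" for i
      using elim that by auto
    show ?case
    proof
      fix u
      consider "u < a" | "p m \<le> u" | "a \<le> u" "u < p m" by linarith
      then show "\<bar>cdf (D k) u - std_normal_cdf u\<bar> \<le> \<epsilon>"
      proof cases
        case 1
        then have "cdf (D k) u \<le> cdf (D k) a" "std_normal_cdf u \<le> std_normal_cdf a"
          by (auto intro: mono std_normal_cdf_mono)
        moreover have "p 0 = a" by (simp add: p_def)
        ultimately show ?thesis using close[of 0] a rng[of u] h by auto
      next
        case 2
        then have "cdf (D k) (p m) \<le> cdf (D k) u" "std_normal_cdf (p m) \<le> std_normal_cdf u"
          "std_normal_cdf b \<le> std_normal_cdf (p m)"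
          using pm by (auto intro: mono std_normal_cdf_mono)
        then show ?thesis using close[of m] b rng[of u] h by auto
      next
        case 3
        define i where "i = nat \<lfloor>(u - a) / h\<rfloor>"
        have "real i \<le> (u - a) / h" "(u - a) / h < real i + 1"
          using 3 h unfolding i_def by (auto simp: of_nat_nat)
        then have i: "p i \<le> u" "u < p (Suc i)"
          using h by (auto simp: p_def field_simps)
        have "p i < p m" using i 3 by linarith
        then have im: "Suc i \<le> m" using h by (simp add: p_def)
        have step: "p (Suc i) = p i + h" by (simp add: p_def algebra_simps)
        have "cdf (D k) (p i) \<le> cdf (D k) u" "cdf (D k) u \<le> cdf (D k) (p (Suc i))"
          using i by (auto intro: mono)
        moreover have "std_normal_cdf (p (Suc i)) - std_normal_cdf u \<le> h"
          "std_normal_cdf u - std_normal_cdf (p i) \<le> h"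
          using std_normal_cdf_lipschitz[of u "p (Suc i)"] std_normal_cdf_lipschitz[of "p i" u] i step
          by auto
        ultimately show ?thesis using close[of i] close[of "Suc i"] im h by linarith
      qed
    qed
  qed
qed

section \<open>Studentized means of perturbed arrays\<close>

text \<open>Row \<open>k\<close> of the array lives on its own probability space \<open>M k\<close>. The variables of interest are the
  \<open>H k i\<close>; their principal parts \<open>W k i\<close> have enough moments for classical arguments, and the
  differences, of which only second moments are controlled, disappear in the limit.\<close>

locale perturbed_array =
  fixes M :: "nat \<Rightarrow> 'a measure" and N :: "nat \<Rightarrow> nat"
    and H W :: "nat \<Rightarrow> nat \<Rightarrow> 'a \<Rightarrow> real" and \<epsilon> :: "nat \<Rightarrow> real" and C :: real
  assumes prob: "prob_space (M k)"
    and N_pos: "0 < N k" and N_lim: "filterlim N at_top sequentially"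
    and indep_H: "prob_space.indep_vars (M k) (\<lambda>_. borel) (H k) {1..N k}"
    and indep_W: "prob_space.indep_vars (M k) (\<lambda>_. borel) (W k) {1..N k}"
    and mean_H: "i \<in> {1..N k} \<Longrightarrow> (LINT \<omega>|M k. H k i \<omega>) = 0"
    and W4_int: "i \<in> {1..N k} \<Longrightarrow> integrable (M k) (\<lambda>\<omega>. W k i \<omega> ^ 4)"
    and W2: "i \<in> {1..N k} \<Longrightarrow> (LINT \<omega>|M k. (W k i \<omega>)\<^sup>2) = 1"
    and W4: "i \<in> {1..N k} \<Longrightarrow> (LINT \<omega>|M k. W k i \<omega> ^ 4) \<le> C"
    and R2_int: "i \<in> {1..N k} \<Longrightarrow> integrable (M k) (\<lambda>\<omega>. (H k i \<omega> - W k i \<omega>)\<^sup>2)"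
    and R2: "i \<in> {1..N k} \<Longrightarrow> (LINT \<omega>|M k. (H k i \<omega> - W k i \<omega>)\<^sup>2) \<le> (\<epsilon> k)\<^sup>2"
    and \<epsilon>_pos: "0 < \<epsilon> k" and \<epsilon>_lim: "\<epsilon> \<longlonglongrightarrow> 0"
begin

lemma measurable_H: "i \<in> {1..N k} \<Longrightarrow> H k i \<in> borel_measurable (M k)"
  using indep_H[of k] by (simp add: prob_space.indep_vars_def2[OF prob])

lemma measurable_W: "i \<in> {1..N k} \<Longrightarrow> W k i \<in> borel_measurable (M k)"
  using indep_W[of k] by (simp add: prob_space.indep_vars_def2[OF prob])

lemma W2_int:
  assumes "i \<in> {1..N k}" shows "integrable (M k) (\<lambda>\<omega>. (W k i \<omega>)\<^sup>2)"
proof -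
  interpret prob_space "M k" by (rule prob)
  note [measurable] = measurable_W[OF assms]
  show ?thesis
    by (rule square_integrable_imp_integrable) (use W4_int[OF assms] in \<open>auto simp flip: power_mult\<close>)
qed

lemma
  assumes "i \<in> {1..N k}"
  shows H2_int: "integrable (M k) (\<lambda>\<omega>. (H k i \<omega>)\<^sup>2)"
    and H2_W2_int: "integrable (M k) (\<lambda>\<omega>. \<bar>(H k i \<omega>)\<^sup>2 - (W k i \<omega>)\<^sup>2\<bar>)"
    and H2_W2: "(LINT \<omega>|M k. \<bar>(H k i \<omega>)\<^sup>2 - (W k i \<omega>)\<^sup>2\<bar>) \<le> 2 * \<epsilon> k + (\<epsilon> k)\<^sup>2"
proof -
  interpret prob_space "M k" by (rule prob)
  note [measurable] = measurable_H[OF assms] measurable_W[OF assms]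
  note [simp] = W2_int[OF assms] R2_int[OF assms]
  define e where "e = \<epsilon> k"
  have e: "0 < e" using \<epsilon>_pos by (simp add: e_def)
  \<comment> \<open>A weighted form of the inequality of the means; with the weight \<open>e\<close> both parts contribute order \<open>e\<close>.\<close>
  have ptw: "\<bar>h\<^sup>2 - w\<^sup>2\<bar> \<le> e * w\<^sup>2 + (1 / e + 1) * (h - w)\<^sup>2" for h w :: real
  proof -
    define r where "r = h - w"
    have "2 * \<bar>w * r\<bar> \<le> e * w\<^sup>2 + r\<^sup>2 / e"
    proof -
      have "0 \<le> (e * \<bar>w\<bar> - \<bar>r\<bar>)\<^sup>2 / e" using e by simp
      also have "\<dots> = e * w\<^sup>2 + r\<^sup>2 / e - 2 * \<bar>w * r\<bar>"
        using e by (simp add: power2_eq_square field_simps abs_mult)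
      finally show ?thesis by simp
    qed
    moreover have "h\<^sup>2 - w\<^sup>2 = 2 * (w * r) + r\<^sup>2"
      by (simp add: r_def power2_eq_square algebra_simps)
    moreover have "\<bar>2 * (w * r) + r\<^sup>2\<bar> \<le> 2 * \<bar>w * r\<bar> + r\<^sup>2"
      by (rule order_trans[OF abs_triangle_ineq]) (simp add: abs_mult)
    ultimately have "\<bar>h\<^sup>2 - w\<^sup>2\<bar> \<le> e * w\<^sup>2 + r\<^sup>2 / e + r\<^sup>2" by simp
    then show ?thesis by (simp add: r_def algebra_simps)
  qed
  have int: "integrable (M k) (\<lambda>\<omega>. e * (W k i \<omega>)\<^sup>2 + (1 / e + 1) * (H k i \<omega> - W k i \<omega>)\<^sup>2)"
    by (intro Bochner_Integration.integrable_add integrable_mult_right) auto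
  show *: "integrable (M k) (\<lambda>\<omega>. \<bar>(H k i \<omega>)\<^sup>2 - (W k i \<omega>)\<^sup>2\<bar>)"
    by (rule Bochner_Integration.integrable_bound[OF int])
      (use ptw in \<open>auto intro!: order_trans[OF _ abs_ge_self]\<close>)
  have "integrable (M k) (\<lambda>\<omega>. (W k i \<omega>)\<^sup>2 + \<bar>(H k i \<omega>)\<^sup>2 - (W k i \<omega>)\<^sup>2\<bar>)" using * by simp
  then show "integrable (M k) (\<lambda>\<omega>. (H k i \<omega>)\<^sup>2)"
    by (rule Bochner_Integration.integrable_bound) auto
  have "(LINT \<omega>|M k. \<bar>(H k i \<omega>)\<^sup>2 - (W k i \<omega>)\<^sup>2\<bar>)
      \<le> (LINT \<omega>|M k. e * (W k i \<omega>)\<^sup>2 + (1 / e + 1) * (H k i \<omega> - W k i \<omega>)\<^sup>2)"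
    by (intro integral_mono * int ptw)
  also have "\<dots> = e + (1 / e + 1) * (LINT \<omega>|M k. (H k i \<omega> - W k i \<omega>)\<^sup>2)"
    using W2[OF assms] by simp
  also have "\<dots> \<le> e + (1 / e + 1) * e\<^sup>2"
    using R2[OF assms] e unfolding e_def by (intro add_left_mono mult_left_mono) auto
  also have "\<dots> = 2 * e + e\<^sup>2" using e by (simp add: field_simps power2_eq_square)
  finally show "(LINT \<omega>|M k. \<bar>(H k i \<omega>)\<^sup>2 - (W k i \<omega>)\<^sup>2\<bar>) \<le> 2 * \<epsilon> k + (\<epsilon> k)\<^sup>2"
    by (simp add: e_def)
qed

lemma H_int: "i \<in> {1..N k} \<Longrightarrow> integrable (M k) (H k i)"
proof -
  assume i: "i \<in> {1..N k}"
  interpret prob_space "M k" by (rule prob)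
  show ?thesis by (rule square_integrable_imp_integrable[OF measurable_H[OF i] H2_int[OF i]])
qed

lemma H2_near_1:
  assumes "i \<in> {1..N k}"
  shows "\<bar>(LINT \<omega>|M k. (H k i \<omega>)\<^sup>2) - 1\<bar> \<le> 2 * \<epsilon> k + (\<epsilon> k)\<^sup>2"
proof -
  have "(LINT \<omega>|M k. (H k i \<omega>)\<^sup>2) - 1 = (LINT \<omega>|M k. (H k i \<omega>)\<^sup>2 - (W k i \<omega>)\<^sup>2)"
    using H2_int[OF assms] W2_int[OF assms] W2[OF assms] by simp
  also have "\<bar>\<dots>\<bar> \<le> (LINT \<omega>|M k. \<bar>(H k i \<omega>)\<^sup>2 - (W k i \<omega>)\<^sup>2\<bar>)" by (rule integral_abs_bound)
  finally show ?thesis using H2_W2[OF assms] by simp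
qed

text \<open>The third-order Taylor estimate of a characteristic function involves
  \<open>min (6 H\<^sup>2) (\<bar>u\<bar> \<bar>H\<bar>\<^sup>3)\<close>. Where the perturbation dominates, the first entry of the minimum is at most
  \<open>24 (H - W)\<^sup>2\<close>; elsewhere the second is at most \<open>8 \<bar>u\<bar> \<bar>W\<bar>\<^sup>3\<close>. So third moments are taken of \<open>W\<close> only.\<close>

lemma char_near_gaussian:
  assumes "i \<in> {1..N k}"
  shows "cmod (char (distr (M k) borel (H k i)) u - exp (- u\<^sup>2 / 2))
    \<le> u\<^sup>2 / 6 * (24 * (\<epsilon> k)\<^sup>2 + 8 * \<bar>u\<bar> * (1 + C)) + u\<^sup>2 / 2 * (2 * \<epsilon> k + (\<epsilon> k)\<^sup>2) + u ^ 4 / 8"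
proof -
  interpret prob_space "M k" by (rule prob)
  note [measurable] = measurable_H[OF assms] measurable_W[OF assms]
  let ?X = "H k i" and ?Y = "W k i" and ?\<phi> = "char (distr (M k) borel (H k i)) u"
  define v where "v = expectation (\<lambda>\<omega>. (?X \<omega>)\<^sup>2)"
  have var: "variance ?X = v" using mean_H[OF assms] by (simp add: v_def)
  have "cmod (?\<phi> - (1 - u\<^sup>2 * v / 2))
      \<le> u\<^sup>2 / 6 * expectation (\<lambda>\<omega>. min (6 * (?X \<omega>)\<^sup>2) (\<bar>u\<bar> * \<bar>?X \<omega>\<bar> ^ 3))"
    by (rule char_approx3'[OF _ H_int[OF assms] H2_int[OF assms] mean_H[OF assms] var]) auto
  also have "\<dots> \<le> u\<^sup>2 / 6 * (24 * (\<epsilon> k)\<^sup>2 + 8 * \<bar>u\<bar> * (1 + C))"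
  proof (rule mult_left_mono)
    have ptw: "min (6 * h\<^sup>2) (\<bar>u\<bar> * \<bar>h\<bar> ^ 3) \<le> 24 * (h - w)\<^sup>2 + 8 * \<bar>u\<bar> * (1 + w ^ 4)" for h w :: real
    proof (cases "\<bar>h - w\<bar> \<le> \<bar>w\<bar>")
      case True
      then have "\<bar>h\<bar> ^ 3 \<le> (2 * \<bar>w\<bar>) ^ 3" by (intro power_mono) auto
      also have "\<dots> = 8 * \<bar>w\<bar> ^ 3" by (simp add: power_mult_distrib)
      also have "\<bar>w\<bar> ^ 3 \<le> 1 + w ^ 4"
      proof (cases "\<bar>w\<bar> \<le> 1")
        case True
        then have "\<bar>w\<bar> ^ 3 \<le> 1" by (intro power_le_one) auto
        then show ?thesis by (intro order_trans[OF \<open>\<bar>w\<bar> ^ 3 \<le> 1\<close>]) simp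
      next
        case False
        then have "\<bar>w\<bar> ^ 3 \<le> \<bar>w\<bar> ^ 4" by (intro power_increasing) auto
        then show ?thesis by simp
      qed
      finally have "\<bar>u\<bar> * \<bar>h\<bar> ^ 3 \<le> \<bar>u\<bar> * (8 * (1 + w ^ 4))" by (intro mult_left_mono) auto
      moreover have "\<bar>u\<bar> * (8 * (1 + w ^ 4)) = 8 * \<bar>u\<bar> * (1 + w ^ 4)" by simp
      moreover have "0 \<le> 24 * (h - w)\<^sup>2" by simp
      ultimately show ?thesis by linarith
    next
      case False
      then have "\<bar>h\<bar> \<le> 2 * \<bar>h - w\<bar>" using abs_triangle_ineq[of "h - w" w] by simp
      then have "\<bar>h\<bar> \<le> \<bar>2 * (h - w)\<bar>" by (simp only: abs_mult abs_numeral)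
      then have "h\<^sup>2 \<le> (2 * (h - w))\<^sup>2" by (simp only: abs_le_square_iff)
      also have "(2 * (h - w))\<^sup>2 = 4 * (h - w)\<^sup>2" by (simp only: power_mult_distrib) simp
      finally have "6 * h\<^sup>2 \<le> 24 * (h - w)\<^sup>2" by linarith
      moreover have "0 \<le> 8 * \<bar>u\<bar> * (1 + w ^ 4)" by (intro mult_nonneg_nonneg) auto
      ultimately show ?thesis by linarith
    qed
    have int: "integrable (M k) (\<lambda>\<omega>. 24 * (?X \<omega> - ?Y \<omega>)\<^sup>2 + 8 * \<bar>u\<bar> * (1 + ?Y \<omega> ^ 4))"
      using R2_int[OF assms] W4_int[OF assms]
      by (intro Bochner_Integration.integrable_add integrable_mult_right) auto
    have "expectation (\<lambda>\<omega>. min (6 * (?X \<omega>)\<^sup>2) (\<bar>u\<bar> * \<bar>?X \<omega>\<bar> ^ 3))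
        \<le> expectation (\<lambda>\<omega>. 24 * (?X \<omega> - ?Y \<omega>)\<^sup>2 + 8 * \<bar>u\<bar> * (1 + ?Y \<omega> ^ 4))"
    proof (intro integral_mono int ptw)
      have "integrable (M k) (\<lambda>\<omega>. 6 * (?X \<omega>)\<^sup>2)" using H2_int[OF assms] by simp
      then show "integrable (M k) (\<lambda>\<omega>. min (6 * (?X \<omega>)\<^sup>2) (\<bar>u\<bar> * \<bar>?X \<omega>\<bar> ^ 3))"
        by (rule Bochner_Integration.integrable_bound) (auto simp: min_def)
    qed
    also have "\<dots> = 24 * expectation (\<lambda>\<omega>. (?X \<omega> - ?Y \<omega>)\<^sup>2) + 8 * \<bar>u\<bar> * (1 + expectation (\<lambda>\<omega>. ?Y \<omega> ^ 4))"
      using R2_int[OF assms] W4_int[OF assms] by (simp add: prob_space)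
    also have "\<dots> \<le> 24 * (\<epsilon> k)\<^sup>2 + 8 * \<bar>u\<bar> * (1 + C)"
      using R2[OF assms] W4[OF assms] by (intro add_mono mult_left_mono) auto
    finally show "expectation (\<lambda>\<omega>. min (6 * (?X \<omega>)\<^sup>2) (\<bar>u\<bar> * \<bar>?X \<omega>\<bar> ^ 3))
        \<le> 24 * (\<epsilon> k)\<^sup>2 + 8 * \<bar>u\<bar> * (1 + C)" .
  qed simp
  finally have 1: "cmod (?\<phi> - (1 - u\<^sup>2 * v / 2)) \<le> u\<^sup>2 / 6 * (24 * (\<epsilon> k)\<^sup>2 + 8 * \<bar>u\<bar> * (1 + C))" .
  have 2: "\<bar>(1 - u\<^sup>2 * v / 2) - (1 - u\<^sup>2 / 2)\<bar> \<le> u\<^sup>2 / 2 * (2 * \<epsilon> k + (\<epsilon> k)\<^sup>2)"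
  proof -
    have "(1 - u\<^sup>2 * v / 2) - (1 - u\<^sup>2 / 2) = - (u\<^sup>2 / 2 * (v - 1))" by (simp add: field_simps)
    then have "\<bar>(1 - u\<^sup>2 * v / 2) - (1 - u\<^sup>2 / 2)\<bar> = u\<^sup>2 / 2 * \<bar>v - 1\<bar>" by (simp add: abs_mult)
    also have "\<dots> \<le> u\<^sup>2 / 2 * (2 * \<epsilon> k + (\<epsilon> k)\<^sup>2)"
      using H2_near_1[OF assms] by (intro mult_left_mono) (auto simp: v_def)
    finally show ?thesis .
  qed
  have 3: "\<bar>(1 - u\<^sup>2 / 2) - exp (- u\<^sup>2 / 2)\<bar> \<le> u ^ 4 / 8"
  proof -
    have "exp (- y) \<le> 1 - y + y\<^sup>2 / 2" if "0 \<le> y" for y :: real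
    proof -
      have "\<exists>s. \<bar>s\<bar> \<le> \<bar>- y\<bar> \<and> exp (- y) = (\<Sum>m<3. (- y) ^ m / fact m) + exp s / fact 3 * (- y) ^ 3"
        by (rule Maclaurin_exp_le)
      then obtain s where "exp (- y) = (\<Sum>m<3. (- y) ^ m / fact m) + exp s / fact 3 * (- y) ^ 3" by blast
      then have "exp (- y) = 1 - y + y\<^sup>2 / 2 - exp s / 6 * y ^ 3"
        by (simp add: numeral_3_eq_3 power2_eq_square fact_numeral)
      moreover have "0 \<le> exp s / 6 * y ^ 3" using that by simp
      ultimately show ?thesis by linarith
    qed
    from this[of "u\<^sup>2 / 2"] have "exp (- u\<^sup>2 / 2) \<le> 1 - u\<^sup>2 / 2 + u ^ 4 / 8"
      by (simp add: power_divide flip: power_mult)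
    moreover have "1 - u\<^sup>2 / 2 \<le> exp (- u\<^sup>2 / 2)" using exp_ge_add_one_self[of "- u\<^sup>2 / 2"] by simp
    ultimately show ?thesis by linarith
  qed
  have "?\<phi> - exp (- u\<^sup>2 / 2) = (?\<phi> - (1 - u\<^sup>2 * v / 2))
      + (of_real ((1 - u\<^sup>2 * v / 2) - (1 - u\<^sup>2 / 2)) + of_real ((1 - u\<^sup>2 / 2) - exp (- u\<^sup>2 / 2)))" by simp
  also have "cmod \<dots> \<le> cmod (?\<phi> - (1 - u\<^sup>2 * v / 2)) + (\<bar>(1 - u\<^sup>2 * v / 2) - (1 - u\<^sup>2 / 2)\<bar>
      + \<bar>(1 - u\<^sup>2 / 2) - exp (- u\<^sup>2 / 2)\<bar>)"
    unfolding norm_of_real[where 'a=complex, symmetric] by (intro order_trans[OF norm_triangle_ineq] add_left_mono norm_triangle_ineq)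
  finally show ?thesis using 1 2 3 by linarith
qed

text \<open>At \<open>u = t / \<surd>N\<close> each factor of the characteristic function of the normalised sum differs from
  \<open>exp (- u\<^sup>2 / 2)\<close> by \<open>o(1 / N)\<close>; all factors have modulus at most one, so the errors add up to a null
  sequence, and Levy's continuity theorem applies.\<close>

lemma clt:
  "weak_conv_m (\<lambda>k. distr (M k) borel (\<lambda>\<omega>. (\<Sum>i=1..N k. H k i \<omega>) / sqrt (N k))) std_normal_distribution"
proof (rule levy_continuity)
  show "real_distribution (distr (M k) borel (\<lambda>\<omega>. (\<Sum>i=1..N k. H k i \<omega>) / sqrt (N k)))" for k
  proof -
    interpret prob_space "M k" by (rule prob)
    note [measurable] = measurable_H
    show ?thesis by (intro real_distribution_distr) measurable
  qed
  show "real_distribution std_normal_distribution" by (rule real_dist_normal_dist)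
  fix t :: real
  let ?u = "\<lambda>k. t / sqrt (N k)"
  let ?\<phi> = "\<lambda>k. char (distr (M k) borel (\<lambda>\<omega>. (\<Sum>i=1..N k. H k i \<omega>) / sqrt (N k))) t"
  let ?b = "\<lambda>k. t\<^sup>2 / 6 * (24 * (\<epsilon> k)\<^sup>2 + 8 * (\<bar>t\<bar> / sqrt (N k)) * (1 + C)) + t\<^sup>2 / 2 * (2 * \<epsilon> k + (\<epsilon> k)\<^sup>2)
      + t ^ 4 / 8 / N k"
  have bound: "cmod (?\<phi> k - exp (- t\<^sup>2 / 2)) \<le> ?b k" for k
  proof -
    interpret prob_space "M k" by (rule prob)
    have Nk: "0 < real (N k)" using N_pos by simp
    have u2: "(?u k)\<^sup>2 = t\<^sup>2 / N k" by (simp add: power_divide)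
    have u4: "(?u k) ^ 4 = t ^ 4 / (N k)\<^sup>2"
    proof -
      have "(?u k) ^ 4 = ((?u k)\<^sup>2)\<^sup>2" by (simp flip: power_mult)
      also have "\<dots> = t ^ 4 / (N k)\<^sup>2" unfolding u2 by (simp add: power_divide flip: power_mult)
      finally show ?thesis .
    qed
    have "?\<phi> k = char (distr (M k) borel (\<lambda>\<omega>. \<Sum>i=1..N k. H k i \<omega> / sqrt (N k))) t"
      by (simp add: sum_divide_distrib)
    also have "\<dots> = (\<Prod>i=1..N k. char (distr (M k) borel (\<lambda>\<omega>. H k i \<omega> / sqrt (N k))) t)"
      by (intro char_distr_sum indep_vars_compose2[OF indep_H]) auto
    also have "\<dots> = (\<Prod>i=1..N k. char (distr (M k) borel (H k i)) (?u k))"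
    proof (intro prod.cong refl)
      fix i assume i: "i \<in> {1..N k}"
      note [measurable] = measurable_H[OF i]
      show "char (distr (M k) borel (\<lambda>\<omega>. H k i \<omega> / sqrt (N k))) t = char (distr (M k) borel (H k i)) (?u k)"
        unfolding char_def by (auto simp: integral_distr)
    qed
    finally have \<phi>: "?\<phi> k = \<dots>" .
    have "complex_of_real (exp (- t\<^sup>2 / 2)) = (\<Prod>i=1..N k. complex_of_real (exp (- (?u k)\<^sup>2 / 2)))"
    proof -
      have "exp (- t\<^sup>2 / 2) = exp (- (?u k)\<^sup>2 / 2) ^ N k"
        using Nk unfolding u2 by (simp flip: exp_of_nat_mult)
      then show ?thesis by simp
    qed
    then have "cmod (?\<phi> k - exp (- t\<^sup>2 / 2)) = cmod ((\<Prod>i=1..N k. char (distr (M k) borel (H k i)) (?u k))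
        - (\<Prod>i=1..N k. complex_of_real (exp (- (?u k)\<^sup>2 / 2))))" using \<phi> by simp
    also have "\<dots> \<le> (\<Sum>i=1..N k. cmod (char (distr (M k) borel (H k i)) (?u k) - exp (- (?u k)\<^sup>2 / 2)))"
    proof (rule norm_prod_diff)
      fix i assume i: "i \<in> {1..N k}"
      have "real_distribution (distr (M k) borel (H k i))"
        using measurable_H[OF i] by (rule real_distribution_distr)
      then show "cmod (char (distr (M k) borel (H k i)) (?u k)) \<le> 1"
        by (rule real_distribution.cmod_char_le_1)
    qed simp
    also have "\<dots> \<le> (\<Sum>i=1..N k. (?u k)\<^sup>2 / 6 * (24 * (\<epsilon> k)\<^sup>2 + 8 * \<bar>?u k\<bar> * (1 + C))
        + (?u k)\<^sup>2 / 2 * (2 * \<epsilon> k + (\<epsilon> k)\<^sup>2) + ?u k ^ 4 / 8)"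
      by (intro sum_mono char_near_gaussian)
    also have "\<dots> = ?b k"
      unfolding u2 u4 using Nk by (simp add: power2_eq_square field_simps)
    finally show ?thesis .
  qed
  have N_real: "filterlim (\<lambda>k. real (N k)) at_top sequentially"
    by (rule filterlim_compose[OF filterlim_real_sequentially N_lim])
  have 1: "(\<lambda>k. \<bar>t\<bar> / sqrt (N k)) \<longlonglongrightarrow> 0"
    by (intro tendsto_divide_0[OF tendsto_const] filterlim_at_top_imp_at_infinity
        filterlim_compose[OF sqrt_at_top N_real])
  have 2: "(\<lambda>k. t ^ 4 / 8 / real (N k)) \<longlonglongrightarrow> 0"
    by (intro tendsto_divide_0[OF tendsto_const] filterlim_at_top_imp_at_infinity N_real)
  have "?b \<longlonglongrightarrow> t\<^sup>2 / 6 * (24 * 0\<^sup>2 + 8 * 0 * (1 + C)) + t\<^sup>2 / 2 * (2 * 0 + 0\<^sup>2) + 0"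
    by (intro tendsto_intros 1 2 \<epsilon>_lim)
  then have "?b \<longlonglongrightarrow> 0" by simp
  then have "(\<lambda>k. ?\<phi> k - exp (- t\<^sup>2 / 2)) \<longlonglongrightarrow> 0"
    by (rule Lim_null_comparison[OF always_eventually, rotated]) (use bound in auto)
  then show "?\<phi> \<longlonglongrightarrow> char std_normal_distribution t"
    unfolding char_std_normal_distribution by (rule LIM_zero_cancel)
qed

definition sample_mean :: "nat \<Rightarrow> 'a \<Rightarrow> real" where
  "sample_mean k \<omega> = (\<Sum>i=1..N k. H k i \<omega>) / N k"

definition sample_var :: "nat \<Rightarrow> 'a \<Rightarrow> real" where
  "sample_var k \<omega> = (\<Sum>i=1..N k. (H k i \<omega> - sample_mean k \<omega>)\<^sup>2) / N k"

lemma sample_var_eq: "sample_var k \<omega> = (\<Sum>i=1..N k. (H k i \<omega>)\<^sup>2) / N k - (sample_mean k \<omega>)\<^sup>2"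
proof -
  let ?m = "sample_mean k \<omega>"
  have Nk: "0 < real (N k)" using N_pos by simp
  have sum: "(\<Sum>i=1..N k. H k i \<omega>) = N k * ?m" using Nk by (simp add: sample_mean_def)
  have "(\<Sum>i=1..N k. (H k i \<omega> - ?m)\<^sup>2) = (\<Sum>i=1..N k. (H k i \<omega>)\<^sup>2 - 2 * ?m * H k i \<omega> + ?m\<^sup>2)"
    by (intro sum.cong refl) (simp add: power2_eq_square algebra_simps)
  also have "\<dots> = (\<Sum>i=1..N k. (H k i \<omega>)\<^sup>2) - 2 * ?m * (\<Sum>i=1..N k. H k i \<omega>) + N k * ?m\<^sup>2"
    by (simp add: sum.distrib sum_subtractf sum_distrib_left)
  also have "\<dots> = (\<Sum>i=1..N k. (H k i \<omega>)\<^sup>2) - N k * ?m\<^sup>2"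
    unfolding sum by (simp add: power2_eq_square)
  finally show ?thesis using Nk by (simp add: sample_var_def field_simps)
qed

lemma measurable_sample_mean [measurable]: "sample_mean k \<in> borel_measurable (M k)"
  and measurable_sample_var [measurable]: "sample_var k \<in> borel_measurable (M k)"
proof -
  note [measurable] = measurable_H
  show "sample_mean k \<in> borel_measurable (M k)" unfolding sample_mean_def[abs_def] by measurable
  then show "sample_var k \<in> borel_measurable (M k)" unfolding sample_var_def[abs_def] by measurable
qed

text \<open>Three errors: replacing \<open>H\<close> by \<open>W\<close> in the mean of squares, the deviation of the mean of
  the \<open>W\<^sup>2\<close> from its expectation, and the squared sample mean.\<close>

lemma sample_var_L1:
  shows "integrable (M k) (\<lambda>\<omega>. \<bar>sample_var k \<omega> - 1\<bar>)"
    and "(LINT \<omega>|M k. \<bar>sample_var k \<omega> - 1\<bar>)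
      \<le> (2 * \<epsilon> k + (\<epsilon> k)\<^sup>2) + sqrt C / sqrt (N k) + (1 + 2 * \<epsilon> k + (\<epsilon> k)\<^sup>2) / N k"
proof -
  interpret prob_space "M k" by (rule prob)
  note [measurable] = measurable_H measurable_W
  define e where "e = 2 * \<epsilon> k + (\<epsilon> k)\<^sup>2"
  have Nk: "0 < real (N k)" using N_pos by simp
  define A where "A \<omega> = (\<Sum>i=1..N k. \<bar>(H k i \<omega>)\<^sup>2 - (W k i \<omega>)\<^sup>2\<bar>) / N k" for \<omega>
  define B where "B \<omega> = \<bar>\<Sum>i=1..N k. (W k i \<omega>)\<^sup>2 - 1\<bar> / N k" for \<omega>
  define G where "G \<omega> = (sample_mean k \<omega>)\<^sup>2" for \<omega>
  have [measurable]: "A \<in> borel_measurable (M k)" "B \<in> borel_measurable (M k)" "G \<in> borel_measurable (M k)"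
    unfolding A_def B_def G_def by measurable
  have ptw: "\<bar>sample_var k \<omega> - 1\<bar> \<le> A \<omega> + B \<omega> + G \<omega>" for \<omega>
  proof -
    have "sample_var k \<omega> - 1 = (\<Sum>i=1..N k. (H k i \<omega>)\<^sup>2 - (W k i \<omega>)\<^sup>2) / N k
        + (\<Sum>i=1..N k. (W k i \<omega>)\<^sup>2 - 1) / N k - G \<omega>"
      using Nk by (simp add: sample_var_eq G_def sum_subtractf field_simps)
    moreover have "\<bar>(\<Sum>i=1..N k. (H k i \<omega>)\<^sup>2 - (W k i \<omega>)\<^sup>2) / N k\<bar> \<le> A \<omega>"
      using Nk unfolding A_def by (auto simp: abs_divide intro!: divide_right_mono sum_abs)
    moreover have "\<bar>(\<Sum>i=1..N k. (W k i \<omega>)\<^sup>2 - 1) / N k\<bar> = B \<omega>"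
      using Nk unfolding B_def by (simp add: abs_divide)
    moreover have "0 \<le> G \<omega>" by (simp add: G_def)
    ultimately show ?thesis by linarith
  qed
  have A: "integrable (M k) A" "expectation A \<le> e"
  proof -
    show "integrable (M k) A" unfolding A_def
      by (intro integrable_divide Bochner_Integration.integrable_sum H2_W2_int)
    have "expectation A = (\<Sum>i=1..N k. expectation (\<lambda>\<omega>. \<bar>(H k i \<omega>)\<^sup>2 - (W k i \<omega>)\<^sup>2\<bar>)) / N k"
      unfolding A_def by (simp add: Bochner_Integration.integral_sum H2_W2_int)
    also have "\<dots> \<le> (\<Sum>i=1..N k. e) / N k"
      unfolding e_def by (intro divide_right_mono sum_mono H2_W2) auto
    finally show "expectation A \<le> e" using Nk by simp
  qed
  have B: "integrable (M k) B" "expectation B \<le> sqrt C / sqrt (N k)"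
  proof -
    let ?Z = "\<lambda>i \<omega>. (W k i \<omega>)\<^sup>2 - 1"
    let ?S = "\<lambda>\<omega>. \<Sum>i=1..N k. ?Z i \<omega>"
    have ind: "indep_vars (\<lambda>_. borel) ?Z {1..N k}"
      by (rule indep_vars_compose2[OF indep_W]) measurable
    have Z2: "(?Z i \<omega>)\<^sup>2 = W k i \<omega> ^ 4 - 2 * (W k i \<omega>)\<^sup>2 + 1" for i \<omega>
      by (simp add: power4_eq_xxxx power2_eq_square algebra_simps)
    have Z2_int: "integrable (M k) (\<lambda>\<omega>. (?Z i \<omega>)\<^sup>2)" if "i \<in> {1..N k}" for i
      unfolding Z2 using W4_int[OF that] W2_int[OF that] by simp
    have EZ2: "expectation (\<lambda>\<omega>. (?Z i \<omega>)\<^sup>2) \<le> C" if "i \<in> {1..N k}" for i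
      unfolding Z2 using W4_int[OF that] W2_int[OF that] W2[OF that] W4[OF that] by (simp add: prob_space)
    have EZ: "expectation (?Z i) = 0" if "i \<in> {1..N k}" for i
      using W2_int[OF that] W2[OF that] by (simp add: prob_space)
    have S2: "integrable (M k) (\<lambda>\<omega>. (?S \<omega>)\<^sup>2)"
      by (rule integrable_sum_power2[OF _ ind Z2_int EZ]) auto
    have "expectation (\<lambda>\<omega>. (?S \<omega>)\<^sup>2) = (\<Sum>i=1..N k. expectation (\<lambda>\<omega>. (?Z i \<omega>)\<^sup>2))"
      by (rule expectation_sum_power2[OF _ ind Z2_int EZ]) auto
    also have "\<dots> \<le> (\<Sum>i=1..N k. C)" by (intro sum_mono EZ2)
    finally have ES2: "expectation (\<lambda>\<omega>. (?S \<omega>)\<^sup>2) \<le> N k * C" by simp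
    have "integrable (M k) ?S" by (rule square_integrable_imp_integrable[OF _ S2]) measurable
    then show "integrable (M k) B" unfolding B_def by simp
    have "expectation B = expectation (\<lambda>\<omega>. \<bar>?S \<omega>\<bar>) / N k" unfolding B_def by simp
    also have "\<dots> \<le> sqrt (N k * C) / N k"
      by (intro divide_right_mono order_trans[OF expectation_abs_le_sqrt[OF _ S2]] real_sqrt_le_mono ES2) auto
    also have "\<dots> = sqrt C / sqrt (N k)"
      using Nk by (simp add: real_sqrt_mult field_simps)
    finally show "expectation B \<le> sqrt C / sqrt (N k)" .
  qed
  have G: "integrable (M k) G" "expectation G \<le> (1 + e) / N k"
  proof -
    let ?S = "\<lambda>\<omega>. \<Sum>i=1..N k. H k i \<omega>"
    have G_eq: "G = (\<lambda>\<omega>. (?S \<omega>)\<^sup>2 / (N k)\<^sup>2)" by (simp add: fun_eq_iff G_def sample_mean_def power_divide)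
    have S2: "integrable (M k) (\<lambda>\<omega>. (?S \<omega>)\<^sup>2)"
      by (rule integrable_sum_power2[OF _ indep_H H2_int mean_H]) auto
    then show "integrable (M k) G" unfolding G_eq by simp
    have "expectation (\<lambda>\<omega>. (?S \<omega>)\<^sup>2) = (\<Sum>i=1..N k. expectation (\<lambda>\<omega>. (H k i \<omega>)\<^sup>2))"
      by (rule expectation_sum_power2[OF _ indep_H H2_int mean_H]) auto
    also have "\<dots> \<le> (\<Sum>i=1..N k. 1 + e)"
      using H2_near_1[of _ k] by (intro sum_mono) (fastforce simp: e_def)
    finally have "expectation G \<le> (N k * (1 + e)) / (N k)\<^sup>2"
      unfolding G_eq by (simp add: divide_right_mono)
    also have "\<dots> = (1 + e) / N k" using Nk by (simp add: power2_eq_square)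
    finally show "expectation G \<le> (1 + e) / N k" .
  qed
  have int: "integrable (M k) (\<lambda>\<omega>. A \<omega> + B \<omega> + G \<omega>)" using A B G by simp
  show *: "integrable (M k) (\<lambda>\<omega>. \<bar>sample_var k \<omega> - 1\<bar>)"
    by (rule Bochner_Integration.integrable_bound[OF int])
      (use ptw in \<open>auto intro!: order_trans[OF _ abs_ge_self]\<close>)
  have "expectation (\<lambda>\<omega>. \<bar>sample_var k \<omega> - 1\<bar>) \<le> expectation (\<lambda>\<omega>. A \<omega> + B \<omega> + G \<omega>)"
    by (intro integral_mono * int ptw)
  also have "\<dots> = expectation A + expectation B + expectation G" using A B G by simp
  finally show "expectation (\<lambda>\<omega>. \<bar>sample_var k \<omega> - 1\<bar>)
      \<le> (2 * \<epsilon> k + (\<epsilon> k)\<^sup>2) + sqrt C / sqrt (N k) + (1 + 2 * \<epsilon> k + (\<epsilon> k)\<^sup>2) / N k"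
    using A B G by (simp add: e_def add.assoc)
qed

lemma sample_var_consistent:
  assumes "0 < \<delta>"
  shows "(\<lambda>k. measure (M k) {\<omega> \<in> space (M k). \<delta> \<le> \<bar>sample_var k \<omega> - 1\<bar>}) \<longlonglongrightarrow> 0"
proof -
  let ?b = "\<lambda>k. (2 * \<epsilon> k + (\<epsilon> k)\<^sup>2) + sqrt C / sqrt (N k) + (1 + 2 * \<epsilon> k + (\<epsilon> k)\<^sup>2) / N k"
  have N_real: "filterlim (\<lambda>k. real (N k)) at_top sequentially"
    by (rule filterlim_compose[OF filterlim_real_sequentially N_lim])
  have 1: "(\<lambda>k. sqrt C / sqrt (N k)) \<longlonglongrightarrow> 0"
    by (intro tendsto_divide_0[OF tendsto_const] filterlim_at_top_imp_at_infinity
        filterlim_compose[OF sqrt_at_top N_real])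
  have 2: "(\<lambda>k. (1 + 2 * \<epsilon> k + (\<epsilon> k)\<^sup>2) / N k) \<longlonglongrightarrow> 0"
    by (rule tendsto_divide_0[where c="1 + 2 * 0 + 0\<^sup>2"])
      (intro tendsto_intros \<epsilon>_lim filterlim_at_top_imp_at_infinity N_real)+
  have "?b \<longlonglongrightarrow> (2 * 0 + 0\<^sup>2) + 0 + 0" by (intro tendsto_intros \<epsilon>_lim 1 2)
  then have "(\<lambda>k. ?b k / \<delta>) \<longlonglongrightarrow> 0" using tendsto_divide[of ?b 0 _ "\<lambda>_. \<delta>" \<delta>] assms by simp
  then show ?thesis
  proof (rule Lim_null_comparison[OF always_eventually, rotated], intro allI)
    fix k
    interpret prob_space "M k" by (rule prob)
    have "prob {\<omega> \<in> space (M k). \<delta> \<le> \<bar>sample_var k \<omega> - 1\<bar>} \<le> expectation (\<lambda>\<omega>. \<bar>sample_var k \<omega> - 1\<bar>) / \<delta>"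
      using assms by (intro integral_Markov_inequality_measure[where A="{}"] sample_var_L1(1)) auto
    also have "\<dots> \<le> ?b k / \<delta>" using assms sample_var_L1(2) by (intro divide_right_mono) auto
    finally show "norm (prob {\<omega> \<in> space (M k). \<delta> \<le> \<bar>sample_var k \<omega> - 1\<bar>}) \<le> ?b k / \<delta>" by simp
  qed
qed

text \<open>When the empirical variance is within \<open>\<delta>\<close> of one, rejection amounts to the sample mean passing a
  threshold within \<open>\<bar>z\<bar> \<delta>\<close> of \<open>z - \<theta>\<^sub>k\<close>. The uniform central limit theorem gives the probability of
  that for any \<open>\<theta>\<^sub>k\<close>, bounded or not.\<close>

theorem studentized_limit:
  fixes \<theta> :: "nat \<Rightarrow> real" and z :: real
  shows "(\<lambda>k. measure (M k) {\<omega> \<in> space (M k).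
      z < (\<theta> k + sqrt (N k) * sample_mean k \<omega>) / sqrt (sample_var k \<omega>)} - std_normal_cdf (\<theta> k - z)) \<longlonglongrightarrow> 0"
proof -
  \<comment> \<open>Passing to the negated array turns the upper tail of the mean into a distribution function.\<close>
  interpret neg: perturbed_array M N "\<lambda>k i \<omega>. - H k i \<omega>" "\<lambda>k i \<omega>. - W k i \<omega>" \<epsilon> C
  proof (rule perturbed_array.intro)
    fix k i
    show "prob_space (M k)" by (rule prob)
    show "prob_space.indep_vars (M k) (\<lambda>_. borel) (\<lambda>i \<omega>. - H k i \<omega>) {1..N k}"
      "prob_space.indep_vars (M k) (\<lambda>_. borel) (\<lambda>i \<omega>. - W k i \<omega>) {1..N k}"
      by (intro prob_space.indep_vars_compose2[OF prob indep_H] prob_space.indep_vars_compose2[OF prob indep_W]; simp)+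
    assume i: "i \<in> {1..N k}"
    have sw: "(- H k i \<omega> - - W k i \<omega>)\<^sup>2 = (H k i \<omega> - W k i \<omega>)\<^sup>2" for \<omega> by (simp add: power2_commute)
    show "integrable (M k) (\<lambda>\<omega>. (- H k i \<omega> - - W k i \<omega>)\<^sup>2)"
      "(LINT \<omega>|M k. (- H k i \<omega> - - W k i \<omega>)\<^sup>2) \<le> (\<epsilon> k)\<^sup>2"
      unfolding sw by (intro R2_int[OF i] R2[OF i])+
  qed (use mean_H W4_int W2 W4 N_pos N_lim \<epsilon>_pos \<epsilon>_lim in simp_all)
  define D where "D k = distr (M k) borel (\<lambda>\<omega>. (\<Sum>i=1..N k. - H k i \<omega>) / sqrt (N k))" for k
  have D: "real_distribution (D k)" for k
  proof -
    interpret prob_space "M k" by (rule prob)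
    note [measurable] = measurable_H
    show ?thesis unfolding D_def by (intro real_distribution_distr) measurable
  qed
  have S_eq: "(\<Sum>i=1..N k. - H k i \<omega>) / sqrt (N k) = - (sqrt (N k) * sample_mean k \<omega>)" for k \<omega>
    using N_pos[of k] by (simp add: sample_mean_def sum_negf field_simps)
  have cdf_D: "cdf (D k) u = measure (M k) {\<omega> \<in> space (M k). - (sqrt (N k) * sample_mean k \<omega>) \<le> u}" for k u
    unfolding cdf_def D_def S_eq
    by (subst measure_distr) (auto intro!: arg_cong2[where f=measure])
  let ?A = "\<lambda>k. {\<omega> \<in> space (M k). z < (\<theta> k + sqrt (N k) * sample_mean k \<omega>) / sqrt (sample_var k \<omega>)}"
  show ?thesis
  proof (rule LIMSEQ_I)
    fix \<eta> :: real assume "0 < \<eta>"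
    define \<delta> where "\<delta> = min (1 / 2) (\<eta> / (4 * (\<bar>z\<bar> + 1)))"
    have \<delta>: "0 < \<delta>" "\<delta> < 1" "(\<bar>z\<bar> + 1) * \<delta> \<le> \<eta> / 4"
    proof -
      have z: "0 < \<bar>z\<bar> + 1" by linarith
      show "0 < \<delta>" "\<delta> < 1" using \<open>0 < \<eta>\<close> z by (auto simp: \<delta>_def)
      have "b * (\<eta> / (4 * b)) = \<eta> / 4" if "0 < b" for b using that by simp
      note eq = this[OF z]
      have "(\<bar>z\<bar> + 1) * \<delta> \<le> (\<bar>z\<bar> + 1) * (\<eta> / (4 * (\<bar>z\<bar> + 1)))"
        using z by (intro mult_left_mono) (auto simp: \<delta>_def)
      also note eq
      finally show "(\<bar>z\<bar> + 1) * \<delta> \<le> \<eta> / 4" .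
    qed
    have unif: "\<forall>\<^sub>F k in sequentially. \<forall>u. \<bar>cdf (D k) u - std_normal_cdf u\<bar> \<le> \<eta> / 4"
      using \<open>0 < \<eta>\<close> neg.clt by (intro std_normal_weak_conv_uniform D) (auto simp: D_def)
    have var: "\<forall>\<^sub>F k in sequentially. measure (M k) {\<omega> \<in> space (M k). \<delta> \<le> \<bar>sample_var k \<omega> - 1\<bar>} < \<eta> / 4"
      using order_tendstoD(2)[OF sample_var_consistent[OF \<delta>(1)], of "\<eta> / 4"] \<open>0 < \<eta>\<close> by simp
    have "\<forall>\<^sub>F k in sequentially. norm (measure (M k) (?A k) - std_normal_cdf (\<theta> k - z) - 0) < \<eta>"
      using unif var
    proof eventually_elim
      case (elim k)
      interpret prob_space "M k" by (rule prob)
      let ?S = "\<lambda>\<omega>. sqrt (N k) * sample_mean k \<omega>"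
      let ?G = "{\<omega> \<in> space (M k). \<delta> \<le> \<bar>sample_var k \<omega> - 1\<bar>}"
      let ?L = "\<lambda>u. {\<omega> \<in> space (M k). - ?S \<omega> \<le> u}"
      have good: "0 < sample_var k \<omega>" "\<bar>z * sqrt (sample_var k \<omega>) - z\<bar> \<le> \<bar>z\<bar> * \<delta>"
        if "\<bar>sample_var k \<omega> - 1\<bar> < \<delta>" for \<omega>
      proof -
        show v: "0 < sample_var k \<omega>" using that \<delta> by linarith
        let ?r = "sqrt (sample_var k \<omega>)"
        have r: "0 < ?r" "?r * ?r = sample_var k \<omega>" using v by auto
        then have "sample_var k \<omega> - 1 = (?r - 1) * (?r + 1)" by (simp add: algebra_simps)
        then have eq: "\<bar>sample_var k \<omega> - 1\<bar> = \<bar>?r - 1\<bar> * (?r + 1)" using r by (simp add: abs_mult)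
        have "\<bar>?r - 1\<bar> * 1 \<le> \<bar>?r - 1\<bar> * (?r + 1)" using r by (intro mult_left_mono) auto
        also have "\<dots> \<le> \<delta>" using that eq by simp
        finally have "\<bar>?r - 1\<bar> \<le> \<delta>" by simp
        then have "\<bar>z\<bar> * \<bar>?r - 1\<bar> \<le> \<bar>z\<bar> * \<delta>" by (intro mult_left_mono) auto
        moreover have "z * ?r - z = z * (?r - 1)" by (simp add: algebra_simps)
        ultimately show "\<bar>z * ?r - z\<bar> \<le> \<bar>z\<bar> * \<delta>" by (simp add: abs_mult)
      qed
      have A_iff: "z < (\<theta> k + ?S \<omega>) / sqrt (sample_var k \<omega>) \<longleftrightarrow> z * sqrt (sample_var k \<omega>) < \<theta> k + ?S \<omega>"
        if "0 < sample_var k \<omega>" for \<omega>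
        using that by (simp add: pos_less_divide_eq)
      have "prob (?A k) \<le> prob (?L (\<theta> k - z + \<bar>z\<bar> * \<delta>) \<union> ?G)"
        using good A_iff by (intro finite_measure_mono) (force simp: not_le abs_le_iff)+
      also have "\<dots> \<le> prob (?L (\<theta> k - z + \<bar>z\<bar> * \<delta>)) + prob ?G"
        by (intro measure_Un_le) measurable
      finally have up: "prob (?A k) \<le> cdf (D k) (\<theta> k - z + \<bar>z\<bar> * \<delta>) + prob ?G" by (simp add: cdf_D)
      have "prob (?L (\<theta> k - z - (\<bar>z\<bar> + 1) * \<delta>)) \<le> prob (?A k \<union> ?G)"
      proof (intro finite_measure_mono subsetI)
        fix \<omega> assume w: "\<omega> \<in> ?L (\<theta> k - z - (\<bar>z\<bar> + 1) * \<delta>)"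
        show "\<omega> \<in> ?A k \<union> ?G"
        proof (cases "\<bar>sample_var k \<omega> - 1\<bar> < \<delta>")
          case True
          have "(\<bar>z\<bar> + 1) * \<delta> = \<bar>z\<bar> * \<delta> + \<delta>" by (simp add: algebra_simps)
          then have "z * sqrt (sample_var k \<omega>) < \<theta> k + ?S \<omega>"
            using good(2)[OF True] w \<delta>(1) by (auto simp: abs_le_iff)
          then show ?thesis using w A_iff[OF good(1)[OF True]] by auto
        qed (use w in auto)
      qed measurable
      also have "\<dots> \<le> prob (?A k) + prob ?G"
        by (intro measure_Un_le) measurable
      finally have lo: "cdf (D k) (\<theta> k - z - (\<bar>z\<bar> + 1) * \<delta>) \<le> prob (?A k) + prob ?G" by (simp add: cdf_D)
      have z\<delta>: "0 \<le> \<bar>z\<bar> * \<delta>" "\<bar>z\<bar> * \<delta> \<le> (\<bar>z\<bar> + 1) * \<delta>" using \<delta> by (auto simp: algebra_simps)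
      have "std_normal_cdf (\<theta> k - z + \<bar>z\<bar> * \<delta>) - std_normal_cdf (\<theta> k - z) \<le> \<bar>z\<bar> * \<delta>"
        using std_normal_cdf_lipschitz[of "\<theta> k - z" "\<theta> k - z + \<bar>z\<bar> * \<delta>"] z\<delta> by simp
      moreover have "std_normal_cdf (\<theta> k - z) - std_normal_cdf (\<theta> k - z - (\<bar>z\<bar> + 1) * \<delta>) \<le> (\<bar>z\<bar> + 1) * \<delta>"
        using std_normal_cdf_lipschitz[of "\<theta> k - z - (\<bar>z\<bar> + 1) * \<delta>" "\<theta> k - z"] z\<delta> by simp
      moreover have "\<bar>cdf (D k) (\<theta> k - z + \<bar>z\<bar> * \<delta>) - std_normal_cdf (\<theta> k - z + \<bar>z\<bar> * \<delta>)\<bar> \<le> \<eta> / 4"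
        "\<bar>cdf (D k) (\<theta> k - z - (\<bar>z\<bar> + 1) * \<delta>) - std_normal_cdf (\<theta> k - z - (\<bar>z\<bar> + 1) * \<delta>)\<bar> \<le> \<eta> / 4"
        using elim(1) by auto
      ultimately show ?case using up lo elim(2) \<delta>(3) z\<delta> \<open>0 < \<eta>\<close> unfolding real_norm_def by linarith
    qed
    then show "\<exists>k0. \<forall>k\<ge>k0. norm (measure (M k) (?A k) - std_normal_cdf (\<theta> k - z) - 0) < \<eta>"
      by (simp add: eventually_sequentially)
  qed
qed

end

section \<open>Elementary inequalities\<close>

lemma exp_le_quadratic: "exp y \<le> 1 + y + y\<^sup>2 / 2 * exp \<bar>y\<bar>" for y :: real
proof -
  have "\<exists>s. \<bar>s\<bar> \<le> \<bar>y\<bar> \<and> exp y = (\<Sum>m<2. y ^ m / fact m) + exp s / fact 2 * y ^ 2"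
    by (rule Maclaurin_exp_le)
  then obtain s where s: "\<bar>s\<bar> \<le> \<bar>y\<bar>" "exp y = (\<Sum>m<2. y ^ m / fact m) + exp s / fact 2 * y ^ 2" by blast
  then have "exp y = 1 + y + y\<^sup>2 / 2 * exp s" by (simp add: numeral_2_eq_2)
  moreover have "y\<^sup>2 / 2 * exp s \<le> y\<^sup>2 / 2 * exp \<bar>y\<bar>"
    using s(1) by (intro mult_left_mono) auto
  ultimately show ?thesis by linarith
qed

lemma exp_minus_le_inverse:
  fixes y :: real
  assumes "0 \<le> y"
  shows "exp (- y) \<le> 1 / (1 + y)"
proof -
  have "1 + y \<le> exp y" by (rule exp_ge_add_one_self)
  then have "1 / exp y \<le> 1 / (1 + y)" using assms by (intro divide_left_mono) auto
  then show ?thesis by (simp add: exp_minus inverse_eq_divide)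
qed

text \<open>The remainder of the linearised exponential is both \<open>O(u\<^sup>2)\<close> and \<open>O(\<bar>u\<bar>)\<close> on a half-line bounded
  below. The squared bound by \<open>u\<^sup>4\<close> alone would ask for too many moments of \<open>u\<close>; the minimum of the two
  asks for three.\<close>

lemma exp_remainder_square_le:
  fixes u \<kappa> :: real
  assumes "- \<kappa> \<le> u" "0 \<le> \<kappa>"
  shows "(exp (- u) - 1 + u)\<^sup>2 \<le> exp (2 * \<kappa>) * min (u ^ 4) (u\<^sup>2)"
proof -
  define r where "r = exp (- u) - 1 + u"
  have r0: "0 \<le> r" using exp_ge_add_one_self[of "- u"] by (simp add: r_def)
  have \<kappa>1: "1 \<le> exp \<kappa>" using assms(2) by simp
  have "r \<le> exp \<kappa> * u\<^sup>2 \<and> r \<le> exp \<kappa> * \<bar>u\<bar>"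
  proof (cases "0 \<le> u")
    case True
    have "r \<le> u" using True by (simp add: r_def)
    moreover have "r \<le> u\<^sup>2"
    proof -
      have "exp (- u) \<le> 1 / (1 + u)" using True by (rule exp_minus_le_inverse)
      moreover have "1 / (1 + u) - 1 + u \<le> u\<^sup>2"
      proof -
        have "1 / (1 + u) - 1 + u = u\<^sup>2 / (1 + u)" using True by (simp add: field_simps power2_eq_square)
        also have "\<dots> \<le> u\<^sup>2 / 1" using True by (intro divide_left_mono) auto
        finally show ?thesis by simp
      qed
      ultimately show ?thesis by (simp add: r_def)
    qed
    moreover have "1 * u \<le> exp \<kappa> * u" "1 * u\<^sup>2 \<le> exp \<kappa> * u\<^sup>2"
      using True \<kappa>1 by (intro mult_right_mono; simp)+
    ultimately show ?thesis using True by simp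
  next
    case False
    define y where "y = - u"
    have y: "0 < y" "u = - y" "y \<le> \<kappa>" using False assms by (auto simp: y_def)
    have *: "exp y - 1 \<le> y * exp y"
    proof -
      have "1 - y \<le> exp (- y)" using exp_ge_add_one_self[of "- y"] by simp
      then have "(1 - y) * exp y \<le> exp (- y) * exp y" by (intro mult_right_mono) auto
      then show ?thesis by (simp add: algebra_simps flip: exp_add)
    qed
    have e: "y * exp y \<le> y * exp \<kappa>" using y by (intro mult_left_mono) auto
    have "exp y - 1 - y \<le> y * (exp y - 1)"
      using * by (simp add: algebra_simps)
    also have "\<dots> \<le> y * (y * exp y)" using * y by (intro mult_left_mono) auto
    also have "\<dots> \<le> y * (y * exp \<kappa>)" using e y by (intro mult_left_mono) auto
    finally have "r \<le> exp \<kappa> * u\<^sup>2" by (simp add: r_def y(2) power2_eq_square mult_ac)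
    moreover have "r \<le> exp \<kappa> * \<bar>u\<bar>"
    proof -
      have "exp y - 1 - y \<le> y * exp \<kappa>" using * e y by linarith
      then show ?thesis using y(1) by (simp add: r_def y(2) mult_ac)
    qed
    ultimately show ?thesis by simp
  qed
  then have "r\<^sup>2 \<le> (exp \<kappa> * u\<^sup>2)\<^sup>2" "r\<^sup>2 \<le> (exp \<kappa> * \<bar>u\<bar>)\<^sup>2" using r0 by (auto intro!: power_mono)
  moreover have "(exp \<kappa>)\<^sup>2 = exp (2 * \<kappa>)" by (simp add: exp_double)
  ultimately have "r\<^sup>2 \<le> exp (2 * \<kappa>) * u ^ 4" "r\<^sup>2 \<le> exp (2 * \<kappa>) * u\<^sup>2"
    by (simp_all add: power_mult_distrib flip: power_mult)
  then show ?thesis by (auto simp: r_def min_def)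
qed

text \<open>The minimum of the fourth and second powers is at most the third power. It will be applied to a sum
  whose first part has a third moment of small order and whose second part has a small variance.\<close>

lemma min_power_sum_le:
  fixes a b :: real
  shows "min ((a + b) ^ 4) ((a + b)\<^sup>2) \<le> 8 * \<bar>a\<bar> ^ 3 + 4 * b\<^sup>2"
proof (cases "\<bar>b\<bar> \<le> \<bar>a\<bar>")
  case True
  have "min ((a + b) ^ 4) ((a + b)\<^sup>2) \<le> \<bar>a + b\<bar> ^ 3"
  proof (cases "\<bar>a + b\<bar> \<le> 1")
    case True
    then have "\<bar>a + b\<bar> ^ 4 \<le> \<bar>a + b\<bar> ^ 3" by (intro power_decreasing) auto
    then show ?thesis by (simp add: power_even_abs)
  next
    case False
    then have "\<bar>a + b\<bar> ^ 2 \<le> \<bar>a + b\<bar> ^ 3" by (intro power_increasing) auto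
    then show ?thesis by simp
  qed
  also have "\<dots> \<le> (2 * \<bar>a\<bar>) ^ 3" using True by (intro power_mono) auto
  also have "\<dots> = 8 * \<bar>a\<bar> ^ 3" by (simp add: power_mult_distrib)
  finally show ?thesis using zero_le_power2[of b] by linarith
next
  case False
  then have "\<bar>a + b\<bar> \<le> \<bar>2 * b\<bar>" by linarith
  then have "(a + b)\<^sup>2 \<le> (2 * b)\<^sup>2" by (simp only: abs_le_square_iff)
  also have "\<dots> = 4 * b\<^sup>2" by (simp add: power_mult_distrib)
  finally have "(a + b)\<^sup>2 \<le> 4 * b\<^sup>2" .
  moreover have "0 \<le> 8 * \<bar>a\<bar> ^ 3" by simp
  ultimately show ?thesis by linarith
qed

lemma one_minus_exp_ge_half: "0 \<le> y \<Longrightarrow> y \<le> 1 \<Longrightarrow> y / 2 \<le> 1 - exp (- y)" for y :: real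
proof -
  assume y: "0 \<le> y" "y \<le> 1"
  have "exp (- y) \<le> 1 / (1 + y)" using y(1) by (rule exp_minus_le_inverse)
  moreover have "y / 2 \<le> y / (1 + y)" using y by (intro divide_left_mono) auto
  moreover have "1 - 1 / (1 + y) = y / (1 + y)" using y by (simp add: field_simps)
  ultimately show ?thesis by linarith
qed

lemma square_add_le: "(x + y)\<^sup>2 \<le> 2 * x\<^sup>2 + 2 * y\<^sup>2" for x y :: real
proof -
  have "0 \<le> (x - y)\<^sup>2" by simp
  then show ?thesis by (simp add: power2_eq_square algebra_simps)
qed

lemma square_diff_le: "(x - y)\<^sup>2 \<le> 2 * x\<^sup>2 + 2 * y\<^sup>2" for x y :: real
  using square_add_le[of x "- y"] by simp

lemma square_sum8_le:
  fixes a b c x y z v w :: real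
  shows "(a + b - (c + x) + ((y + z) - (v + w)))\<^sup>2
    \<le> 8 * (a\<^sup>2 + b\<^sup>2 + c\<^sup>2 + x\<^sup>2 + y\<^sup>2 + z\<^sup>2 + v\<^sup>2 + w\<^sup>2)"
proof -
  note square_add_le[of "a + b - (c + x)" "(y + z) - (v + w)"]
    square_diff_le[of "a + b" "c + x"] square_diff_le[of "y + z" "v + w"]
    square_add_le[of a b] square_add_le[of c x] square_add_le[of y z] square_add_le[of v w]
  then show ?thesis by argo
qed

section \<open>The law of a difference of two coordinates\<close>

lemma (in prob_space) indep_var_commute:
  assumes "indep_var S X T Y"
  shows "indep_var T Y S X"
proof -
  let ?A = "sigma_sets (space M) {X -` A \<inter> space M |A. A \<in> sets S}"
  let ?B = "sigma_sets (space M) {Y -` A \<inter> space M |A. A \<in> sets T}"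
  have rv: "random_variable S X" "random_variable T Y" and ind: "indep_set ?A ?B"
    using assms unfolding indep_var_eq by auto
  have "indep_set ?B ?A"
    unfolding indep_sets2_eq
  proof (intro conjI ballI)
    fix b a assume "b \<in> ?B" "a \<in> ?A"
    then show "prob (b \<inter> a) = prob b * prob a"
      using indep_setD[OF ind, of a b] by (simp add: Int_commute mult.commute)
  qed (use ind in \<open>simp_all add: indep_sets2_eq\<close>)
  then show ?thesis using rv unfolding indep_var_eq by simp
qed

locale coordinate_law =
  fixes \<nu> :: "real measure" and \<sigma> :: real
  assumes law: "real_distribution \<nu>"
    and mean: "(LINT u|\<nu>. u) = 0"
    and sixth_moment: "integrable \<nu> (\<lambda>u. u ^ 6)"
    and \<sigma>_pos: "0 < \<sigma>" and second_moment: "(LINT u|\<nu>. u\<^sup>2) = \<sigma>\<^sup>2"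
begin

sublocale \<nu>: real_distribution \<nu> by (rule law)

lemma \<nu>_power: "m \<le> 6 \<Longrightarrow> integrable \<nu> (\<lambda>u. u ^ m)"
  using \<nu>.integrable_power_le_abs[of "\<lambda>u. u" 6 m] sixth_moment by (simp add: power_even_abs)

definition diff_law :: "real measure" where
  "diff_law = distr (\<nu> \<Otimes>\<^sub>M \<nu>) borel (\<lambda>(u, v). u - v)"

sublocale pair: pair_prob_space \<nu> \<nu> ..

lemma measurable_diff [measurable]: "(\<lambda>(u, v). u - v) \<in> borel_measurable (\<nu> \<Otimes>\<^sub>M \<nu>)"
  unfolding case_prod_beta by measurable

sublocale dl: real_distribution diff_law
  unfolding diff_law_def by (rule pair.P.real_distribution_distr) measurable

lemma
  fixes f :: "real \<Rightarrow> real"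
  assumes [measurable]: "f \<in> borel_measurable borel"
  shows diff_law_integral: "(LINT x|diff_law. f x) = (LINT p|(\<nu> \<Otimes>\<^sub>M \<nu>). f (fst p - snd p))"
    and diff_law_integrable: "integrable diff_law f \<longleftrightarrow> integrable (\<nu> \<Otimes>\<^sub>M \<nu>) (\<lambda>p. f (fst p - snd p))"
  unfolding diff_law_def by (simp_all add: integral_distr integrable_distr_eq case_prod_beta)

lemma
  shows distr_fst: "distr (\<nu> \<Otimes>\<^sub>M \<nu>) borel fst = \<nu>"
    and distr_snd: "distr (\<nu> \<Otimes>\<^sub>M \<nu>) borel snd = \<nu>"
proof -
  have 1: "distr (\<nu> \<Otimes>\<^sub>M \<nu>) \<nu> fst = \<nu>" by (rule \<nu>.distr_pair_fst)
  have "distr (\<nu> \<Otimes>\<^sub>M \<nu>) \<nu> snd = distr (distr (\<nu> \<Otimes>\<^sub>M \<nu>) (\<nu> \<Otimes>\<^sub>M \<nu>) (\<lambda>(x, y). (y, x))) \<nu> snd"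
    by (rule arg_cong[OF pair.distr_pair_swap])
  also have "\<dots> = distr (\<nu> \<Otimes>\<^sub>M \<nu>) \<nu> (snd \<circ> (\<lambda>(x, y). (y, x)))"
    by (rule distr_distr) (rule measurable_snd measurable_pair_swap')+
  also have "snd \<circ> (\<lambda>(x, y). (y, x)) = fst" by (auto simp: fun_eq_iff)
  finally have 2: "distr (\<nu> \<Otimes>\<^sub>M \<nu>) \<nu> snd = \<nu>" using 1 by simp
  show "distr (\<nu> \<Otimes>\<^sub>M \<nu>) borel fst = \<nu>" "distr (\<nu> \<Otimes>\<^sub>M \<nu>) borel snd = \<nu>"
    using 1 2 by (simp_all cong: distr_cong)
qed

lemma indep_fst_snd: "pair.P.indep_var borel fst borel snd"
proof -
  have "sets (borel \<Otimes>\<^sub>M borel) = sets (\<nu> \<Otimes>\<^sub>M \<nu>)" by (intro sets_pair_measure_cong) auto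
  then have "distr (\<nu> \<Otimes>\<^sub>M \<nu>) (borel \<Otimes>\<^sub>M borel) (\<lambda>p. (fst p, snd p)) = \<nu> \<Otimes>\<^sub>M \<nu>"
    by (simp add: distr_id2)
  then show ?thesis by (simp add: pair.P.indep_var_distribution_eq distr_fst distr_snd)
qed

lemma distr_indep_diff:
  assumes "prob_space P" "prob_space.indep_var P borel X borel Y"
    and "distr P borel X = \<nu>" "distr P borel Y = \<nu>"
  shows "distr P borel (\<lambda>\<omega>. X \<omega> - Y \<omega> :: real) = diff_law"
proof -
  interpret P: prob_space P by fact
  have XY[measurable]: "X \<in> borel_measurable P" "Y \<in> borel_measurable P"
    and joint: "distr P (borel \<Otimes>\<^sub>M borel) (\<lambda>\<omega>. (X \<omega>, Y \<omega>)) = \<nu> \<Otimes>\<^sub>M \<nu>"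
    using assms(2-4) by (auto simp: P.indep_var_distribution_eq)
  have "diff_law = distr (distr P (borel \<Otimes>\<^sub>M borel) (\<lambda>\<omega>. (X \<omega>, Y \<omega>))) borel (\<lambda>(u, v). u - v)"
    by (simp add: diff_law_def joint)
  also have "\<dots> = distr P borel ((\<lambda>(u, v). u - v) \<circ> (\<lambda>\<omega>. (X \<omega>, Y \<omega>)))"
    by (rule distr_distr) (auto simp: case_prod_beta)
  finally show ?thesis by (simp add: o_def)
qed

lemma diff_law_symmetric:
  fixes f :: "real \<Rightarrow> real"
  assumes [measurable]: "f \<in> borel_measurable borel"
  shows "(LINT x|diff_law. f (- x)) = (LINT x|diff_law. f x)"
proof -
  have "pair.P.indep_var borel snd borel fst" by (rule pair.P.indep_var_commute[OF indep_fst_snd])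
  then have "distr (\<nu> \<Otimes>\<^sub>M \<nu>) borel (\<lambda>p. snd p - fst p) = diff_law"
    by (intro distr_indep_diff) (auto simp: distr_fst distr_snd pair.P.prob_space_axioms)
  then have "(LINT x|diff_law. f x) = (LINT x|distr (\<nu> \<Otimes>\<^sub>M \<nu>) borel (\<lambda>p. snd p - fst p). f x)" by simp
  also have "\<dots> = (LINT p|(\<nu> \<Otimes>\<^sub>M \<nu>). f (snd p - fst p))" by (rule integral_distr) measurable
  also have "\<dots> = (LINT x|diff_law. f (- x))" by (simp add: diff_law_integral)
  finally show ?thesis by simp
qed

lemma diff_law_power6: "integrable diff_law (\<lambda>x. x ^ 6)"
proof -
  have ptw: "(u - v) ^ 6 \<le> 64 * (u ^ 6 + v ^ 6)" for u v :: real
  proof -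
    have m: "\<bar>u - v\<bar> \<le> 2 * max \<bar>u\<bar> \<bar>v\<bar>" by linarith
    have "(u - v) ^ 6 = \<bar>u - v\<bar> ^ 6" by (simp add: power_even_abs)
    also have "\<dots> \<le> (2 * max \<bar>u\<bar> \<bar>v\<bar>) ^ 6" by (rule power_mono[OF m]) simp
    also have "\<dots> = 64 * max \<bar>u\<bar> \<bar>v\<bar> ^ 6" by (simp add: power_mult_distrib)
    also have "max \<bar>u\<bar> \<bar>v\<bar> ^ 6 \<le> u ^ 6 + v ^ 6" by (cases "\<bar>u\<bar> \<le> \<bar>v\<bar>") (auto simp: max_def power_even_abs)
    finally show ?thesis by simp
  qed
  have "integrable (distr (\<nu> \<Otimes>\<^sub>M \<nu>) borel fst) (\<lambda>u. u ^ 6)" "integrable (distr (\<nu> \<Otimes>\<^sub>M \<nu>) borel snd) (\<lambda>u. u ^ 6)"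
    using sixth_moment by (simp_all only: distr_fst distr_snd)
  then have "integrable (\<nu> \<Otimes>\<^sub>M \<nu>) (\<lambda>p. fst p ^ 6)" "integrable (\<nu> \<Otimes>\<^sub>M \<nu>) (\<lambda>p. snd p ^ 6)"
    by (simp_all add: integrable_distr_eq)
  then have "integrable (\<nu> \<Otimes>\<^sub>M \<nu>) (\<lambda>p. 64 * (fst p ^ 6 + snd p ^ 6))" by simp
  then have "integrable (\<nu> \<Otimes>\<^sub>M \<nu>) (\<lambda>p. (fst p - snd p) ^ 6)"
    by (rule Bochner_Integration.integrable_bound) (use ptw in auto)
  then show ?thesis by (simp add: diff_law_integrable)
qed

lemma diff_law_power: "m \<le> 6 \<Longrightarrow> integrable diff_law (\<lambda>x. x ^ m)"
  using dl.integrable_power_le_abs[of "\<lambda>u. u" 6 m] diff_law_power6 by (simp add: power_even_abs)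

lemma diff_law_mean: "(LINT x|diff_law. x) = 0"
  using diff_law_symmetric[of "\<lambda>x. x"] by simp

lemma diff_law_second: "(LINT x|diff_law. x\<^sup>2) = 2 * \<sigma>\<^sup>2"
proof -
  have "integrable (distr (\<nu> \<Otimes>\<^sub>M \<nu>) borel fst) (\<lambda>u. u ^ m)" "integrable (distr (\<nu> \<Otimes>\<^sub>M \<nu>) borel snd) (\<lambda>u. u ^ m)"
    if "m \<le> 6" for m using \<nu>_power[OF that] by (simp_all only: distr_fst distr_snd)
  then have int: "integrable (\<nu> \<Otimes>\<^sub>M \<nu>) (\<lambda>p. fst p ^ m)" "integrable (\<nu> \<Otimes>\<^sub>M \<nu>) (\<lambda>p. snd p ^ m)" if "m \<le> 6" for m
    using that by (simp_all add: integrable_distr_eq)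
  have "(LINT u|distr (\<nu> \<Otimes>\<^sub>M \<nu>) borel fst. u ^ m) = (LINT u|\<nu>. u ^ m)"
    "(LINT u|distr (\<nu> \<Otimes>\<^sub>M \<nu>) borel snd. u ^ m) = (LINT u|\<nu>. u ^ m)" for m
    by (simp_all only: distr_fst distr_snd)
  then have val: "(LINT p|(\<nu> \<Otimes>\<^sub>M \<nu>). fst p ^ m) = (LINT u|\<nu>. u ^ m)"
    "(LINT p|(\<nu> \<Otimes>\<^sub>M \<nu>). snd p ^ m) = (LINT u|\<nu>. u ^ m)" for m
    by (simp_all add: integral_distr)
  have cross: "integrable (\<nu> \<Otimes>\<^sub>M \<nu>) (\<lambda>p. fst p * snd p)" "(LINT p|(\<nu> \<Otimes>\<^sub>M \<nu>). fst p * snd p) = 0"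
    using pair.P.indep_var_integrable[OF indep_fst_snd] pair.P.indep_var_lebesgue_integral[OF indep_fst_snd]
      int[of 1] val[of 1] mean by auto
  have "(LINT x|diff_law. x\<^sup>2) = (LINT p|(\<nu> \<Otimes>\<^sub>M \<nu>). (fst p)\<^sup>2 - 2 * (fst p * snd p) + (snd p)\<^sup>2)"
    by (simp add: diff_law_integral power2_eq_square algebra_simps)
  also have "\<dots> = 2 * \<sigma>\<^sup>2"
    using int[of 2] cross val[of 2] second_moment by simp
  finally show ?thesis .
qed

section \<open>Coordinate factors of the expected kernel\<close>

text \<open>The contribution of one coordinate to the expected kernel of two observations whose means differ
  by \<open>a\<close> in that coordinate; the function \<open>\<psi>\<close> of the introduction.\<close>

definition shifted_kernel_mean :: "real \<Rightarrow> real \<Rightarrow> real" where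
  "shifted_kernel_mean g a = (LINT x|diff_law. exp (- (g * (x + a)\<^sup>2)))"

lemma kernel_integrable: "0 \<le> g \<Longrightarrow> integrable diff_law (\<lambda>x. exp (- (g * (x + a)\<^sup>2)))"
  by (rule dl.integrable_const_bound[where B=1]) auto

lemma shifted_kernel_mean_le_1: "0 \<le> g \<Longrightarrow> shifted_kernel_mean g a \<le> 1"
  unfolding shifted_kernel_mean_def
  by (rule order_trans[OF integral_mono[OF kernel_integrable, of _ "\<lambda>_. 1"]]) (auto simp: dl.prob_space)

text \<open>Jensen's inequality for the exponential, by means of the tangent at the mean \<open>2 \<sigma>\<^sup>2\<close> of the
  squared difference.\<close>

lemma shifted_kernel_mean_zero_ge: 
  assumes "0 < g" shows "exp (- (2 * g * \<sigma>\<^sup>2)) \<le> shifted_kernel_mean g 0"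
proof -
  let ?m = "2 * g * \<sigma>\<^sup>2"
  have ptw: "exp (- ?m) * (1 - (g * x\<^sup>2 - ?m)) \<le> exp (- (g * x\<^sup>2))" for x :: real
  proof -
    have "exp (- ?m) * (1 - (g * x\<^sup>2 - ?m)) \<le> exp (- ?m) * exp (- (g * x\<^sup>2 - ?m))"
    proof (rule mult_left_mono)
      show "1 - (g * x\<^sup>2 - ?m) \<le> exp (- (g * x\<^sup>2 - ?m))"
        using exp_ge_add_one_self[of "- (g * x\<^sup>2 - ?m)"] by linarith
    qed simp
    also have "\<dots> = exp (- (g * x\<^sup>2))" by (simp flip: exp_add)
    finally show ?thesis .
  qed
  have int: "integrable diff_law (\<lambda>x. exp (- ?m) * (1 - (g * x\<^sup>2 - ?m)))"
    using diff_law_power[of 2] by simp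
  have "(LINT x|diff_law. exp (- ?m) * (1 - (g * x\<^sup>2 - ?m))) = exp (- ?m)"
    using diff_law_power[of 2] by (simp add: diff_law_second dl.prob_space[unfolded dl.space_eq_univ])
  moreover have "(LINT x|diff_law. exp (- ?m) * (1 - (g * x\<^sup>2 - ?m))) \<le> shifted_kernel_mean g 0"
    unfolding shifted_kernel_mean_def
    by (intro integral_mono int) (use ptw kernel_integrable[of g 0] assms in auto)
  ultimately show ?thesis by simp
qed

text \<open>Averaging over the sign of the difference turns the cross term of the square into a hyperbolic
  cosine, which contains no first-order term in the shift.\<close>

lemma shifted_kernel_mean_symmetrised:
  assumes "0 \<le> g"
  shows "integrable diff_law (\<lambda>x. exp (- (g * x\<^sup>2)) * ((exp (2 * g * a * x) + exp (- (2 * g * a * x))) / 2))"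
    and "shifted_kernel_mean g a = exp (- (g * a\<^sup>2)) *
      (LINT x|diff_law. exp (- (g * x\<^sup>2)) * ((exp (2 * g * a * x) + exp (- (2 * g * a * x))) / 2))"
proof -
  have *: "exp (- (g * x\<^sup>2)) * ((exp (2 * g * a * x) + exp (- (2 * g * a * x))) / 2)
      = exp (g * a\<^sup>2) * ((exp (- (g * (x + a)\<^sup>2)) + exp (- (g * (x - a)\<^sup>2))) / 2)" for x
    by (simp add: field_simps power2_eq_square flip: exp_add)
  have i: "integrable diff_law (\<lambda>x. exp (- (g * (x + a)\<^sup>2)))" "integrable diff_law (\<lambda>x. exp (- (g * (x - a)\<^sup>2)))"
    using kernel_integrable[OF assms, of a] kernel_integrable[OF assms, of "- a"] by auto
  show "integrable diff_law (\<lambda>x. exp (- (g * x\<^sup>2)) * ((exp (2 * g * a * x) + exp (- (2 * g * a * x))) / 2))"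
    unfolding * using i by simp
  have "(LINT x|diff_law. exp (- (g * (x - a)\<^sup>2))) = shifted_kernel_mean g a"
    using diff_law_symmetric[of "\<lambda>x. exp (- (g * (x + a)\<^sup>2))"]
    by (simp add: shifted_kernel_mean_def power2_eq_square algebra_simps)
  then have "(LINT x|diff_law. exp (g * a\<^sup>2) * ((exp (- (g * (x + a)\<^sup>2)) + exp (- (g * (x - a)\<^sup>2))) / 2))
      = exp (g * a\<^sup>2) * shifted_kernel_mean g a"
    using i by (simp add: shifted_kernel_mean_def)
  then show "shifted_kernel_mean g a = exp (- (g * a\<^sup>2)) *
      (LINT x|diff_law. exp (- (g * x\<^sup>2)) * ((exp (2 * g * a * x) + exp (- (2 * g * a * x))) / 2))"
    unfolding * by (simp add: exp_minus)
qed

lemma shifted_kernel_mean_lower: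
  assumes "0 \<le> g"
  shows "exp (- (g * a\<^sup>2)) * shifted_kernel_mean g 0 \<le> shifted_kernel_mean g a"
proof -
  have ch: "1 \<le> (exp y + exp (- y)) / 2" for y :: real
    using cosh_real_ge_1[of y] by (simp add: cosh_field_def)
  have "shifted_kernel_mean g 0 \<le>
      (LINT x|diff_law. exp (- (g * x\<^sup>2)) * ((exp (2 * g * a * x) + exp (- (2 * g * a * x))) / 2))"
    unfolding shifted_kernel_mean_def
  proof (rule integral_mono[OF kernel_integrable[OF assms] shifted_kernel_mean_symmetrised(1)[OF assms]])
    fix x
    have "exp (- (g * x\<^sup>2)) * 1 \<le> exp (- (g * x\<^sup>2)) * ((exp (2 * g * a * x) + exp (- (2 * g * a * x))) / 2)"
      using ch[of "2 * g * a * x"] by (intro mult_left_mono) auto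
    then show "exp (- (g * (x + 0)\<^sup>2)) \<le> exp (- (g * x\<^sup>2)) * ((exp (2 * g * a * x) + exp (- (2 * g * a * x))) / 2)"
      by simp
  qed
  then show ?thesis by (subst shifted_kernel_mean_symmetrised(2)[OF assms]) (intro mult_left_mono, auto)
qed

text \<open>Expanding the hyperbolic cosine costs a relative error of order \<open>g\<^sup>2 a\<^sup>2 \<sigma>\<^sup>2\<close>. For small
  \<open>g \<sigma>\<^sup>2\<close> this is a fraction of \<open>g a\<^sup>2\<close>, and half of the decay \<open>exp (- g a\<^sup>2)\<close> survives.\<close>

lemma shifted_kernel_mean_upper:
  assumes g: "0 < g" and g\<sigma>: "32 * g * \<sigma>\<^sup>2 \<le> 1" and ga: "2 * g * a\<^sup>2 \<le> 1"
  shows "shifted_kernel_mean g a \<le> exp (- (g * a\<^sup>2 / 2)) * shifted_kernel_mean g 0"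
proof -
  have exp_half: "exp (1 / 2 :: real) \<le> 2"
  proof -
    have "exp (1 / 2 :: real) \<le> 1 + 1 / 2 + (1 / 2)\<^sup>2" by (rule exp_bound) auto
    then show ?thesis by (simp add: power2_eq_square)
  qed
  have ptw: "exp (- (g * x\<^sup>2)) * ((exp (2 * g * a * x) + exp (- (2 * g * a * x))) / 2)
      \<le> exp (- (g * x\<^sup>2)) + 4 * g\<^sup>2 * a\<^sup>2 * x\<^sup>2" for x
  proof -
    define y where "y = 2 * g * a * x"
    have "(exp y + exp (- y)) / 2 \<le> 1 + y\<^sup>2 / 2 * exp \<bar>y\<bar>"
      using exp_le_quadratic[of y] exp_le_quadratic[of "- y"] by simp
    then have "exp (- (g * x\<^sup>2)) * ((exp y + exp (- y)) / 2) \<le> exp (- (g * x\<^sup>2)) * (1 + y\<^sup>2 / 2 * exp \<bar>y\<bar>)"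
      by (intro mult_left_mono) auto
    also have "\<dots> = exp (- (g * x\<^sup>2)) + y\<^sup>2 / 2 * exp (\<bar>y\<bar> - g * x\<^sup>2)"
      by (simp add: algebra_simps exp_diff exp_minus field_simps)
    also have "\<bar>y\<bar> - g * x\<^sup>2 \<le> 1 / 2"
    proof -
      have "0 \<le> g * (\<bar>x\<bar> - \<bar>a\<bar>)\<^sup>2" using g by simp
      also have "\<dots> = g * x\<^sup>2 + g * a\<^sup>2 - \<bar>y\<bar>"
        using g by (simp add: y_def power2_eq_square abs_mult algebra_simps)
      finally show ?thesis using ga by linarith
    qed
    then have "y\<^sup>2 / 2 * exp (\<bar>y\<bar> - g * x\<^sup>2) \<le> y\<^sup>2 / 2 * 2"
      using exp_half by (intro mult_left_mono order_trans[OF _ exp_half]) auto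
    finally show ?thesis by (simp add: y_def power_mult_distrib mult_ac)
  qed
  let ?\<psi> = "shifted_kernel_mean g 0"
  have half: "1 / 2 \<le> ?\<psi>"
    using shifted_kernel_mean_zero_ge[OF g] exp_ge_add_one_self[of "- (2 * g * \<sigma>\<^sup>2)"] g\<sigma> by linarith
  have "(LINT x|diff_law. exp (- (g * x\<^sup>2)) * ((exp (2 * g * a * x) + exp (- (2 * g * a * x))) / 2))
      \<le> (LINT x|diff_law. exp (- (g * x\<^sup>2)) + 4 * g\<^sup>2 * a\<^sup>2 * x\<^sup>2)"
    using kernel_integrable[of g 0] diff_law_power[of 2] g
    by (intro integral_mono ptw shifted_kernel_mean_symmetrised) auto
  also have "\<dots> = ?\<psi> + 4 * g\<^sup>2 * a\<^sup>2 * (2 * \<sigma>\<^sup>2)"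
    using kernel_integrable[of g 0] diff_law_power[of 2] g
    by (simp add: shifted_kernel_mean_def diff_law_second)
  also have "\<dots> \<le> ?\<psi> * exp (g * a\<^sup>2 / 2)"
  proof -
    have "4 * g\<^sup>2 * a\<^sup>2 * (2 * \<sigma>\<^sup>2) = (32 * g * \<sigma>\<^sup>2) * (g * a\<^sup>2 / 4)" by (simp add: power2_eq_square)
    also have "\<dots> \<le> 1 * (g * a\<^sup>2 / 4)" using g\<sigma> g by (intro mult_right_mono) auto
    also have "\<dots> = 1 / 2 * (g * a\<^sup>2 / 2)" by simp
    also have "\<dots> \<le> ?\<psi> * (g * a\<^sup>2 / 2)" using half g by (intro mult_right_mono) auto
    finally have "?\<psi> + 4 * g\<^sup>2 * a\<^sup>2 * (2 * \<sigma>\<^sup>2) \<le> ?\<psi> * (1 + g * a\<^sup>2 / 2)" by (simp add: algebra_simps)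
    also have "\<dots> \<le> ?\<psi> * exp (g * a\<^sup>2 / 2)"
      using half by (intro mult_left_mono exp_ge_add_one_self) auto
    finally show ?thesis .
  qed
  finally have "shifted_kernel_mean g a \<le> exp (- (g * a\<^sup>2)) * (?\<psi> * exp (g * a\<^sup>2 / 2))"
    unfolding shifted_kernel_mean_symmetrised(2)[OF less_imp_le[OF g], of a] by (intro mult_left_mono) auto
  also have "\<dots> = exp (- (g * a\<^sup>2 / 2)) * ?\<psi>" by (simp add: mult.left_commute flip: exp_add)
  finally show ?thesis .
qed

end

section \<open>First-order expansion of the kernel\<close>

context coordinate_law begin

definition sq_var :: real where "sq_var = (LINT x|diff_law. (x\<^sup>2 - 2 * \<sigma>\<^sup>2)\<^sup>2)"
definition sq_abs3 :: real where "sq_abs3 = (LINT x|diff_law. \<bar>x\<^sup>2 - 2 * \<sigma>\<^sup>2\<bar> ^ 3)"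
definition fourth_moment :: real where "fourth_moment = (LINT x|diff_law. x ^ 4)"

lemma sq_var_nonneg: "0 \<le> sq_var" unfolding sq_var_def by simp

lemma sq_dev_integrable:
  shows "integrable diff_law (\<lambda>x. \<bar>x\<^sup>2 - 2 * \<sigma>\<^sup>2\<bar> ^ 3)"
    and "integrable diff_law (\<lambda>x. (x\<^sup>2 - 2 * \<sigma>\<^sup>2)\<^sup>2)"
    and "integrable diff_law (\<lambda>x. x\<^sup>2 - 2 * \<sigma>\<^sup>2)"
proof -
  let ?c = "2 * \<sigma>\<^sup>2"
  have "integrable diff_law (\<lambda>x. x ^ 6 + 3 * ?c * x ^ 4 + 3 * ?c\<^sup>2 * x\<^sup>2 + ?c ^ 3)"
    using diff_law_power[of 6] diff_law_power[of 4] diff_law_power[of 2] by simp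
  then show *: "integrable diff_law (\<lambda>x. \<bar>x\<^sup>2 - ?c\<bar> ^ 3)"
  proof (rule Bochner_Integration.integrable_bound)
    show "AE x in diff_law. norm (\<bar>x\<^sup>2 - ?c\<bar> ^ 3) \<le> norm (x ^ 6 + 3 * ?c * x ^ 4 + 3 * ?c\<^sup>2 * x\<^sup>2 + ?c ^ 3)"
    proof (rule AE_I2)
      fix x :: real
      have "\<bar>x\<^sup>2 - ?c\<bar> ^ 3 \<le> (x\<^sup>2 + ?c) ^ 3"
        by (intro power_mono order_trans[OF abs_triangle_ineq4]) auto
      also have "\<dots> = x ^ 6 + 3 * ?c * x ^ 4 + 3 * ?c\<^sup>2 * x\<^sup>2 + ?c ^ 3"
        by (simp add: eval_nat_numeral algebra_simps)
      finally show "norm (\<bar>x\<^sup>2 - ?c\<bar> ^ 3) \<le> norm (x ^ 6 + 3 * ?c * x ^ 4 + 3 * ?c\<^sup>2 * x\<^sup>2 + ?c ^ 3)"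
        by simp
    qed
  qed simp
  show "integrable diff_law (\<lambda>x. (x\<^sup>2 - ?c)\<^sup>2)" "integrable diff_law (\<lambda>x. x\<^sup>2 - ?c)"
    using dl.integrable_power_le_abs[OF _ *, of 2] dl.integrable_power_le_abs[OF _ *, of 1] by auto
qed

end

text \<open>The coordinates of the difference of two independent noise vectors.\<close>

locale diff_family = coordinate_law \<nu> \<sigma> + prob_space P
  for \<nu> \<sigma> and P :: "'b measure" +
  fixes D :: "nat \<Rightarrow> 'b \<Rightarrow> real" and d :: nat
  assumes indep: "indep_vars (\<lambda>_. borel) D {..<d}"
    and D_law: "j < d \<Longrightarrow> distr P borel (D j) = diff_law"
begin

lemma measurable_D [measurable]: "j < d \<Longrightarrow> D j \<in> borel_measurable P"
  using indep by (simp add: indep_vars_def2)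

lemma
  fixes f :: "real \<Rightarrow> real"
  assumes j: "j < d" and [measurable]: "f \<in> borel_measurable borel"
  shows D_expectation: "expectation (\<lambda>\<omega>. f (D j \<omega>)) = (LINT x|diff_law. f x)"
    and D_integrable: "integrable P (\<lambda>\<omega>. f (D j \<omega>)) \<longleftrightarrow> integrable diff_law f"
  unfolding D_law[OF j, symmetric] using j by (simp_all add: integral_distr integrable_distr_eq)

definition sq_dev :: "'b \<Rightarrow> real" where
  "sq_dev \<omega> = (\<Sum>j<d. (D j \<omega>)\<^sup>2 - 2 * \<sigma>\<^sup>2)"

definition lin :: "(nat \<Rightarrow> real) \<Rightarrow> 'b \<Rightarrow> real" where
  "lin e \<omega> = (\<Sum>j<d. e j * D j \<omega>)"

lemma measurable_sq_dev [measurable]: "sq_dev \<in> borel_measurable P"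
  unfolding sq_dev_def[abs_def] by measurable

lemma measurable_lin [measurable]: "lin e \<in> borel_measurable P"
  unfolding lin_def[abs_def] by measurable

lemma
  shows sq_dev3_integrable: "integrable P (\<lambda>\<omega>. \<bar>sq_dev \<omega>\<bar> ^ 3)"
    and sq_dev3: "expectation (\<lambda>\<omega>. \<bar>sq_dev \<omega>\<bar> ^ 3) \<le> d * (3 * sqrt (d * sq_var) * sq_var + sq_abs3)"
    and sq_dev2_integrable: "integrable P (\<lambda>\<omega>. (sq_dev \<omega>)\<^sup>2)"
    and sq_dev2: "expectation (\<lambda>\<omega>. (sq_dev \<omega>)\<^sup>2) = d * sq_var"
proof -
  let ?Z = "\<lambda>j \<omega>. (D j \<omega>)\<^sup>2 - 2 * \<sigma>\<^sup>2"
  have ind: "indep_vars (\<lambda>_. borel) ?Z {..<d}" by (rule indep_vars_compose2[OF indep]) measurable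
  have Z3: "integrable P (\<lambda>\<omega>. \<bar>?Z j \<omega>\<bar> ^ 3)" "expectation (\<lambda>\<omega>. \<bar>?Z j \<omega>\<bar> ^ 3) \<le> sq_abs3"
    and Z2: "integrable P (\<lambda>\<omega>. (?Z j \<omega>)\<^sup>2)" "expectation (\<lambda>\<omega>. (?Z j \<omega>)\<^sup>2) = sq_var"
    and Z1: "expectation (?Z j) = 0" if "j < d" for j
    using D_integrable[OF that, of "\<lambda>x. \<bar>x\<^sup>2 - 2 * \<sigma>\<^sup>2\<bar> ^ 3"] D_expectation[OF that, of "\<lambda>x. \<bar>x\<^sup>2 - 2 * \<sigma>\<^sup>2\<bar> ^ 3"]
      D_integrable[OF that, of "\<lambda>x. (x\<^sup>2 - 2 * \<sigma>\<^sup>2)\<^sup>2"] D_expectation[OF that, of "\<lambda>x. (x\<^sup>2 - 2 * \<sigma>\<^sup>2)\<^sup>2"]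
      D_expectation[OF that, of "\<lambda>x. x\<^sup>2 - 2 * \<sigma>\<^sup>2"]
      sq_dev_integrable diff_law_power[of 2] diff_law_second
    by (simp_all add: sq_abs3_def sq_var_def dl.prob_space[unfolded dl.space_eq_univ])
  show "integrable P (\<lambda>\<omega>. \<bar>sq_dev \<omega>\<bar> ^ 3)" unfolding sq_dev_def
    by (rule integrable_sum_abs3[OF ind, where v=sq_var and \<kappa>=sq_abs3]) (simp_all add: Z1 Z2 Z3 sq_var_nonneg)
  show "expectation (\<lambda>\<omega>. \<bar>sq_dev \<omega>\<bar> ^ 3) \<le> d * (3 * sqrt (d * sq_var) * sq_var + sq_abs3)" unfolding sq_dev_def
    by (rule expectation_sum_abs3_le[OF ind, where v=sq_var and \<kappa>=sq_abs3]) (simp_all add: Z1 Z2 Z3 sq_var_nonneg)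
  show "integrable P (\<lambda>\<omega>. (sq_dev \<omega>)\<^sup>2)" unfolding sq_dev_def
    by (rule integrable_sum_power2[OF _ ind]) (simp_all add: Z1 Z2)
  have "expectation (\<lambda>\<omega>. (sq_dev \<omega>)\<^sup>2) = (\<Sum>j<d. expectation (\<lambda>\<omega>. (?Z j \<omega>)\<^sup>2))" unfolding sq_dev_def
    by (rule expectation_sum_power2[OF _ ind]) (simp_all add: Z1 Z2)
  then show "expectation (\<lambda>\<omega>. (sq_dev \<omega>)\<^sup>2) = d * sq_var" by (simp add: Z2)
qed

lemma
  shows lin2_integrable: "integrable P (\<lambda>\<omega>. (lin e \<omega>)\<^sup>2)"
    and lin2: "expectation (\<lambda>\<omega>. (lin e \<omega>)\<^sup>2) = 2 * \<sigma>\<^sup>2 * (\<Sum>j<d. (e j)\<^sup>2)"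
proof -
  let ?Z = "\<lambda>j \<omega>. e j * D j \<omega>"
  have ind: "indep_vars (\<lambda>_. borel) ?Z {..<d}" by (rule indep_vars_compose2[OF indep]) measurable
  have Z2: "integrable P (\<lambda>\<omega>. (?Z j \<omega>)\<^sup>2)" "expectation (\<lambda>\<omega>. (?Z j \<omega>)\<^sup>2) = (e j)\<^sup>2 * (2 * \<sigma>\<^sup>2)"
    and Z1: "expectation (?Z j) = 0" if "j < d" for j
    using D_integrable[OF that, of "\<lambda>x. x\<^sup>2"] D_expectation[OF that, of "\<lambda>x. x\<^sup>2"]
      D_expectation[OF that, of "\<lambda>x. x"] diff_law_power[of 2] diff_law_second diff_law_mean
    by (simp_all add: power_mult_distrib)
  show "integrable P (\<lambda>\<omega>. (lin e \<omega>)\<^sup>2)" unfolding lin_def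
    by (rule integrable_sum_power2[OF _ ind Z2(1) Z1]) simp_all
  have "expectation (\<lambda>\<omega>. (lin e \<omega>)\<^sup>2) = (\<Sum>j<d. expectation (\<lambda>\<omega>. (?Z j \<omega>)\<^sup>2))" unfolding lin_def
    by (rule expectation_sum_power2[OF _ ind Z2(1) Z1]) simp_all
  then show "expectation (\<lambda>\<omega>. (lin e \<omega>)\<^sup>2) = 2 * \<sigma>\<^sup>2 * (\<Sum>j<d. (e j)\<^sup>2)"
    by (simp add: Z2 sum_distrib_left sum_distrib_right mult_ac)
qed

lemma expectation_kernel:
  assumes "0 \<le> g"
  shows "expectation (\<lambda>\<omega>. exp (- (g * (\<Sum>j<d. (D j \<omega> + e j)\<^sup>2)))) = (\<Prod>j<d. shifted_kernel_mean g (e j))"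
proof -
  have "expectation (\<lambda>\<omega>. exp (- (g * (\<Sum>j<d. (D j \<omega> + e j)\<^sup>2))))
      = expectation (\<lambda>\<omega>. \<Prod>j<d. exp (- (g * (D j \<omega> + e j)\<^sup>2)))"
    by (simp add: exp_sum sum_distrib_left flip: sum_negf)
  also have "\<dots> = (\<Prod>j<d. expectation (\<lambda>\<omega>. exp (- (g * (D j \<omega> + e j)\<^sup>2))))"
  proof (rule indep_vars_lebesgue_integral)
    show "indep_vars (\<lambda>_. borel) (\<lambda>j \<omega>. exp (- (g * (D j \<omega> + e j)\<^sup>2))) {..<d}"
      by (rule indep_vars_compose2[OF indep]) measurable
    show "integrable P (\<lambda>\<omega>. exp (- (g * (D j \<omega> + e j)\<^sup>2)))" if "j \<in> {..<d}" for j
      using D_integrable[of j "\<lambda>x. exp (- (g * (x + e j)\<^sup>2))"] that kernel_integrable[OF assms] by simp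
  qed simp
  also have "\<dots> = (\<Prod>j<d. shifted_kernel_mean g (e j))"
    by (intro prod.cong refl) (simp add: D_expectation[where f="\<lambda>x. exp (- (g * (x + _)\<^sup>2))"] shifted_kernel_mean_def)
  finally show ?thesis .
qed

text \<open>The centred part of the exponent \<open>g \<parallel>D + e\<parallel>\<^sup>2\<close>; see \<open>sq_norm_shift\<close>.\<close>

definition fluct :: "real \<Rightarrow> (nat \<Rightarrow> real) \<Rightarrow> 'b \<Rightarrow> real" where
  "fluct g e \<omega> = g * (sq_dev \<omega> + 2 * lin e \<omega>)"

definition taylor_rem :: "real \<Rightarrow> (nat \<Rightarrow> real) \<Rightarrow> 'b \<Rightarrow> real" where
  "taylor_rem g e \<omega> = exp (- fluct g e \<omega>) - 1 + fluct g e \<omega>"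

lemma measurable_fluct [measurable]: "fluct g e \<in> borel_measurable P"
  unfolding fluct_def[abs_def] by measurable

lemma measurable_taylor_rem [measurable]: "taylor_rem g e \<in> borel_measurable P"
  unfolding taylor_rem_def[abs_def] by measurable

lemma sq_norm_shift:
  "g * (\<Sum>j<d. (D j \<omega> + e j)\<^sup>2) = g * (2 * \<sigma>\<^sup>2 * d + (\<Sum>j<d. (e j)\<^sup>2)) + fluct g e \<omega>"
  by (simp add: fluct_def sq_dev_def lin_def power2_sum sum.distrib sum_subtractf sum_distrib_left algebra_simps)

lemma kernel_expansion:
  "exp (- (g * (\<Sum>j<d. (D j \<omega> + e j)\<^sup>2)))
    = exp (- (g * (2 * \<sigma>\<^sup>2 * d + (\<Sum>j<d. (e j)\<^sup>2)))) * (1 - fluct g e \<omega> + taylor_rem g e \<omega>)"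
  unfolding sq_norm_shift taylor_rem_def by (simp flip: exp_add)

lemma
  shows fluct2_integrable: "integrable P (\<lambda>\<omega>. (fluct g e \<omega>)\<^sup>2)"
    and fluct2: "expectation (\<lambda>\<omega>. (fluct g e \<omega>)\<^sup>2) \<le> 2 * g\<^sup>2 * (d * sq_var + 8 * \<sigma>\<^sup>2 * (\<Sum>j<d. (e j)\<^sup>2))"
proof -
  have ptw: "(fluct g e \<omega>)\<^sup>2 \<le> 2 * g\<^sup>2 * ((sq_dev \<omega>)\<^sup>2 + 4 * (lin e \<omega>)\<^sup>2)" for \<omega>
  proof -
    have "0 \<le> g\<^sup>2 * (sq_dev \<omega> - 2 * lin e \<omega>)\<^sup>2" by simp
    then show ?thesis by (simp add: fluct_def power2_eq_square algebra_simps)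
  qed
  have int: "integrable P (\<lambda>\<omega>. 2 * g\<^sup>2 * ((sq_dev \<omega>)\<^sup>2 + 4 * (lin e \<omega>)\<^sup>2))"
    using sq_dev2_integrable lin2_integrable by simp
  show *: "integrable P (\<lambda>\<omega>. (fluct g e \<omega>)\<^sup>2)"
    by (rule Bochner_Integration.integrable_bound[OF int])
      (use ptw in \<open>auto intro!: order_trans[OF _ abs_ge_self]\<close>)
  have "expectation (\<lambda>\<omega>. (fluct g e \<omega>)\<^sup>2) \<le> expectation (\<lambda>\<omega>. 2 * g\<^sup>2 * ((sq_dev \<omega>)\<^sup>2 + 4 * (lin e \<omega>)\<^sup>2))"
    by (intro integral_mono * int ptw)
  also have "\<dots> = 2 * g\<^sup>2 * (d * sq_var + 8 * \<sigma>\<^sup>2 * (\<Sum>j<d. (e j)\<^sup>2))"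
    using sq_dev2_integrable lin2_integrable by (simp add: sq_dev2 lin2)
  finally show "expectation (\<lambda>\<omega>. (fluct g e \<omega>)\<^sup>2) \<le> 2 * g\<^sup>2 * (d * sq_var + 8 * \<sigma>\<^sup>2 * (\<Sum>j<d. (e j)\<^sup>2))" .
qed

text \<open>The exponent is nonnegative, so its centred part is bounded below by minus the centre, and the
  centre is at most \<open>\<kappa>\<close>. The quadratic part of the fluctuation enters with its third absolute moment and
  the part linear in \<open>e\<close> with its variance.\<close>

lemma
  assumes g: "0 \<le> g" and \<kappa>: "g * (2 * \<sigma>\<^sup>2 * d + (\<Sum>j<d. (e j)\<^sup>2)) \<le> \<kappa>"
  shows taylor_rem2_integrable: "integrable P (\<lambda>\<omega>. (taylor_rem g e \<omega>)\<^sup>2)"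
    and taylor_rem2: "expectation (\<lambda>\<omega>. (taylor_rem g e \<omega>)\<^sup>2) \<le> exp (2 * \<kappa>) *
      (8 * g ^ 3 * (d * (3 * sqrt (d * sq_var) * sq_var + sq_abs3)) + 32 * g\<^sup>2 * \<sigma>\<^sup>2 * (\<Sum>j<d. (e j)\<^sup>2))"
proof -
  let ?E2 = "\<Sum>j<d. (e j)\<^sup>2"
  have \<kappa>0: "0 \<le> \<kappa>" by (rule order_trans[OF _ \<kappa>]) (use g in \<open>simp add: sum_nonneg\<close>)
  have ptw: "(taylor_rem g e \<omega>)\<^sup>2 \<le> exp (2 * \<kappa>) * (8 * g ^ 3 * \<bar>sq_dev \<omega>\<bar> ^ 3 + 16 * g\<^sup>2 * (lin e \<omega>)\<^sup>2)" for \<omega>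
  proof -
    have "0 \<le> g * (\<Sum>j<d. (D j \<omega> + e j)\<^sup>2)" using g by (simp add: sum_nonneg)
    then have "- \<kappa> \<le> fluct g e \<omega>" using sq_norm_shift[of g \<omega> e] \<kappa> by linarith
    then have "(taylor_rem g e \<omega>)\<^sup>2 \<le> exp (2 * \<kappa>) * min (fluct g e \<omega> ^ 4) ((fluct g e \<omega>)\<^sup>2)"
      unfolding taylor_rem_def by (rule exp_remainder_square_le[OF _ \<kappa>0])
    also have "min (fluct g e \<omega> ^ 4) ((fluct g e \<omega>)\<^sup>2) \<le> 8 * \<bar>g * sq_dev \<omega>\<bar> ^ 3 + 4 * (2 * g * lin e \<omega>)\<^sup>2"
      using min_power_sum_le[of "g * sq_dev \<omega>" "2 * g * lin e \<omega>"] by (simp add: fluct_def algebra_simps)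
    also have "\<dots> = 8 * g ^ 3 * \<bar>sq_dev \<omega>\<bar> ^ 3 + 16 * g\<^sup>2 * (lin e \<omega>)\<^sup>2"
      using g by (simp add: abs_mult power_mult_distrib)
    finally show ?thesis by simp
  qed
  have int: "integrable P (\<lambda>\<omega>. exp (2 * \<kappa>) * (8 * g ^ 3 * \<bar>sq_dev \<omega>\<bar> ^ 3 + 16 * g\<^sup>2 * (lin e \<omega>)\<^sup>2))"
    using sq_dev3_integrable lin2_integrable by simp
  show *: "integrable P (\<lambda>\<omega>. (taylor_rem g e \<omega>)\<^sup>2)"
    by (rule Bochner_Integration.integrable_bound[OF int])
      (use ptw in \<open>auto intro!: order_trans[OF _ abs_ge_self]\<close>)
  have "expectation (\<lambda>\<omega>. (taylor_rem g e \<omega>)\<^sup>2)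
      \<le> expectation (\<lambda>\<omega>. exp (2 * \<kappa>) * (8 * g ^ 3 * \<bar>sq_dev \<omega>\<bar> ^ 3 + 16 * g\<^sup>2 * (lin e \<omega>)\<^sup>2))"
    by (intro integral_mono * int ptw)
  also have "\<dots> = exp (2 * \<kappa>) * (8 * g ^ 3 * expectation (\<lambda>\<omega>. \<bar>sq_dev \<omega>\<bar> ^ 3) + 16 * g\<^sup>2 * (2 * \<sigma>\<^sup>2 * ?E2))"
    using sq_dev3_integrable lin2_integrable by (simp add: lin2)
  also have "\<dots> \<le> exp (2 * \<kappa>) *
      (8 * g ^ 3 * (d * (3 * sqrt (d * sq_var) * sq_var + sq_abs3)) + 16 * g\<^sup>2 * (2 * \<sigma>\<^sup>2 * ?E2))"
    using sq_dev3 g by (intro mult_left_mono add_right_mono) auto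
  finally show "expectation (\<lambda>\<omega>. (taylor_rem g e \<omega>)\<^sup>2) \<le> exp (2 * \<kappa>) *
      (8 * g ^ 3 * (d * (3 * sqrt (d * sq_var) * sq_var + sq_abs3)) + 32 * g\<^sup>2 * \<sigma>\<^sup>2 * ?E2)"
    by (simp add: mult_ac)
qed

end

section \<open>The statistic of one pair of observations\<close>

text \<open>The bound on the squared \<open>L\<^sup>2\<close> distance between standardised statistic and standardised bilinear
  form when \<open>g d \<le> K\<close> and \<open>q = \<parallel>e\<parallel>\<^sup>2 / d\<close>. It tends to zero as \<open>d \<rightarrow> \<infinity>\<close> and \<open>q \<rightarrow> 0\<close> with \<open>K\<close> fixed. The
  three summands stem from the terms linear in \<open>e\<close>, from the unequal centres of the mixed and unmixed
  distances, and from the Taylor remainders.\<close>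

definition (in coordinate_law) rel_error :: "real \<Rightarrow> real \<Rightarrow> real \<Rightarrow> real" where
  "rel_error K d q = (16 * \<sigma>\<^sup>2 * q + 4 * K\<^sup>2 * q\<^sup>2 * (sq_var + 8 * \<sigma>\<^sup>2 * q)
     + 4 * exp (2 * (2 * K * \<sigma>\<^sup>2 + K * q)) * (8 * K * ((3 * sqrt (d * sq_var) * sq_var + sq_abs3) / d) + 32 * \<sigma>\<^sup>2 * q))
     / (2 * \<sigma> ^ 4)"

text \<open>The quantity \<open>h\<close> for one pair of observations in rotated coordinates: \<open>y 0, y 1, y 2, y 3\<close>
  are the noise vectors \<open>s, t, s', t'\<close>, and \<open>e\<close> is the rotated difference of the means.\<close>

definition pair_stat :: "nat \<Rightarrow> real \<Rightarrow> (nat \<Rightarrow> real) \<Rightarrow> (nat \<Rightarrow> nat \<Rightarrow> real) \<Rightarrow> real" where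
  "pair_stat d g e y = exp (- (g * (\<Sum>j<d. (y 0 j - y 2 j)\<^sup>2))) + exp (- (g * (\<Sum>j<d. (y 1 j - y 3 j)\<^sup>2)))
     - exp (- (g * (\<Sum>j<d. (y 0 j - y 3 j + e j)\<^sup>2))) - exp (- (g * (\<Sum>j<d. (y 2 j - y 1 j + e j)\<^sup>2)))"

definition pair_bilinear :: "nat \<Rightarrow> (nat \<Rightarrow> nat \<Rightarrow> real) \<Rightarrow> real" where
  "pair_bilinear d y = (\<Sum>j<d. (y 0 j - y 1 j) * (y 2 j - y 3 j))"

definition (in coordinate_law) mmd_mean :: "nat \<Rightarrow> real \<Rightarrow> (nat \<Rightarrow> real) \<Rightarrow> real" where
  "mmd_mean d g e = 2 * (shifted_kernel_mean g 0 ^ d - (\<Prod>j<d. shifted_kernel_mean g (e j)))"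

text \<open>The standard deviation of the leading term \<open>2 g \<tau> \<langle>s - t, s' - t'\<rangle>\<close> of the statistic.\<close>

definition (in coordinate_law) mmd_scale :: "nat \<Rightarrow> real \<Rightarrow> real" where
  "mmd_scale d g = 4 * g * exp (- (g * (2 * \<sigma>\<^sup>2 * d))) * \<sigma>\<^sup>2 * sqrt d"

text \<open>The four noise vectors \<open>s, t, s', t'\<close> of one pair of observations, in this order: \<open>Y q j\<close> is the
  \<open>j\<close>-th coordinate of the \<open>q\<close>-th vector.\<close>

locale noise_block = coordinate_law \<nu> \<sigma> + prob_space P
  for \<nu> \<sigma> and P :: "'b measure" +
  fixes Y :: "nat \<Rightarrow> nat \<Rightarrow> 'b \<Rightarrow> real" and d :: nat
  assumes indep_Y: "indep_vars (\<lambda>_. borel) (\<lambda>(q, j). Y q j) ({..<4} \<times> {..<d})"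
    and Y_law: "q < 4 \<Longrightarrow> j < d \<Longrightarrow> distr P borel (Y q j) = \<nu>"
begin

(* Keeps the index of Y 1 in the form in which the definitions and interpretations below use it. *)
declare One_nat_def [simp del]

lemma measurable_Y [measurable]: "q < 4 \<Longrightarrow> j < d \<Longrightarrow> Y q j \<in> borel_measurable P"
  using indep_Y by (auto simp: indep_vars_def2)

lemma indep_coordinates:
  fixes F :: "(nat \<Rightarrow> real) \<Rightarrow> real"
  assumes "F \<in> borel_measurable (\<Pi>\<^sub>M q\<in>{..<4}. borel)"
  shows "indep_vars (\<lambda>_. borel) (\<lambda>j \<omega>. F (\<lambda>q\<in>{..<4}. Y q j \<omega>)) {..<d}"
proof -
  let ?X = "\<lambda>i \<omega>. (case i of (q, j) \<Rightarrow> Y q j) \<omega>"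
  have "indep_vars (\<lambda>j. \<Pi>\<^sub>M i\<in>{..<4} \<times> {j}. borel) (\<lambda>j \<omega>. restrict (\<lambda>i. ?X i \<omega>) ({..<4} \<times> {j})) {..<d}"
    by (rule indep_vars_restrict[OF indep_Y]) (auto simp: disjoint_family_on_def)
  then have "indep_vars (\<lambda>_. borel) (\<lambda>j \<omega>. F (\<lambda>q\<in>{..<4}. restrict (\<lambda>i. ?X i \<omega>) ({..<4} \<times> {j}) (q, j))) {..<d}"
  proof (rule indep_vars_compose2)
    fix j
    have "(\<lambda>f. \<lambda>q\<in>{..<4}. f (q, j)) \<in> (\<Pi>\<^sub>M i\<in>{..<4} \<times> {j}. borel :: real measure) \<rightarrow>\<^sub>M (\<Pi>\<^sub>M q\<in>{..<4}. borel)"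
      by (intro measurable_restrict measurable_component_singleton) auto
    then show "(\<lambda>f. F (\<lambda>q\<in>{..<4}. f (q, j))) \<in> borel_measurable (\<Pi>\<^sub>M i\<in>{..<4} \<times> {j}. borel)"
      by (rule measurable_compose) (rule assms)
  qed
  moreover have "(\<lambda>q\<in>{..<4}. restrict (\<lambda>i. ?X i \<omega>) ({..<4} \<times> {j}) (q, j)) = (\<lambda>q\<in>{..<4}. Y q j \<omega>)" for j \<omega>
    by (auto simp: fun_eq_iff restrict_def)
  ultimately show ?thesis by simp
qed

lemma indep_pair:
  assumes "q < 4" "r < 4" "q \<noteq> r" "j < d"
  shows "indep_var borel (Y q j) borel (Y r j)"
proof -
  have "indep_var borel ((\<lambda>f. f (q, j)) \<circ> (\<lambda>\<omega>. restrict (\<lambda>i. (case i of (q, j) \<Rightarrow> Y q j) \<omega>) {(q, j)}))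
      borel ((\<lambda>f. f (r, j)) \<circ> (\<lambda>\<omega>. restrict (\<lambda>i. (case i of (q, j) \<Rightarrow> Y q j) \<omega>) {(r, j)}))"
    using assms by (intro indep_var_compose[OF indep_var_restrict[OF indep_Y]]) auto
  then show ?thesis by (simp add: o_def)
qed

lemma diff_family:
  assumes "q < 4" "r < 4" "q \<noteq> r"
  shows "diff_family \<nu> \<sigma> P (\<lambda>j \<omega>. Y q j \<omega> - Y r j \<omega>) d"
proof
  have "indep_vars (\<lambda>_. borel) (\<lambda>j \<omega>. (\<lambda>f. f q - f r) (\<lambda>q\<in>{..<4}. Y q j \<omega>)) {..<d}"
    using assms by (intro indep_coordinates borel_measurable_diff measurable_component_singleton) auto
  then show "indep_vars (\<lambda>_. borel) (\<lambda>j \<omega>. Y q j \<omega> - Y r j \<omega>) {..<d}" using assms by simp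
  show "distr P borel (\<lambda>\<omega>. Y q j \<omega> - Y r j \<omega>) = diff_law" if "j < d" for j
    using assms that by (intro distr_indep_diff indep_pair Y_law prob_space_axioms)
qed

definition block_h :: "real \<Rightarrow> (nat \<Rightarrow> real) \<Rightarrow> 'b \<Rightarrow> real" where
  "block_h g e \<omega> = pair_stat d g e (\<lambda>q j. Y q j \<omega>)"

definition bilinear :: "'b \<Rightarrow> real" where
  "bilinear \<omega> = pair_bilinear d (\<lambda>q j. Y q j \<omega>)"

lemma measurable_block_h [measurable]: "block_h g e \<in> borel_measurable P"
  unfolding block_h_def[abs_def] pair_stat_def by measurable

lemma measurable_bilinear [measurable]: "bilinear \<in> borel_measurable P"
  unfolding bilinear_def[abs_def] pair_bilinear_def by measurable

lemma block_h_integrable: "0 \<le> g \<Longrightarrow> integrable P (block_h g e)"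
  unfolding block_h_def[abs_def] pair_stat_def
  by (intro Bochner_Integration.integrable_add Bochner_Integration.integrable_diff integrable_const_bound[where B=1])
    (auto simp: sum_nonneg)

lemma block_h_expectation:
  assumes "0 \<le> g" shows "expectation (block_h g e) = mmd_mean d g e"
proof -
  interpret F02: diff_family \<nu> \<sigma> P "\<lambda>j \<omega>. Y 0 j \<omega> - Y 2 j \<omega>" d by (rule diff_family) auto
  interpret F13: diff_family \<nu> \<sigma> P "\<lambda>j \<omega>. Y 1 j \<omega> - Y 3 j \<omega>" d by (rule diff_family) auto
  interpret F03: diff_family \<nu> \<sigma> P "\<lambda>j \<omega>. Y 0 j \<omega> - Y 3 j \<omega>" d by (rule diff_family) auto
  interpret F21: diff_family \<nu> \<sigma> P "\<lambda>j \<omega>. Y 2 j \<omega> - Y 1 j \<omega>" d by (rule diff_family) auto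
  have i: "integrable P (\<lambda>\<omega>. exp (- (g * (\<Sum>j<d. (Y 0 j \<omega> - Y 2 j \<omega>)\<^sup>2))))"
    "integrable P (\<lambda>\<omega>. exp (- (g * (\<Sum>j<d. (Y 1 j \<omega> - Y 3 j \<omega>)\<^sup>2))))"
    "integrable P (\<lambda>\<omega>. exp (- (g * (\<Sum>j<d. (Y 0 j \<omega> - Y 3 j \<omega> + e j)\<^sup>2))))"
    "integrable P (\<lambda>\<omega>. exp (- (g * (\<Sum>j<d. (Y 2 j \<omega> - Y 1 j \<omega> + e j)\<^sup>2))))"
    using assms by (intro integrable_const_bound[where B=1]; auto simp: sum_nonneg)+
  show ?thesis
    unfolding block_h_def pair_stat_def mmd_mean_def
    using i F02.expectation_kernel[OF assms, of "\<lambda>_. 0"] F13.expectation_kernel[OF assms, of "\<lambda>_. 0"]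
      F03.expectation_kernel[OF assms, of e] F21.expectation_kernel[OF assms, of e]
    by simp
qed

text \<open>A coordinate contributes the product of two independent differences, with second moment
  \<open>(2 \<sigma>\<^sup>2)\<^sup>2\<close>.\<close>

lemma
  shows bilinear_integrable: "integrable P bilinear"
    and bilinear_mean: "expectation bilinear = 0"
    and bilinear2: "expectation (\<lambda>\<omega>. (bilinear \<omega>)\<^sup>2) = d * (4 * \<sigma> ^ 4)"
    and bilinear4_integrable: "integrable P (\<lambda>\<omega>. bilinear \<omega> ^ 4)"
    and bilinear4: "expectation (\<lambda>\<omega>. bilinear \<omega> ^ 4) \<le> d * (6 * (d * (4 * \<sigma> ^ 4)) * (4 * \<sigma> ^ 4) + fourth_moment\<^sup>2)"
proof -
  interpret F01: diff_family \<nu> \<sigma> P "\<lambda>j \<omega>. Y 0 j \<omega> - Y 1 j \<omega>" d by (rule diff_family) auto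
  interpret F23: diff_family \<nu> \<sigma> P "\<lambda>j \<omega>. Y 2 j \<omega> - Y 3 j \<omega>" d by (rule diff_family) auto
  let ?X = "\<lambda>j \<omega>. (Y 0 j \<omega> - Y 1 j \<omega>) * (Y 2 j \<omega> - Y 3 j \<omega>)"
  have "indep_vars (\<lambda>_. borel) (\<lambda>j \<omega>. (\<lambda>f. (f 0 - f 1) * (f 2 - f 3)) (\<lambda>q\<in>{..<4}. Y q j \<omega>)) {..<d}"
    by (intro indep_coordinates borel_measurable_times borel_measurable_diff measurable_component_singleton) auto
  then have ind: "indep_vars (\<lambda>_. borel) ?X {..<d}" by simp
  have ind2: "indep_var borel (\<lambda>\<omega>. (Y 0 j \<omega> - Y 1 j \<omega>) ^ m) borel (\<lambda>\<omega>. (Y 2 j \<omega> - Y 3 j \<omega>) ^ m)" if "j < d" for j m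
  proof -
    let ?r = "\<lambda>A \<omega>. restrict (\<lambda>i. (case i of (q, j) \<Rightarrow> Y q j) \<omega>) A"
    have "indep_var borel ((\<lambda>f. (f (0, j) - f (1, j)) ^ m) \<circ> ?r {(0, j), (1, j)})
        borel ((\<lambda>f. (f (2, j) - f (3, j)) ^ m) \<circ> ?r {(2, j), (3, j)})"
      using that by (intro indep_var_compose[OF indep_var_restrict[OF indep_Y]]
          borel_measurable_power borel_measurable_diff measurable_component_singleton) auto
    then show ?thesis by (simp add: o_def)
  qed
  have X: "integrable P (\<lambda>\<omega>. ?X j \<omega> ^ m)" "expectation (\<lambda>\<omega>. ?X j \<omega> ^ m) = (LINT x|diff_law. x ^ m)\<^sup>2"
    if "j < d" "m \<le> 4" for j m
  proof -
    have "integrable P (\<lambda>\<omega>. (Y 0 j \<omega> - Y 1 j \<omega>) ^ m)" "integrable P (\<lambda>\<omega>. (Y 2 j \<omega> - Y 3 j \<omega>) ^ m)"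
      "expectation (\<lambda>\<omega>. (Y 0 j \<omega> - Y 1 j \<omega>) ^ m) = (LINT x|diff_law. x ^ m)"
      "expectation (\<lambda>\<omega>. (Y 2 j \<omega> - Y 3 j \<omega>) ^ m) = (LINT x|diff_law. x ^ m)"
      using F01.D_integrable[OF that(1), of "\<lambda>x. x ^ m"] F23.D_integrable[OF that(1), of "\<lambda>x. x ^ m"]
        F01.D_expectation[OF that(1), of "\<lambda>x. x ^ m"] F23.D_expectation[OF that(1), of "\<lambda>x. x ^ m"]
        diff_law_power[of m] that(2) by simp_all
    then show "integrable P (\<lambda>\<omega>. ?X j \<omega> ^ m)" "expectation (\<lambda>\<omega>. ?X j \<omega> ^ m) = (LINT x|diff_law. x ^ m)\<^sup>2"
      using indep_var_integrable[OF ind2[OF that(1), of m]] indep_var_lebesgue_integral[OF ind2[OF that(1), of m]]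
      by (simp_all add: power_mult_distrib power2_eq_square)
  qed
  have X1: "integrable P (?X j)" "expectation (?X j) = 0"
    and X2: "integrable P (\<lambda>\<omega>. (?X j \<omega>)\<^sup>2)" "expectation (\<lambda>\<omega>. (?X j \<omega>)\<^sup>2) = 4 * \<sigma> ^ 4"
    and X4: "integrable P (\<lambda>\<omega>. ?X j \<omega> ^ 4)" "expectation (\<lambda>\<omega>. ?X j \<omega> ^ 4) = fourth_moment\<^sup>2" if "j < d" for j
    using X[OF that, of 1] X[OF that, of 2] X[OF that, of 4]
    by (simp_all add: diff_law_mean diff_law_second fourth_moment_def power_mult_distrib flip: power_mult)
  show "integrable P bilinear" unfolding bilinear_def[abs_def] pair_bilinear_def
    by (intro Bochner_Integration.integrable_sum X1) simp
  show "expectation bilinear = 0" unfolding bilinear_def[abs_def] pair_bilinear_def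
    by (subst Bochner_Integration.integral_sum) (simp_all add: X1 del: One_nat_def)
  have "expectation (\<lambda>\<omega>. (bilinear \<omega>)\<^sup>2) = (\<Sum>j<d. expectation (\<lambda>\<omega>. (?X j \<omega>)\<^sup>2))" unfolding bilinear_def pair_bilinear_def
    by (rule expectation_sum_power2[OF _ ind X2(1) X1(2)]) simp_all
  then show "expectation (\<lambda>\<omega>. (bilinear \<omega>)\<^sup>2) = d * (4 * \<sigma> ^ 4)" by (simp add: X2)
  show "integrable P (\<lambda>\<omega>. bilinear \<omega> ^ 4)" unfolding bilinear_def pair_bilinear_def
    by (rule integrable_sum_power4[OF ind, where v="4 * \<sigma> ^ 4" and \<kappa>="fourth_moment\<^sup>2"]) (simp_all add: X1(2) X2 X4)
  show "expectation (\<lambda>\<omega>. bilinear \<omega> ^ 4) \<le> d * (6 * (d * (4 * \<sigma> ^ 4)) * (4 * \<sigma> ^ 4) + fourth_moment\<^sup>2)" unfolding bilinear_def pair_bilinear_def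
    by (rule expectation_sum_power4_le[OF ind, where v="4 * \<sigma> ^ 4" and \<kappa>="fourth_moment\<^sup>2"]) (simp_all add: X1(2) X2 X4)
qed

text \<open>Linearising the four kernels around their centres leaves four groups of terms: constants, which
  the mean absorbs; a combination of squared distances, which collapses to the bilinear form plus terms
  linear in \<open>e\<close>; a defect from the factor \<open>\<rho> = exp (- g \<parallel>e\<parallel>\<^sup>2)\<close> by which the mixed kernels are centred
  lower; and the Taylor remainders. Centring an \<open>L\<^sup>2\<close> variable does not increase its second
  moment, so the remainder can be bounded before its mean is subtracted.\<close>

lemma
  fixes g K q :: real
  assumes g: "0 < g" and d: "0 < d" and gd: "g * d \<le> K"
    and q: "q = (\<Sum>j<d. (e j)\<^sup>2) / d"
  defines "R \<equiv> \<lambda>\<omega>. (block_h g e \<omega> - mmd_mean d g e) / mmd_scale d g - bilinear \<omega> / (2 * \<sigma>\<^sup>2 * sqrt d)"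
  shows remainder2_integrable: "integrable P (\<lambda>\<omega>. (R \<omega>)\<^sup>2)"
    and remainder2: "expectation (\<lambda>\<omega>. (R \<omega>)\<^sup>2) \<le> rel_error K d q"
proof -
  let ?E2 = "\<Sum>j<d. (e j)\<^sup>2"
  let ?z = "\<lambda>_ :: nat. 0 :: real"
  define \<tau> where "\<tau> = exp (- (g * (2 * \<sigma>\<^sup>2 * d)))"
  define \<rho> where "\<rho> = exp (- (g * ?E2))"
  define \<kappa> where "\<kappa> = 2 * K * \<sigma>\<^sup>2 + K * q"
  define T where "T = d * (3 * sqrt (d * sq_var) * sq_var + sq_abs3)"
  interpret F02: diff_family \<nu> \<sigma> P "\<lambda>j \<omega>. Y 0 j \<omega> - Y 2 j \<omega>" d by (rule diff_family) auto
  interpret F13: diff_family \<nu> \<sigma> P "\<lambda>j \<omega>. Y 1 j \<omega> - Y 3 j \<omega>" d by (rule diff_family) auto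
  interpret F03: diff_family \<nu> \<sigma> P "\<lambda>j \<omega>. Y 0 j \<omega> - Y 3 j \<omega>" d by (rule diff_family) auto
  interpret F21: diff_family \<nu> \<sigma> P "\<lambda>j \<omega>. Y 2 j \<omega> - Y 1 j \<omega>" d by (rule diff_family) auto
  have d': "0 < real d" using d by simp
  have E2: "0 \<le> ?E2" "?E2 = q * d" using d' by (auto simp: q sum_nonneg)
  have q0: "0 \<le> q" by (simp add: q sum_nonneg)
  have K0: "0 \<le> K" by (rule order_trans[OF _ gd]) (use g in simp)
  have gE2: "g * ?E2 \<le> K * q"
    unfolding E2(2) using mult_right_mono[OF gd q0] by (simp add: mult_ac)
  have gs: "g * (2 * \<sigma>\<^sup>2 * d) \<le> 2 * K * \<sigma>\<^sup>2"
    using mult_right_mono[OF gd, of "2 * \<sigma>\<^sup>2"] by (simp add: mult_ac)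
  have \<kappa>: "g * (2 * \<sigma>\<^sup>2 * d + ?E2) \<le> \<kappa>"
    using gE2 gs by (simp add: \<kappa>_def algebra_simps)
  have \<kappa>z: "g * (2 * \<sigma>\<^sup>2 * d + (\<Sum>j<d. (?z j)\<^sup>2)) \<le> \<kappa>"
  proof -
    have "0 \<le> K * q" using K0 q0 by simp
    then show ?thesis using gs by (simp add: \<kappa>_def)
  qed
  have \<tau>0: "0 < \<tau>" by (simp add: \<tau>_def)
  have \<rho>: "0 \<le> 1 - \<rho>" "1 - \<rho> \<le> K * q" "0 \<le> \<rho>" "\<rho> \<le> 1"
    using exp_ge_add_one_self[of "- (g * ?E2)"] gE2 g E2(1) unfolding \<rho>_def by auto
  define u3 where "u3 = F03.fluct g e"
  define u4 where "u4 = F21.fluct g e"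
  define r1 where "r1 = F02.taylor_rem g ?z"
  define r2 where "r2 = F13.taylor_rem g ?z"
  define r3 where "r3 = F03.taylor_rem g e"
  define r4 where "r4 = F21.taylor_rem g e"
  define Z where "Z \<omega> = 2 * g * F03.lin e \<omega> + 2 * g * F21.lin e \<omega> - ((1 - \<rho>) * u3 \<omega> + (1 - \<rho>) * u4 \<omega>)
    + ((r1 \<omega> + r2 \<omega>) - (\<rho> * r3 \<omega> + \<rho> * r4 \<omega>))" for \<omega>
  \<comment> \<open>The identity \<open>(a - b')\<^sup>2 + (a' - b)\<^sup>2 - (a - a')\<^sup>2 - (b - b')\<^sup>2 = 2 (a - b) (a' - b')\<close> in every coordinate.\<close>
  have fl: "F02.fluct g ?z \<omega> + F13.fluct g ?z \<omega> = u3 \<omega> + u4 \<omega> - (2 * g * bilinear \<omega> + 2 * g * F03.lin e \<omega> + 2 * g * F21.lin e \<omega>)" for \<omega>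
  proof -
    have "F02.sq_dev \<omega> + F13.sq_dev \<omega> = F03.sq_dev \<omega> + F21.sq_dev \<omega> - 2 * bilinear \<omega>"
      unfolding F02.sq_dev_def F13.sq_dev_def F03.sq_dev_def F21.sq_dev_def bilinear_def pair_bilinear_def
        sum_distrib_left sum.distrib[symmetric] sum_subtractf[symmetric]
      by (intro sum.cong refl) (simp add: power2_eq_square algebra_simps)
    then have "g * (F02.sq_dev \<omega> + F13.sq_dev \<omega>) = g * (F03.sq_dev \<omega> + F21.sq_dev \<omega> - 2 * bilinear \<omega>)" by simp
    moreover have "F02.lin ?z \<omega> = 0" "F13.lin ?z \<omega> = 0" by (simp_all add: F02.lin_def F13.lin_def)
    ultimately show ?thesis
      by (simp add: F02.fluct_def F13.fluct_def F03.fluct_def F21.fluct_def u3_def u4_def algebra_simps)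
  qed
  have h_eq: "block_h g e \<omega> = 2 * \<tau> * (1 - \<rho>) + 2 * g * \<tau> * bilinear \<omega> + \<tau> * Z \<omega>" for \<omega>
  proof -
    have \<tau>\<rho>: "exp (- (g * (2 * \<sigma>\<^sup>2 * d + ?E2))) = \<tau> * \<rho>"
      by (simp add: \<tau>_def \<rho>_def algebra_simps flip: exp_add)
    have "block_h g e \<omega> = \<tau> * (1 - F02.fluct g ?z \<omega> + r1 \<omega>) + \<tau> * (1 - F13.fluct g ?z \<omega> + r2 \<omega>)
        - \<tau> * \<rho> * (1 - u3 \<omega> + r3 \<omega>) - \<tau> * \<rho> * (1 - u4 \<omega> + r4 \<omega>)"
      unfolding block_h_def pair_stat_def
      using F02.kernel_expansion[of g \<omega> ?z] F13.kernel_expansion[of g \<omega> ?z]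
        F03.kernel_expansion[of g \<omega> e, unfolded \<tau>\<rho>] F21.kernel_expansion[of g \<omega> e, unfolded \<tau>\<rho>]
      by (simp add: \<tau>_def r1_def r2_def r3_def r4_def u3_def u4_def)
    also have "\<dots> = \<tau> * (2 - (F02.fluct g ?z \<omega> + F13.fluct g ?z \<omega>) + r1 \<omega> + r2 \<omega>
        - \<rho> * (2 - u3 \<omega> - u4 \<omega> + r3 \<omega> + r4 \<omega>))" by (simp add: algebra_simps)
    also have "\<dots> = 2 * \<tau> * (1 - \<rho>) + 2 * g * \<tau> * bilinear \<omega> + \<tau> * Z \<omega>"
      unfolding fl Z_def by (simp add: algebra_simps)
    finally show ?thesis .
  qed
  define Q where "Q \<omega> = 8 * (4 * g\<^sup>2 * (F03.lin e \<omega>)\<^sup>2 + 4 * g\<^sup>2 * (F21.lin e \<omega>)\<^sup>2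
      + (1 - \<rho>)\<^sup>2 * (u3 \<omega>)\<^sup>2 + (1 - \<rho>)\<^sup>2 * (u4 \<omega>)\<^sup>2
      + (r1 \<omega>)\<^sup>2 + (r2 \<omega>)\<^sup>2 + (r3 \<omega>)\<^sup>2 + (r4 \<omega>)\<^sup>2)" for \<omega>
  have ZQ: "(Z \<omega>)\<^sup>2 \<le> Q \<omega>" for \<omega>
  proof -
    have "\<rho>\<^sup>2 \<le> 1" using \<rho> by (simp add: power_le_one)
    then have "\<rho>\<^sup>2 * (r3 \<omega>)\<^sup>2 \<le> (r3 \<omega>)\<^sup>2" "\<rho>\<^sup>2 * (r4 \<omega>)\<^sup>2 \<le> (r4 \<omega>)\<^sup>2"
      by (intro mult_left_le_one_le; simp)+
    then show ?thesis
      using square_sum8_le[of "2 * g * F03.lin e \<omega>" "2 * g * F21.lin e \<omega>" "(1 - \<rho>) * u3 \<omega>" "(1 - \<rho>) * u4 \<omega>" "r1 \<omega>" "r2 \<omega>" "\<rho> * r3 \<omega>" "\<rho> * r4 \<omega>"]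
      unfolding Z_def Q_def power_mult_distrib by simp
  qed
  note ints = F03.lin2_integrable[of e] F21.lin2_integrable[of e] F03.fluct2_integrable[of g e] F21.fluct2_integrable[of g e]
    F02.taylor_rem2_integrable[OF less_imp_le[OF g] \<kappa>z] F13.taylor_rem2_integrable[OF less_imp_le[OF g] \<kappa>z]
    F03.taylor_rem2_integrable[OF less_imp_le[OF g] \<kappa>] F21.taylor_rem2_integrable[OF less_imp_le[OF g] \<kappa>]
  have Q_int: "integrable P Q" unfolding Q_def[abs_def]
    using ints by (simp add: u3_def u4_def r1_def r2_def r3_def r4_def)
  have [measurable]: "Z \<in> borel_measurable P"
    unfolding Z_def[abs_def] u3_def u4_def r1_def r2_def r3_def r4_def by measurable
  have Z2_int: "integrable P (\<lambda>\<omega>. (Z \<omega>)\<^sup>2)"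
    by (rule Bochner_Integration.integrable_bound[OF Q_int])
      (use ZQ in \<open>auto intro!: order_trans[OF _ abs_ge_self]\<close>)
  have Z_int: "integrable P Z" by (rule square_integrable_imp_integrable[OF _ Z2_int]) simp
  define B where "B = exp (2 * \<kappa>) * (8 * g ^ 3 * T + 32 * g\<^sup>2 * \<sigma>\<^sup>2 * ?E2)"
  have Bz: "exp (2 * \<kappa>) * (8 * g ^ 3 * T + 32 * g\<^sup>2 * \<sigma>\<^sup>2 * (\<Sum>j<d. (?z j)\<^sup>2)) \<le> B"
    unfolding B_def using E2 g by (intro mult_left_mono add_left_mono) auto
  have V: "0 \<le> 2 * g\<^sup>2 * (d * sq_var + 8 * \<sigma>\<^sup>2 * ?E2)" using E2(1) sq_var_nonneg by simp
  have \<rho>2: "(1 - \<rho>)\<^sup>2 \<le> (K * q)\<^sup>2" using \<rho> by (intro power_mono) auto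
  have e3: "(1 - \<rho>)\<^sup>2 * expectation (\<lambda>\<omega>. (u3 \<omega>)\<^sup>2) \<le> (K * q)\<^sup>2 * (2 * g\<^sup>2 * (d * sq_var + 8 * \<sigma>\<^sup>2 * ?E2))"
    unfolding u3_def by (rule mult_mono[OF \<rho>2 F03.fluct2]) simp_all
  have e4: "(1 - \<rho>)\<^sup>2 * expectation (\<lambda>\<omega>. (u4 \<omega>)\<^sup>2) \<le> (K * q)\<^sup>2 * (2 * g\<^sup>2 * (d * sq_var + 8 * \<sigma>\<^sup>2 * ?E2))"
    unfolding u4_def by (rule mult_mono[OF \<rho>2 F21.fluct2]) simp_all
  have b1: "expectation (\<lambda>\<omega>. (r1 \<omega>)\<^sup>2) \<le> B"
    unfolding r1_def by (rule order_trans[OF F02.taylor_rem2[OF less_imp_le[OF g] \<kappa>z, folded T_def] Bz])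
  have b2: "expectation (\<lambda>\<omega>. (r2 \<omega>)\<^sup>2) \<le> B"
    unfolding r2_def by (rule order_trans[OF F13.taylor_rem2[OF less_imp_le[OF g] \<kappa>z, folded T_def] Bz])
  have b3: "expectation (\<lambda>\<omega>. (r3 \<omega>)\<^sup>2) \<le> B"
    unfolding r3_def B_def by (rule F03.taylor_rem2[OF less_imp_le[OF g] \<kappa>, folded T_def])
  have b4: "expectation (\<lambda>\<omega>. (r4 \<omega>)\<^sup>2) \<le> B"
    unfolding r4_def B_def by (rule F21.taylor_rem2[OF less_imp_le[OF g] \<kappa>, folded T_def])
  have "expectation Q = 8 * (4 * g\<^sup>2 * (2 * \<sigma>\<^sup>2 * ?E2) + 4 * g\<^sup>2 * (2 * \<sigma>\<^sup>2 * ?E2)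
      + (1 - \<rho>)\<^sup>2 * expectation (\<lambda>\<omega>. (u3 \<omega>)\<^sup>2) + (1 - \<rho>)\<^sup>2 * expectation (\<lambda>\<omega>. (u4 \<omega>)\<^sup>2)
      + expectation (\<lambda>\<omega>. (r1 \<omega>)\<^sup>2) + expectation (\<lambda>\<omega>. (r2 \<omega>)\<^sup>2) + expectation (\<lambda>\<omega>. (r3 \<omega>)\<^sup>2) + expectation (\<lambda>\<omega>. (r4 \<omega>)\<^sup>2))"
    unfolding Q_def using ints by (simp add: u3_def u4_def r1_def r2_def r3_def r4_def F03.lin2 F21.lin2)
  also have "\<dots> \<le> 8 * (4 * g\<^sup>2 * (2 * \<sigma>\<^sup>2 * ?E2) + 4 * g\<^sup>2 * (2 * \<sigma>\<^sup>2 * ?E2)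
      + (K * q)\<^sup>2 * (2 * g\<^sup>2 * (d * sq_var + 8 * \<sigma>\<^sup>2 * ?E2)) + (K * q)\<^sup>2 * (2 * g\<^sup>2 * (d * sq_var + 8 * \<sigma>\<^sup>2 * ?E2))
      + B + B + B + B)"
    by (intro mult_left_mono add_mono e3 e4 b1 b2 b3 b4 order_refl) simp
  also have "\<dots> = 128 * g\<^sup>2 * \<sigma>\<^sup>2 * ?E2 + 32 * g\<^sup>2 * (K * q)\<^sup>2 * (d * sq_var + 8 * \<sigma>\<^sup>2 * ?E2) + 32 * B"
    by (simp add: algebra_simps)
  finally have EQ: "expectation Q \<le> 128 * g\<^sup>2 * \<sigma>\<^sup>2 * ?E2 + 32 * g\<^sup>2 * (K * q)\<^sup>2 * (d * sq_var + 8 * \<sigma>\<^sup>2 * ?E2) + 32 * B" .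
  let ?s = "mmd_scale d g"
  have s0: "0 < ?s" using g \<sigma>_pos d' by (simp add: mmd_scale_def)
  have s: "?s = 4 * g * \<tau> * \<sigma>\<^sup>2 * sqrt d" by (simp add: mmd_scale_def \<tau>_def)
  have mean: "mmd_mean d g e = 2 * \<tau> * (1 - \<rho>) + \<tau> * expectation Z"
  proof -
    have "expectation (block_h g e) = 2 * \<tau> * (1 - \<rho>) + \<tau> * expectation Z"
      unfolding h_eq using Z_int bilinear_integrable bilinear_mean by (simp add: prob_space)
    then show ?thesis using block_h_expectation[of g e] g by simp
  qed
  have R: "R \<omega> = \<tau> / ?s * (Z \<omega> - expectation Z)" for \<omega>
  proof -
    have "2 * g * \<tau> * bilinear \<omega> / ?s = bilinear \<omega> / (2 * \<sigma>\<^sup>2 * sqrt d)"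
      unfolding s using g \<tau>0 \<sigma>_pos d' by (simp add: field_simps)
    then show ?thesis unfolding R_def mean h_eq using s0
      by (simp add: add_divide_distrib diff_divide_distrib algebra_simps)
  qed
  have R2: "(R \<omega>)\<^sup>2 = (\<tau> / ?s)\<^sup>2 * (Z \<omega> - expectation Z)\<^sup>2" for \<omega> unfolding R by (rule power_mult_distrib)
  have Zc: "integrable P (\<lambda>\<omega>. (Z \<omega> - expectation Z)\<^sup>2)"
    unfolding power2_diff using Z_int Z2_int by simp
  show "integrable P (\<lambda>\<omega>. (R \<omega>)\<^sup>2)" unfolding R2 using Zc by simp
  have "expectation (\<lambda>\<omega>. (R \<omega>)\<^sup>2) = (\<tau> / ?s)\<^sup>2 * variance Z" unfolding R2 by simp
  also have "\<dots> \<le> (\<tau> / ?s)\<^sup>2 * expectation Q"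
  proof (intro mult_left_mono)
    have "variance Z \<le> expectation (\<lambda>\<omega>. (Z \<omega>)\<^sup>2)" using variance_eq[OF Z_int Z2_int] by simp
    also have "\<dots> \<le> expectation Q" by (intro integral_mono Z2_int Q_int ZQ)
    finally show "variance Z \<le> expectation Q" .
  qed simp
  also have "\<dots> \<le> (\<tau> / ?s)\<^sup>2 * (128 * g\<^sup>2 * \<sigma>\<^sup>2 * ?E2 + 32 * g\<^sup>2 * (K * q)\<^sup>2 * (d * sq_var + 8 * \<sigma>\<^sup>2 * ?E2) + 32 * B)"
    by (intro mult_left_mono EQ) simp
  also have "(\<tau> / ?s)\<^sup>2 = 1 / (16 * g\<^sup>2 * \<sigma> ^ 4 * d)"
    unfolding s using \<tau>0 d' by (simp add: power_divide power_mult_distrib field_simps flip: power_mult)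
  also have "1 / (16 * g\<^sup>2 * \<sigma> ^ 4 * d) * (128 * g\<^sup>2 * \<sigma>\<^sup>2 * ?E2 + 32 * g\<^sup>2 * (K * q)\<^sup>2 * (d * sq_var + 8 * \<sigma>\<^sup>2 * ?E2) + 32 * B)
     = 1 / (16 * g\<^sup>2 * \<sigma> ^ 4 * d) * (128 * g\<^sup>2 * \<sigma>\<^sup>2 * (q * d) + 32 * g\<^sup>2 * (K * q)\<^sup>2 * (d * sq_var + 8 * \<sigma>\<^sup>2 * (q * d))
       + 32 * (exp (2 * \<kappa>) * (8 * g ^ 3 * T + 32 * g\<^sup>2 * \<sigma>\<^sup>2 * (q * d))))"
    unfolding B_def E2(2) ..
  also have "\<dots> = (16 * \<sigma>\<^sup>2 * q + 4 * (K * q)\<^sup>2 * (sq_var + 8 * \<sigma>\<^sup>2 * q)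
      + 4 * exp (2 * \<kappa>) * (8 * g * (T / d) + 32 * \<sigma>\<^sup>2 * q)) / (2 * \<sigma> ^ 4)"
    using g \<sigma>_pos d' by (simp add: field_simps power2_eq_square power3_eq_cube)
  also have "\<dots> \<le> rel_error K d q"
  proof -
    let ?t = "3 * sqrt (d * sq_var) * sq_var + sq_abs3"
    have t0: "0 \<le> ?t" using sq_var_nonneg by (simp add: sq_abs3_def)
    have "g \<le> K / d" using gd d' by (simp add: field_simps)
    then have "g * ?t \<le> K / d * ?t" by (rule mult_right_mono[OF _ t0])
    moreover have "T / d = ?t" using d' by (simp add: T_def)
    ultimately have "8 * g * (T / d) + 32 * \<sigma>\<^sup>2 * q \<le> 8 * K * (?t / d) + 32 * \<sigma>\<^sup>2 * q" by simp
    then have "4 * exp (2 * \<kappa>) * (8 * g * (T / d) + 32 * \<sigma>\<^sup>2 * q)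
        \<le> 4 * exp (2 * \<kappa>) * (8 * K * (?t / d) + 32 * \<sigma>\<^sup>2 * q)" by (rule mult_left_mono) simp
    then show ?thesis unfolding rel_error_def \<kappa>_def power_mult_distrib using \<sigma>_pos
      by (intro divide_right_mono) (simp_all add: mult.assoc)
  qed
  finally show "expectation (\<lambda>\<omega>. (R \<omega>)\<^sup>2) \<le> rel_error K d q" .
qed

end

section \<open>Size of the population discrepancy\<close>

text \<open>The bounds on the factors multiply to
  \<open>exp (- g \<parallel>e\<parallel>\<^sup>2) \<le> \<Prod>\<psi>(e\<^sub>j) / \<psi>(0)\<^sup>d \<le> exp (- g \<parallel>e\<parallel>\<^sup>2 / 2)\<close>, and \<open>\<psi>(0)\<^sup>d\<close> lies between
  \<open>exp (- 2 g d \<sigma>\<^sup>2)\<close> and one.\<close>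

lemma (in coordinate_law) mmd_mean_bounds:
  assumes g: "0 < g" "32 * g * \<sigma>\<^sup>2 \<le> 1" and small: "g * (\<Sum>j<d. (e j)\<^sup>2) \<le> 1 / 2"
  shows "exp (- (g * (2 * \<sigma>\<^sup>2 * d))) * (g * (\<Sum>j<d. (e j)\<^sup>2)) / 2 \<le> mmd_mean d g e"
    and "mmd_mean d g e \<le> 2 * (g * (\<Sum>j<d. (e j)\<^sup>2))"
proof -
  let ?E = "g * (\<Sum>j<d. (e j)\<^sup>2)" and ?\<psi> = "shifted_kernel_mean g 0"
  have g0: "0 \<le> g" using g by simp
  have E0: "0 \<le> ?E" using g by (simp add: sum_nonneg)
  have \<psi>0: "0 < ?\<psi>" by (rule less_le_trans[OF _ shifted_kernel_mean_zero_ge[OF g(1)]]) simp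
  have ge: "2 * g * (e j)\<^sup>2 \<le> 1" if "j < d" for j
  proof -
    have "(e j)\<^sup>2 \<le> (\<Sum>j<d. (e j)\<^sup>2)" using that by (intro member_le_sum) auto
    then have "g * (e j)\<^sup>2 \<le> ?E" using g by (intro mult_left_mono) auto
    then show ?thesis using small by simp
  qed
  have lo: "exp (- ?E) * ?\<psi> ^ d \<le> (\<Prod>j<d. shifted_kernel_mean g (e j))"
  proof -
    have "exp (- ?E) * ?\<psi> ^ d = (\<Prod>j<d. exp (- (g * (e j)\<^sup>2)) * ?\<psi>)"
      by (simp add: prod.distrib sum_distrib_left exp_sum flip: sum_negf)
    also have "\<dots> \<le> (\<Prod>j<d. shifted_kernel_mean g (e j))"
      using shifted_kernel_mean_lower[OF g0] \<psi>0 by (intro prod_mono) auto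
    finally show ?thesis .
  qed
  have up: "(\<Prod>j<d. shifted_kernel_mean g (e j)) \<le> exp (- (?E / 2)) * ?\<psi> ^ d"
  proof -
    have "0 \<le> shifted_kernel_mean g a" for a unfolding shifted_kernel_mean_def by simp
    then have "(\<Prod>j<d. shifted_kernel_mean g (e j)) \<le> (\<Prod>j<d. exp (- (g * (e j)\<^sup>2 / 2)) * ?\<psi>)"
      using shifted_kernel_mean_upper[OF g ge] by (intro prod_mono) auto
    also have "\<dots> = exp (- (?E / 2)) * ?\<psi> ^ d"
      by (simp add: prod.distrib sum_distrib_left sum_divide_distrib exp_sum flip: sum_negf)
    finally show ?thesis .
  qed
  have \<psi>1: "?\<psi> ^ d \<le> 1" using \<psi>0 shifted_kernel_mean_le_1[OF g0] by (intro power_le_one) auto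
  have \<psi>\<tau>: "exp (- (g * (2 * \<sigma>\<^sup>2 * d))) \<le> ?\<psi> ^ d"
  proof -
    have "exp (- (g * (2 * \<sigma>\<^sup>2 * d))) = exp (- (2 * g * \<sigma>\<^sup>2)) ^ d" by (simp add: mult_ac flip: exp_of_nat_mult)
    also have "\<dots> \<le> ?\<psi> ^ d" by (intro power_mono shifted_kernel_mean_zero_ge g) simp
    finally show ?thesis .
  qed
  have quarter: "a * b / 2 = 2 * (a * (b / 2 / 2))" for a b :: real by simp
  have "exp (- (g * (2 * \<sigma>\<^sup>2 * d))) * ?E / 2 = 2 * (exp (- (g * (2 * \<sigma>\<^sup>2 * d))) * (?E / 2 / 2))"
    by (rule quarter)
  also have "\<dots> \<le> 2 * (?\<psi> ^ d * (1 - exp (- (?E / 2))))"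
    using E0 small \<psi>0 by (intro mult_left_mono mult_mono[OF \<psi>\<tau>] one_minus_exp_ge_half) simp_all
  also have "\<dots> \<le> mmd_mean d g e" unfolding mmd_mean_def using up by (simp add: algebra_simps)
  finally show "exp (- (g * (2 * \<sigma>\<^sup>2 * d))) * ?E / 2 \<le> mmd_mean d g e" .
  have "mmd_mean d g e \<le> 2 * (?\<psi> ^ d * (1 - exp (- ?E)))" unfolding mmd_mean_def using lo by (simp add: algebra_simps)
  also have "\<dots> \<le> 2 * (1 * ?E)"
  proof (intro mult_left_mono mult_mono[OF \<psi>1])
    show "1 - exp (- ?E) \<le> ?E" using exp_ge_add_one_self[of "- ?E"] by linarith
    show "0 \<le> 1 - exp (- ?E)" using E0 by simp
  qed simp_all
  finally show "mmd_mean d g e \<le> 2 * ?E" by simp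
qed

section \<open>Flattening and regrouping independent families\<close>

text \<open>An event that restricts every coordinate of every vector is an intersection, over the vectors, of
  box events; independence of the vectors and then of the coordinates factorises its probability.\<close>

lemma (in prob_space) indep_vars_flatten:
  assumes fin: "finite I" "finite J"
    and outer: "indep_vars (\<lambda>_. PiM J N) F I"
    and inner: "\<And>i. i \<in> I \<Longrightarrow> indep_vars N (\<lambda>j \<omega>. F i \<omega> j) J"
  shows "indep_vars (\<lambda>(i, j). N j) (\<lambda>(i, j) \<omega>. F i \<omega> j) (I \<times> J)"
proof (cases "I = {} \<or> J = {}")
  case True
  then have empty: "I \<times> J = {}" by auto
  show ?thesis unfolding empty by (simp add: indep_vars_def2 indep_sets_def)
next
  case False
  have rvF: "F i \<in> M \<rightarrow>\<^sub>M PiM J N" if "i \<in> I" for i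
    using outer that by (auto simp: indep_vars_def2)
  have rv: "(\<lambda>\<omega>. F i \<omega> j) \<in> M \<rightarrow>\<^sub>M N j" if "i \<in> I" "j \<in> J" for i j
    using inner[OF that(1)] that(2) by (auto simp: indep_vars_def2)
  show ?thesis
    unfolding indep_vars_def2
  proof (intro conjI ballI)
    show "random_variable (case p of (i, j) \<Rightarrow> N j) (case p of (i, j) \<Rightarrow> \<lambda>\<omega>. F i \<omega> j)" if "p \<in> I \<times> J" for p
      using that rv by auto
    let ?S = "\<lambda>p. {(case p of (i, j) \<Rightarrow> \<lambda>\<omega>. F i \<omega> j) -` A \<inter> space M | A. A \<in> sets (case p of (i, j) \<Rightarrow> N j)}"
    show "indep_sets ?S (I \<times> J)"
    proof (subst indep_sets_finite)
      show "I \<times> J \<noteq> {}" "finite (I \<times> J)" using False fin by auto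
      show "?S p \<subseteq> events" if "p \<in> I \<times> J" for p
        using that rv by (auto intro!: measurable_sets)
      show "space M \<in> ?S p" if "p \<in> I \<times> J" for p
      proof -
        from that obtain i j where p: "p = (i, j)" "i \<in> I" "j \<in> J" by auto
        have "(\<lambda>\<omega>. F i \<omega> j) -` space (N j) \<inter> space M = space M"
          using measurable_space[OF rv[OF p(2,3)]] by auto
        then show ?thesis using p by (auto intro!: exI[of _ "space (N j)"])
      qed
      show "\<forall>A\<in>Pi (I \<times> J) ?S. prob (\<Inter>p\<in>I \<times> J. A p) = (\<Prod>p\<in>I \<times> J. prob (A p))"
      proof
        fix A assume A: "A \<in> Pi (I \<times> J) ?S"
        have "\<forall>i\<in>I. \<forall>j\<in>J. \<exists>B. B \<in> sets (N j) \<and> A (i, j) = (\<lambda>\<omega>. F i \<omega> j) -` B \<inter> space M"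
        proof (intro ballI)
          fix i j assume "i \<in> I" "j \<in> J"
          then have "A (i, j) \<in> ?S (i, j)" by (intro Pi_mem[OF A]) simp
          then show "\<exists>B. B \<in> sets (N j) \<and> A (i, j) = (\<lambda>\<omega>. F i \<omega> j) -` B \<inter> space M" by auto
        qed
        then obtain B where B: "\<And>i j. i \<in> I \<Longrightarrow> j \<in> J \<Longrightarrow> B i j \<in> sets (N j)"
            "\<And>i j. i \<in> I \<Longrightarrow> j \<in> J \<Longrightarrow> A (i, j) = (\<lambda>\<omega>. F i \<omega> j) -` B i j \<inter> space M"
          by metis
        let ?E = "\<lambda>i. F i -` (PiE J (B i)) \<inter> space M"
        have E: "?E i = (\<Inter>j\<in>J. (\<lambda>\<omega>. F i \<omega> j) -` B i j \<inter> space M)" if "i \<in> I" for i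
          using measurable_space[OF rvF[OF that]] False
          by (auto simp: space_PiM PiE_iff)
        have "(\<Inter>p\<in>I \<times> J. A p) = (\<Inter>i\<in>I. ?E i)"
          using False B(2) by (auto simp: E)
        then have "prob (\<Inter>p\<in>I \<times> J. A p) = prob (\<Inter>i\<in>I. F i -` (PiE J (B i)) \<inter> space M)" by simp
        also have "\<dots> = (\<Prod>i\<in>I. prob (?E i))"
          using False fin B(1) by (intro indep_varsD_finite[OF outer]) (auto intro!: sets_PiM_I_finite)
        also have "\<dots> = (\<Prod>i\<in>I. \<Prod>j\<in>J. prob (A (i, j)))"
        proof (intro prod.cong refl)
          fix i assume i: "i \<in> I"
          show "prob (?E i) = (\<Prod>j\<in>J. prob (A (i, j)))"
            unfolding E[OF i] using False fin B i by (subst indep_varsD_finite[OF inner[OF i]]) auto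
        qed
        also have "\<dots> = (\<Prod>p\<in>I \<times> J. prob (A p))"
          by (simp add: prod.cartesian_product)
        finally show "prob (\<Inter>p\<in>I \<times> J. A p) = (\<Prod>p\<in>I \<times> J. prob (A p))" .
      qed
    qed
  qed
qed

lemma (in prob_space) indep_vars_reindex:
  assumes "indep_vars N X I" "inj_on f J" "f ` J \<subseteq> I"
  shows "indep_vars (\<lambda>j. N (f j)) (\<lambda>j. X (f j)) J"
proof -
  have "indep_vars (\<lambda>j. PiM {f j} N) (\<lambda>j \<omega>. restrict (\<lambda>i. X i \<omega>) {f j}) J"
    using assms by (intro indep_vars_restrict[OF assms(1)]) (auto simp: disjoint_family_on_def inj_on_def)
  then have "indep_vars (\<lambda>j. N (f j)) (\<lambda>j \<omega>. (restrict (\<lambda>i. X i \<omega>) {f j}) (f j)) J"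
    by (rule indep_vars_compose2) (auto intro: measurable_component_singleton)
  then show ?thesis by simp
qed

section \<open>Orthogonal matrices\<close>

text \<open>Orthonormal rows have orthonormal columns. The matrix \<open>P = U\<^sup>T U\<close> has trace \<open>d\<close> and squared
  Frobenius norm \<open>d\<close>, both by orthonormality of the rows, so \<open>\<parallel>P - I\<parallel>\<^sup>2 = d - 2 d + d = 0\<close>.\<close>

lemma orthogonal_mat_transpose:
  assumes "orthogonal_mat d U" "i < d" "j < d"
  shows "(\<Sum>l<d. U l i * U l j) = (if i = j then 1 else 0)"
proof -
  let ?P = "\<lambda>i j. \<Sum>l<d. U l i * U l j" and ?I = "\<lambda>i j. if i = j then 1 else 0 :: real"
  have rows: "(\<Sum>i<d. U l i * U m i) = ?I l m" if "l < d" "m < d" for l m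
    using assms(1) that by (simp add: orthogonal_mat_def)
  have "(\<Sum>i<d. \<Sum>j<d. (?P i j)\<^sup>2) = (\<Sum>i<d. \<Sum>j<d. \<Sum>l<d. \<Sum>m<d. (U l i * U m i) * (U l j * U m j))"
    by (intro sum.cong refl) (simp add: power2_eq_square sum_product mult_ac)
  also have "\<dots> = (\<Sum>l<d. \<Sum>m<d. \<Sum>i<d. \<Sum>j<d. (U l i * U m i) * (U l j * U m j))"
  proof -
    have "(\<Sum>i<d. \<Sum>j<d. \<Sum>l<d. \<Sum>m<d. (U l i * U m i) * (U l j * U m j))
        = (\<Sum>i<d. \<Sum>l<d. \<Sum>j<d. \<Sum>m<d. (U l i * U m i) * (U l j * U m j))"
      by (intro sum.cong refl sum.swap)
    also have "\<dots> = (\<Sum>l<d. \<Sum>i<d. \<Sum>j<d. \<Sum>m<d. (U l i * U m i) * (U l j * U m j))" by (rule sum.swap)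
    also have "\<dots> = (\<Sum>l<d. \<Sum>i<d. \<Sum>m<d. \<Sum>j<d. (U l i * U m i) * (U l j * U m j))"
      by (intro sum.cong refl sum.swap)
    also have "\<dots> = (\<Sum>l<d. \<Sum>m<d. \<Sum>i<d. \<Sum>j<d. (U l i * U m i) * (U l j * U m j))"
      by (intro sum.cong refl sum.swap)
    finally show ?thesis .
  qed
  also have "\<dots> = (\<Sum>l<d. \<Sum>m<d. (\<Sum>i<d. U l i * U m i) * (\<Sum>j<d. U l j * U m j))"
    by (simp add: sum_product)
  also have "\<dots> = (\<Sum>l<d. \<Sum>m<d. ?I l m)"
    by (intro sum.cong refl) (auto simp: rows)
  also have "\<dots> = d" by simp
  finally have sq: "(\<Sum>i<d. \<Sum>j<d. (?P i j)\<^sup>2) = d" .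
  have "(\<Sum>i<d. ?P i i) = (\<Sum>l<d. \<Sum>i<d. U l i * U l i)" by (rule sum.swap)
  also have "\<dots> = d" by (simp add: rows)
  finally have tr: "(\<Sum>i<d. ?P i i) = d" .
  have row: "(\<Sum>j<d. (p j - ?I i j)\<^sup>2) = (\<Sum>j<d. (p j)\<^sup>2) - 2 * p i + 1" if "i < d" for p :: "nat \<Rightarrow> real" and i
  proof -
    have "(\<Sum>j<d. (p j - ?I i j)\<^sup>2) = (\<Sum>j<d. (p j)\<^sup>2 - (if i = j then 2 * p j else 0) + ?I i j)"
      by (intro sum.cong refl) (simp add: power2_eq_square algebra_simps)
    also have "\<dots> = (\<Sum>j<d. (p j)\<^sup>2) - 2 * p i + 1"
      using that by (simp add: sum.distrib sum_subtractf)
    finally show ?thesis .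
  qed
  have "(\<Sum>i<d. \<Sum>j<d. (?P i j - ?I i j)\<^sup>2) = (\<Sum>i<d. (\<Sum>j<d. (?P i j)\<^sup>2) - 2 * ?P i i + 1)"
    by (intro sum.cong refl row) simp
  also have "\<dots> = (\<Sum>i<d. \<Sum>j<d. (?P i j)\<^sup>2) - 2 * (\<Sum>i<d. ?P i i) + d"
    by (simp only: sum.distrib sum_subtractf sum_distrib_left[symmetric]) simp
  also have "\<dots> = 0" unfolding sq tr by simp
  finally have "(\<Sum>j<d. (?P i j - ?I i j)\<^sup>2) = 0"
    using assms(2) by (subst (asm) sum_nonneg_eq_0_iff) (auto intro: sum_nonneg)
  then have "(?P i j - ?I i j)\<^sup>2 = 0"
    using assms(3) by (subst (asm) sum_nonneg_eq_0_iff) auto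
  then show ?thesis by simp
qed

lemma orthogonal_mat_isometry:
  assumes "orthogonal_mat d U"
  shows "(\<Sum>j<d. (\<Sum>l<d. U j l * w l)\<^sup>2) = (\<Sum>l<d. (w l)\<^sup>2)"
proof -
  have "(\<Sum>j<d. (\<Sum>l<d. U j l * w l)\<^sup>2) = (\<Sum>j<d. \<Sum>l<d. \<Sum>m<d. (w l * w m) * (U j l * U j m))"
    by (intro sum.cong refl) (simp add: power2_eq_square sum_product mult_ac)
  also have "\<dots> = (\<Sum>l<d. \<Sum>j<d. \<Sum>m<d. (w l * w m) * (U j l * U j m))" by (rule sum.swap)
  also have "\<dots> = (\<Sum>l<d. \<Sum>m<d. \<Sum>j<d. (w l * w m) * (U j l * U j m))"
    by (intro sum.cong refl sum.swap)
  also have "\<dots> = (\<Sum>l<d. \<Sum>m<d. (w l * w m) * (\<Sum>j<d. U j l * U j m))"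
    by (simp add: sum_distrib_left)
  also have "\<dots> = (\<Sum>l<d. \<Sum>m<d. (w l * w m) * (if l = m then 1 else 0))"
    by (intro sum.cong refl) (simp add: orthogonal_mat_transpose[OF assms])
  also have "\<dots> = (\<Sum>l<d. (w l)\<^sup>2)"
    by (simp add: if_distrib power2_eq_square cong: if_cong)
  finally show ?thesis .
qed

lemma orthogonal_mat_preimage:
  assumes "orthogonal_mat d U" "j < d"
  shows "(\<Sum>l<d. U j l * (\<Sum>i<d. U i l * v i)) = v j"
proof -
  have "(\<Sum>l<d. U j l * (\<Sum>i<d. U i l * v i)) = (\<Sum>l<d. \<Sum>i<d. v i * (U j l * U i l))"
    by (simp add: sum_distrib_left mult_ac)
  also have "\<dots> = (\<Sum>i<d. \<Sum>l<d. v i * (U j l * U i l))" by (rule sum.swap)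
  also have "\<dots> = (\<Sum>i<d. v i * (\<Sum>l<d. U j l * U i l))" by (simp add: sum_distrib_left)
  also have "\<dots> = (\<Sum>i<d. v i * (if j = i then 1 else 0))"
    using assms by (intro sum.cong refl) (simp add: orthogonal_mat_def)
  also have "\<dots> = v j" using assms(2) by (simp add: if_distrib cong: if_cong)
  finally show ?thesis .
qed

lemma gauss_kernel_orthogonal:
  assumes U: "orthogonal_mat d U"
    and diff: "\<And>j. j < d \<Longrightarrow> x j - x' j = (\<Sum>l<d. U j l * w l)"
  shows "gauss_kernel d \<gamma> x x' = exp (- (1 / \<gamma>\<^sup>2 * (\<Sum>l<d. (w l)\<^sup>2)))"
proof -
  have "(L2_set (\<lambda>j. x j - x' j) {..<d})\<^sup>2 = (\<Sum>j<d. (x j - x' j)\<^sup>2)"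
    by (simp add: L2_set_def sum_nonneg)
  also have "\<dots> = (\<Sum>j<d. (\<Sum>l<d. U j l * w l)\<^sup>2)" by (intro sum.cong refl) (simp add: diff)
  also have "\<dots> = (\<Sum>l<d. (w l)\<^sup>2)" by (rule orthogonal_mat_isometry[OF U])
  finally show ?thesis by (simp add: gauss_kernel_def)
qed

text \<open>All differences of observations are images under \<open>U\<close> of differences of noise vectors, shifted by
  \<open>e = U\<^sup>T (\<mu>\<^sub>P - \<mu>\<^sub>Q)\<close> for the mixed pairs, and \<open>U\<close> preserves norms.\<close>

lemma mmd_h_eq_pair_stat:
  assumes U: "orthogonal_mat d U"
    and x: "\<And>j. j < d \<Longrightarrow> x j = (\<Sum>l<d. U j l * a l) + \<mu>P j" "\<And>j. j < d \<Longrightarrow> x' j = (\<Sum>l<d. U j l * a' l) + \<mu>P j"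
    and y: "\<And>j. j < d \<Longrightarrow> y j = (\<Sum>l<d. U j l * b l) + \<mu>Q j" "\<And>j. j < d \<Longrightarrow> y' j = (\<Sum>l<d. U j l * b' l) + \<mu>Q j"
    and z: "z 0 = a" "z 1 = b" "z 2 = a'" "z 3 = b'"
  shows "mmd_h d \<gamma> (x, y) (x', y') = pair_stat d (1 / \<gamma>\<^sup>2) (\<lambda>l. \<Sum>j<d. U j l * (\<mu>P j - \<mu>Q j)) z"
proof -
  let ?e = "\<lambda>l. \<Sum>j<d. U j l * (\<mu>P j - \<mu>Q j)"
  note pre = orthogonal_mat_preimage[OF U, of _ "\<lambda>j. \<mu>P j - \<mu>Q j"]
  have 1: "gauss_kernel d \<gamma> x x' = exp (- (1 / \<gamma>\<^sup>2 * (\<Sum>l<d. (a l - a' l)\<^sup>2)))"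
    by (rule gauss_kernel_orthogonal[OF U]) (simp add: x right_diff_distrib sum_subtractf)
  have 2: "gauss_kernel d \<gamma> y y' = exp (- (1 / \<gamma>\<^sup>2 * (\<Sum>l<d. (b l - b' l)\<^sup>2)))"
    by (rule gauss_kernel_orthogonal[OF U]) (simp add: y right_diff_distrib sum_subtractf)
  have 3: "gauss_kernel d \<gamma> x y' = exp (- (1 / \<gamma>\<^sup>2 * (\<Sum>l<d. (a l - b' l + ?e l)\<^sup>2)))"
  proof (rule gauss_kernel_orthogonal[OF U])
    fix j assume j: "j < d"
    have "(\<Sum>l<d. U j l * (a l - b' l + ?e l)) = (\<Sum>l<d. U j l * a l) - (\<Sum>l<d. U j l * b' l) + (\<Sum>l<d. U j l * ?e l)"
      by (simp only: ring_distribs right_diff_distrib sum.distrib sum_subtractf)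
    then show "x j - y' j = (\<Sum>l<d. U j l * (a l - b' l + ?e l))" using pre[OF j] x(1)[OF j] y(2)[OF j] by simp
  qed
  have 4: "gauss_kernel d \<gamma> x' y = exp (- (1 / \<gamma>\<^sup>2 * (\<Sum>l<d. (a' l - b l + ?e l)\<^sup>2)))"
  proof (rule gauss_kernel_orthogonal[OF U])
    fix j assume j: "j < d"
    have "(\<Sum>l<d. U j l * (a' l - b l + ?e l)) = (\<Sum>l<d. U j l * a' l) - (\<Sum>l<d. U j l * b l) + (\<Sum>l<d. U j l * ?e l)"
      by (simp only: ring_distribs right_diff_distrib sum.distrib sum_subtractf)
    then show "x' j - y j = (\<Sum>l<d. U j l * (a' l - b l + ?e l))" using pre[OF j] x(2)[OF j] y(1)[OF j] by simp
  qed
  show ?thesis unfolding mmd_h_def pair_stat_def z by (simp only: 1 2 3 4 prod.case)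
qed

section \<open>The power of the test\<close>

text \<open>The labels of the four noise vectors that enter the \<open>i\<close>-th pair of observations, with \<open>Inl\<close> for the
  first sample and \<open>Inr\<close> for the second.\<close>

definition noise_label :: "nat \<Rightarrow> nat \<Rightarrow> nat + nat" where
  "noise_label i q = (if q = 0 then Inl (2 * i - 1) else if q = 1 then Inr (2 * i - 1)
     else if q = 2 then Inl (2 * i) else Inr (2 * i))"

lemma noise_label_simps [simp]:
  "noise_label i 0 = Inl (2 * i - 1)" "noise_label i (Suc 0) = Inr (2 * i - 1)"
  "noise_label i 2 = Inl (2 * i)" "noise_label i 3 = Inr (2 * i)"
  by (simp_all add: noise_label_def)

lemma noise_label_in:
  assumes "even n" "i \<in> {1..n div 2}"
  shows "noise_label i q \<in> {1..n} <+> {1..n}"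
proof -
  have "2 * i - 1 \<in> {1..n}" "2 * i \<in> {1..n}" using assms by auto
  then show ?thesis by (auto simp: noise_label_def)
qed

lemma noise_label_eq_iff:
  assumes "q < 4" "r < 4" "1 \<le> i" "1 \<le> i'"
  shows "noise_label i q = noise_label i' r \<longleftrightarrow> i = i' \<and> q = r"
proof -
  have odd: "2 * i - 1 \<noteq> 2 * i'" "2 * i \<noteq> 2 * i' - 1" using assms(3,4) by presburger+
  have "q = 0 \<or> q = 1 \<or> q = 2 \<or> q = 3" "r = 0 \<or> r = 1 \<or> r = 2 \<or> r = 3" using assms(1,2) by linarith+
  then show ?thesis using odd assms(3,4) by (elim disjE) (auto simp: noise_label_def)
qed

lemma
  assumes "\<And>q j. q < 4 \<Longrightarrow> j < d \<Longrightarrow> y q j = y' q j"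
  shows pair_stat_cong: "pair_stat d g e y = pair_stat d g e y'"
    and pair_bilinear_cong: "pair_bilinear d y = pair_bilinear d y'"
  unfolding pair_stat_def pair_bilinear_def using assms by simp_all

lemma measurable_pair_stat_component:
  assumes "\<And>q j. q < 4 \<Longrightarrow> j < d \<Longrightarrow> L q j \<in> K"
  shows "(\<lambda>f. pair_stat d g e (\<lambda>q j. f (L q j))) \<in> borel_measurable (\<Pi>\<^sub>M p\<in>K. borel)"
    and "(\<lambda>f. pair_bilinear d (\<lambda>q j. f (L q j))) \<in> borel_measurable (\<Pi>\<^sub>M p\<in>K. borel)"
proof -
  have [measurable]: "(\<lambda>f. f (L q j)) \<in> borel_measurable (\<Pi>\<^sub>M p\<in>K. borel :: real measure)" if "q < 4" "j < d" for q j
    using assms[OF that] by (rule measurable_component_singleton)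
  show "(\<lambda>f. pair_stat d g e (\<lambda>q j. f (L q j))) \<in> borel_measurable (\<Pi>\<^sub>M p\<in>K. borel)"
    "(\<lambda>f. pair_bilinear d (\<lambda>q j. f (L q j))) \<in> borel_measurable (\<Pi>\<^sub>M p\<in>K. borel)"
    unfolding pair_stat_def pair_bilinear_def by measurable
qed

lemma iid_noise_coordinates:
  assumes "prob_space M" and noise: "iid_noise M \<nu> n d s t"
  shows "prob_space.indep_vars M (\<lambda>_. borel) (\<lambda>(c, j) \<omega>. case_sum s t c \<omega> j) (({1..n} <+> {1..n}) \<times> {..<d})"
    and "\<And>c j. c \<in> {1..n} <+> {1..n} \<Longrightarrow> j < d \<Longrightarrow> distr M borel (\<lambda>\<omega>. case_sum s t c \<omega> j) = \<nu>"
proof -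
  interpret prob_space M by fact
  have "indep_vars (\<lambda>_. borel) (\<lambda>j \<omega>. case_sum s t c \<omega> j) {..<d}" if "c \<in> {1..n} <+> {1..n}" for c
    using noise that unfolding iid_noise_def by (elim PlusE) auto
  then have "indep_vars (\<lambda>(c, j). borel) (\<lambda>(c, j) \<omega>. case_sum s t c \<omega> j) (({1..n} <+> {1..n}) \<times> {..<d})"
    using noise unfolding iid_noise_def by (intro indep_vars_flatten) auto
  then show "indep_vars (\<lambda>_. borel) (\<lambda>(c, j) \<omega>. case_sum s t c \<omega> j) (({1..n} <+> {1..n}) \<times> {..<d})"
    by (simp add: case_prod_unfold)
  show "distr M borel (\<lambda>\<omega>. case_sum s t c \<omega> j) = \<nu>" if "c \<in> {1..n} <+> {1..n}" "j < d" for c j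
    using noise that unfolding iid_noise_def by (elim PlusE) auto
qed

text \<open>Different pairs of observations use disjoint sets of labels.\<close>

lemma (in coordinate_law) noise_blocks:
  assumes P: "prob_space P" and noise: "iid_noise P \<nu> n d s t" and n: "even n"
  defines "Y \<equiv> \<lambda>i q j \<omega>. case_sum s t (noise_label i q) \<omega> j"
  shows "i \<in> {1..n div 2} \<Longrightarrow> noise_block \<nu> \<sigma> P (Y i) d"
    and "prob_space.indep_vars P (\<lambda>_. borel) (\<lambda>i \<omega>. pair_stat d g e (\<lambda>q j. Y i q j \<omega>)) {1..n div 2}"
    and "prob_space.indep_vars P (\<lambda>_. borel) (\<lambda>i \<omega>. pair_bilinear d (\<lambda>q j. Y i q j \<omega>)) {1..n div 2}"
proof -
  interpret P: prob_space P by fact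
  note coord = iid_noise_coordinates[OF P noise]
  let ?X = "\<lambda>(c, j) \<omega>. case_sum s t c \<omega> j"
  let ?I = "({1..n} <+> {1..n}) \<times> {..<d}"
  {
    assume i: "i \<in> {1..n div 2}"
    have "P.indep_vars (\<lambda>p. borel) (\<lambda>p. ?X ((\<lambda>(q, j). (noise_label i q, j)) p)) ({..<4} \<times> {..<d})"
    proof (rule P.indep_vars_reindex[OF coord(1)])
      show "inj_on (\<lambda>(q, j). (noise_label i q, j)) ({..<4} \<times> {..<d})"
        using i by (auto simp: inj_on_def noise_label_eq_iff)
      show "(\<lambda>(q, j). (noise_label i q, j)) ` ({..<4} \<times> {..<d}) \<subseteq> ?I"
        using noise_label_in[OF n i] by auto
    qed
    then have "P.indep_vars (\<lambda>_. borel) (\<lambda>(q, j). Y i q j) ({..<4} \<times> {..<d})"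
      by (simp add: Y_def case_prod_unfold)
    then show "noise_block \<nu> \<sigma> P (Y i) d"
      using noise_label_in[OF n i] coord(2)
      by (intro noise_block.intro noise_block_axioms.intro coordinate_law_axioms P) (auto simp: Y_def)
  }
  let ?K = "\<lambda>i. noise_label i ` {..<4} \<times> {..<d}"
  have blocks: "P.indep_vars (\<lambda>i. \<Pi>\<^sub>M p\<in>?K i. borel) (\<lambda>i \<omega>. restrict (\<lambda>p. ?X p \<omega>) (?K i)) {1..n div 2}"
  proof (rule P.indep_vars_restrict[OF coord(1)])
    show "?K i \<subseteq> ?I" if "i \<in> {1..n div 2}" for i using noise_label_in[OF n that] by auto
    show "disjoint_family_on ?K {1..n div 2}"
      unfolding disjoint_family_on_def by (auto simp: noise_label_eq_iff)
  qed
  have entry: "restrict (\<lambda>p. ?X p \<omega>) (?K i) (noise_label i q, j) = Y i q j \<omega>" if "q < 4" "j < d" for i q j \<omega>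
    using that by (simp add: Y_def)
  have stat_eq: "pair_stat d g e (\<lambda>q j. restrict (\<lambda>p. ?X p \<omega>) (?K i) (noise_label i q, j)) = pair_stat d g e (\<lambda>q j. Y i q j \<omega>)"
    and bil_eq: "pair_bilinear d (\<lambda>q j. restrict (\<lambda>p. ?X p \<omega>) (?K i) (noise_label i q, j)) = pair_bilinear d (\<lambda>q j. Y i q j \<omega>)"
    for i \<omega> by (intro pair_stat_cong pair_bilinear_cong entry; assumption)+
  have "P.indep_vars (\<lambda>_. borel) (\<lambda>i \<omega>. pair_stat d g e (\<lambda>q j. restrict (\<lambda>p. ?X p \<omega>) (?K i) (noise_label i q, j))) {1..n div 2}"
    by (rule P.indep_vars_compose2[OF blocks], rule measurable_pair_stat_component) auto
  moreover have "P.indep_vars (\<lambda>_. borel) (\<lambda>i \<omega>. pair_bilinear d (\<lambda>q j. restrict (\<lambda>p. ?X p \<omega>) (?K i) (noise_label i q, j))) {1..n div 2}"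
    by (rule P.indep_vars_compose2[OF blocks], rule measurable_pair_stat_component) auto
  ultimately show "P.indep_vars (\<lambda>_. borel) (\<lambda>i \<omega>. pair_stat d g e (\<lambda>q j. Y i q j \<omega>)) {1..n div 2}"
    "P.indep_vars (\<lambda>_. borel) (\<lambda>i \<omega>. pair_bilinear d (\<lambda>q j. Y i q j \<omega>)) {1..n div 2}"
    by (simp_all only: stat_eq bil_eq)
qed

text \<open>The test statistic is unchanged when the values of \<open>h\<close> are standardised, except that the sample
  mean is shifted by the ratio of mean to scale. So it is the studentized mean of a perturbed array plus an
  offset.\<close>

lemma (in coordinate_law) power_limit:
  fixes n d :: "nat \<Rightarrow> nat" and M :: "nat \<Rightarrow> 'a measure" and \<gamma> :: "nat \<Rightarrow> real"
    and s t x y :: "nat \<Rightarrow> nat \<Rightarrow> 'a \<Rightarrow> nat \<Rightarrow> real" and K :: real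
  assumes n: "\<And>k. 0 < n k" "\<And>k. even (n k)" "filterlim n at_top sequentially"
    and d: "\<And>k. 0 < d k"
    and prob: "\<And>k. prob_space (M k)"
    and noise: "\<And>k. iid_noise (M k) \<nu> (n k) (d k) (s k) (t k)"
    and U: "\<And>k. orthogonal_mat (d k) (U k)"
    and x: "\<And>k i \<omega> j. i \<in> {1..n k} \<Longrightarrow> \<omega> \<in> space (M k) \<Longrightarrow> j < d k \<Longrightarrow>
              x k i \<omega> j = (\<Sum>l<d k. U k j l * s k i \<omega> l) + \<mu>P k j"
    and y: "\<And>k i \<omega> j. i \<in> {1..n k} \<Longrightarrow> \<omega> \<in> space (M k) \<Longrightarrow> j < d k \<Longrightarrow>
              y k i \<omega> j = (\<Sum>l<d k. U k j l * t k i \<omega> l) + \<mu>Q k j"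
    and \<gamma>: "\<And>k. 0 < \<gamma> k" "\<And>k. 1 / (\<gamma> k)\<^sup>2 * d k \<le> K"
    and e: "\<And>k l. e k l = (\<Sum>j<d k. U k j l * (\<mu>P k j - \<mu>Q k j))"
    and q: "\<And>k. q k = (\<Sum>l<d k. (e k l)\<^sup>2) / d k"
    and err: "\<And>k. 0 < rel_error K (d k) (q k)" "(\<lambda>k. rel_error K (d k) (q k)) \<longlonglongrightarrow> 0"
  shows "(\<lambda>k. mmd_rejection_prob (M k) \<alpha> (n k) (d k) (\<gamma> k) (x k) (y k)
      - std_normal_cdf (sqrt (n k / 2) * (mmd_mean (d k) (1 / (\<gamma> k)\<^sup>2) (e k) / mmd_scale (d k) (1 / (\<gamma> k)\<^sup>2))
          - normal_upper_quantile \<alpha>)) \<longlonglongrightarrow> 0"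
proof -
  define g where "g k = 1 / (\<gamma> k)\<^sup>2" for k
  define N where "N k = n k div 2" for k
  define Y where "Y k i q j \<omega> = case_sum (s k) (t k) (noise_label i q) \<omega> j" for k i q j \<omega>
  define m where "m k = mmd_mean (d k) (g k) (e k)" for k
  define c where "c k = mmd_scale (d k) (g k)" for k
  define H where "H k i \<omega> = (pair_stat (d k) (g k) (e k) (\<lambda>q j. Y k i q j \<omega>) - m k) / c k" for k i \<omega>
  define W where "W k i \<omega> = pair_bilinear (d k) (\<lambda>q j. Y k i q j \<omega>) / (2 * \<sigma>\<^sup>2 * sqrt (d k))" for k i \<omega>
  define \<epsilon> where "\<epsilon> k = sqrt (rel_error K (d k) (q k))" for k
  define C where "C = 6 + fourth_moment\<^sup>2 / (16 * \<sigma> ^ 8)"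
  have g: "0 < g k" for k using \<gamma>(1)[of k] by (simp add: g_def)
  have c: "0 < c k" for k using g[of k] d[of k] \<sigma>_pos by (simp add: c_def mmd_scale_def)
  have N_real: "real (N k) = n k / 2" for k unfolding N_def using n(2)[of k] by (simp add: real_of_nat_div)
  have block: "noise_block \<nu> \<sigma> (M k) (Y k i) (d k)" if "i \<in> {1..N k}" for k i
    unfolding Y_def[abs_def] by (rule noise_blocks(1)[OF prob noise n(2)]) (use that in \<open>simp add: N_def\<close>)
  interpret array: perturbed_array M N H W \<epsilon> C
  proof (rule perturbed_array.intro)
    fix k i
    show "prob_space (M k)" by (rule prob)
    show "0 < N k"
    proof -
      have "n k \<noteq> 1" using n(2)[of k] by auto
      then show ?thesis using n(1)[of k] by (simp add: N_def div_greater_zero_iff)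
    qed
    show "filterlim N at_top sequentially"
      unfolding filterlim_at_top
    proof
      fix Z
      have "\<forall>\<^sub>F k in sequentially. 2 * Z \<le> n k" using n(3) by (simp add: filterlim_at_top)
      then show "\<forall>\<^sub>F k in sequentially. Z \<le> N k" by eventually_elim (simp add: N_def)
    qed
    show "prob_space.indep_vars (M k) (\<lambda>_. borel) (H k) {1..N k}"
      unfolding H_def[abs_def] Y_def N_def
      by (rule prob_space.indep_vars_compose2[OF prob noise_blocks(2)[OF prob noise n(2)]]) measurable
    show "prob_space.indep_vars (M k) (\<lambda>_. borel) (W k) {1..N k}"
      unfolding W_def[abs_def] Y_def N_def
      by (rule prob_space.indep_vars_compose2[OF prob noise_blocks(3)[OF prob noise n(2)]]) measurable
    show "0 < \<epsilon> k" using err(1) by (simp add: \<epsilon>_def)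
    show "\<epsilon> \<longlonglongrightarrow> 0" using tendsto_real_sqrt[OF err(2)] by (simp add: \<epsilon>_def[abs_def])
    assume i: "i \<in> {1..N k}"
    interpret B: noise_block \<nu> \<sigma> "M k" "Y k i" "d k" by (rule block[OF i])
    have H: "H k i = (\<lambda>\<omega>. (B.block_h (g k) (e k) \<omega> - mmd_mean (d k) (g k) (e k)) / mmd_scale (d k) (g k))"
      by (simp add: fun_eq_iff H_def B.block_h_def m_def c_def)
    have W: "W k i = (\<lambda>\<omega>. B.bilinear \<omega> / (2 * \<sigma>\<^sup>2 * sqrt (d k)))"
      by (simp add: fun_eq_iff W_def B.bilinear_def)
    have dk: "0 < real (d k)" using d[of k] by simp
    show "(LINT \<omega>|M k. H k i \<omega>) = 0"
      unfolding H using B.block_h_integrable[of "g k" "e k"] B.block_h_expectation[of "g k" "e k"] g[of k]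
      by (simp add: B.prob_space)
    have W2: "(W k i \<omega>)\<^sup>2 = (B.bilinear \<omega>)\<^sup>2 / (4 * \<sigma> ^ 4 * d k)"
      and W4: "W k i \<omega> ^ 4 = B.bilinear \<omega> ^ 4 / (16 * \<sigma> ^ 8 * (d k)\<^sup>2)" for \<omega>
    proof -
      show W2: "(W k i \<omega>)\<^sup>2 = (B.bilinear \<omega>)\<^sup>2 / (4 * \<sigma> ^ 4 * d k)"
        unfolding W by (simp add: power_divide power_mult_distrib flip: power_mult)
      have "W k i \<omega> ^ 4 = ((W k i \<omega>)\<^sup>2)\<^sup>2" by (simp flip: power_mult)
      then show "W k i \<omega> ^ 4 = B.bilinear \<omega> ^ 4 / (16 * \<sigma> ^ 8 * (d k)\<^sup>2)"
        unfolding W2 by (simp add: power_divide power_mult_distrib flip: power_mult)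
    qed
    show "integrable (M k) (\<lambda>\<omega>. W k i \<omega> ^ 4)" unfolding W4 using B.bilinear4_integrable by simp
    show "(LINT \<omega>|M k. (W k i \<omega>)\<^sup>2) = 1" unfolding W2 using \<sigma>_pos dk by (simp add: B.bilinear2)
    have "(LINT \<omega>|M k. W k i \<omega> ^ 4) = (LINT \<omega>|M k. B.bilinear \<omega> ^ 4) / (16 * \<sigma> ^ 8 * (d k)\<^sup>2)" unfolding W4 by simp
    also have "\<dots> \<le> (d k * (6 * (d k * (4 * \<sigma> ^ 4)) * (4 * \<sigma> ^ 4) + fourth_moment\<^sup>2)) / (16 * \<sigma> ^ 8 * (d k)\<^sup>2)"
      using \<sigma>_pos by (intro divide_right_mono B.bilinear4) simp
    also have "\<dots> = 6 + fourth_moment\<^sup>2 / (16 * \<sigma> ^ 8) / d k"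
    proof -
      have "D * (6 * (D * (4 * a)) * (4 * a) + F) / (16 * a\<^sup>2 * D\<^sup>2) = 6 + F / (16 * a\<^sup>2) / D"
        if "0 < D" "0 < a" for D a F :: real
        using that by (simp add: field_simps power2_eq_square)
      from this[OF dk, of "\<sigma> ^ 4"] show ?thesis using \<sigma>_pos by (simp flip: power_mult)
    qed
    also have "\<dots> \<le> C"
    proof -
      have "fourth_moment\<^sup>2 / (16 * \<sigma> ^ 8) / d k \<le> fourth_moment\<^sup>2 / (16 * \<sigma> ^ 8) / 1"
        using d[of k] \<sigma>_pos by (intro divide_left_mono) auto
      then show ?thesis by (simp add: C_def)
    qed
    finally show "(LINT \<omega>|M k. W k i \<omega> ^ 4) \<le> C" .
    have gd: "g k * d k \<le> K" using \<gamma>(2)[of k] by (simp add: g_def)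
    show "integrable (M k) (\<lambda>\<omega>. (H k i \<omega> - W k i \<omega>)\<^sup>2)"
      unfolding H W by (rule B.remainder2_integrable[OF g d gd q])
    have "(LINT \<omega>|M k. (H k i \<omega> - W k i \<omega>)\<^sup>2) \<le> rel_error K (d k) (q k)"
      unfolding H W by (rule B.remainder2[OF g d gd q])
    then show "(LINT \<omega>|M k. (H k i \<omega> - W k i \<omega>)\<^sup>2) \<le> (\<epsilon> k)\<^sup>2"
      using err(1)[of k] by (simp add: \<epsilon>_def)
  qed
  let ?z = "normal_upper_quantile \<alpha>"
  have stat: "sqrt (n k) * mmd_linear (n k) (d k) (\<gamma> k) (\<lambda>i. x k i \<omega>) (\<lambda>i. y k i \<omega>)
        / sqrt (mmd_variance (n k) (d k) (\<gamma> k) (\<lambda>i. x k i \<omega>) (\<lambda>i. y k i \<omega>))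
      = (sqrt (N k) * (m k / c k) + sqrt (N k) * array.sample_mean k \<omega>) / sqrt (array.sample_var k \<omega>)"
    if \<omega>: "\<omega> \<in> space (M k)" for k \<omega>
  proof -
    let ?L = "mmd_linear (n k) (d k) (\<gamma> k) (\<lambda>i. x k i \<omega>) (\<lambda>i. y k i \<omega>)"
    let ?V = "mmd_variance (n k) (d k) (\<gamma> k) (\<lambda>i. x k i \<omega>) (\<lambda>i. y k i \<omega>)"
    let ?h = "\<lambda>i. mmd_h (d k) (\<gamma> k) (x k (2 * i - 1) \<omega>, y k (2 * i - 1) \<omega>) (x k (2 * i) \<omega>, y k (2 * i) \<omega>)"
    have Nk: "0 < real (N k)" using array.N_pos[of k] by simp
    have h: "?h i = m k + c k * H k i \<omega>" if i: "i \<in> {1..N k}" for i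
    proof -
      have in_range: "2 * i - 1 \<in> {1..n k}" "2 * i \<in> {1..n k}" using i n(2)[of k] by (auto simp: N_def)
      have "?h i = pair_stat (d k) (1 / (\<gamma> k)\<^sup>2) (\<lambda>l. \<Sum>j<d k. U k j l * (\<mu>P k j - \<mu>Q k j)) (\<lambda>q j. Y k i q j \<omega>)"
        by (rule mmd_h_eq_pair_stat[OF U x[OF in_range(1) \<omega>] x[OF in_range(2) \<omega>] y[OF in_range(1) \<omega>] y[OF in_range(2) \<omega>]])
          (simp_all add: Y_def)
      then show ?thesis using c[of k] by (simp add: H_def g_def e[abs_def])
    qed
    have L: "?L = m k + c k * array.sample_mean k \<omega>"
    proof -
      have "?L = 1 / N k * (\<Sum>i=1..N k. ?h i)" unfolding mmd_linear_def N_real[symmetric] by (simp only: N_def)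
      also have "(\<Sum>i=1..N k. ?h i) = (\<Sum>i=1..N k. m k + c k * H k i \<omega>)" by (intro sum.cong refl h)
      also have "\<dots> = N k * m k + c k * (\<Sum>i=1..N k. H k i \<omega>)" by (simp add: sum.distrib sum_distrib_left)
      finally show ?thesis using Nk by (simp add: array.sample_mean_def field_simps)
    qed
    have V: "?V = 2 * (c k)\<^sup>2 * array.sample_var k \<omega>"
    proof -
      have "?V = 2 * (1 / N k * (\<Sum>i=1..N k. (?h i - ?L)\<^sup>2))" unfolding mmd_variance_def N_real[symmetric] by (simp only: N_def)
      also have "(\<Sum>i=1..N k. (?h i - ?L)\<^sup>2) = (\<Sum>i=1..N k. (c k)\<^sup>2 * (H k i \<omega> - array.sample_mean k \<omega>)\<^sup>2)"
      proof (intro sum.cong refl)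
        fix i assume "i \<in> {1..N k}"
        then have "?h i - ?L = c k * (H k i \<omega> - array.sample_mean k \<omega>)" by (simp only: h L) (simp add: algebra_simps)
        then show "(?h i - ?L)\<^sup>2 = (c k)\<^sup>2 * (H k i \<omega> - array.sample_mean k \<omega>)\<^sup>2"
          by (simp only: power_mult_distrib)
      qed
      also have "\<dots> = (c k)\<^sup>2 * (\<Sum>i=1..N k. (H k i \<omega> - array.sample_mean k \<omega>)\<^sup>2)" by (simp add: sum_distrib_left)
      finally show ?thesis by (simp add: array.sample_var_def)
    qed
    have "sqrt (n k) = sqrt 2 * sqrt (N k)" by (simp add: N_real flip: real_sqrt_mult)
    moreover have "sqrt ?V = sqrt 2 * c k * sqrt (array.sample_var k \<omega>)"
      unfolding V using c[of k] by (simp add: real_sqrt_mult)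
    ultimately have "sqrt (n k) * ?L / sqrt ?V = (sqrt 2 * sqrt (N k)) * (m k + c k * array.sample_mean k \<omega>)
        / (sqrt 2 * c k * sqrt (array.sample_var k \<omega>))" by (simp only: L)
    also have "\<dots> = (sqrt (N k) * (m k + c k * array.sample_mean k \<omega>) / c k) / sqrt (array.sample_var k \<omega>)"
      by simp
    also have "sqrt (N k) * (m k + c k * array.sample_mean k \<omega>) / c k
        = sqrt (N k) * (m k / c k) + sqrt (N k) * array.sample_mean k \<omega>"
      using c[of k] by (simp add: field_simps)
    finally show ?thesis .
  qed
  have "mmd_rejection_prob (M k) \<alpha> (n k) (d k) (\<gamma> k) (x k) (y k) = measure (M k) {\<omega> \<in> space (M k).
      ?z < (sqrt (N k) * (m k / c k) + sqrt (N k) * array.sample_mean k \<omega>) / sqrt (array.sample_var k \<omega>)}" for k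
    unfolding mmd_rejection_prob_def mmd_rejects_def using stat[of _ k]
    by (intro arg_cong[where f="measure (M k)"]) auto
  then show ?thesis
    using array.studentized_limit[of ?z "\<lambda>k. sqrt (N k) * (m k / c k)"]
    by (simp add: N_real m_def c_def g_def)
qed

theorem corollary1:
  fixes n d :: "nat \<Rightarrow> nat"
    and M :: "nat \<Rightarrow> 'a measure"
    and \<nu> :: "real measure"
    and U :: "nat \<Rightarrow> nat \<Rightarrow> nat \<Rightarrow> real"
    and \<mu>P \<mu>Q :: "nat \<Rightarrow> nat \<Rightarrow> real"
    and s t x y :: "nat \<Rightarrow> nat \<Rightarrow> 'a \<Rightarrow> nat \<Rightarrow> real"
    and \<gamma> \<Psi> :: "nat \<Rightarrow> real"
    and \<sigma> \<alpha> :: real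
  assumes n: "\<And>k. 0 < n k" "\<And>k. even (n k)" "filterlim n at_top sequentially"
    and d: "\<And>k. 0 < d k" "filterlim d at_top sequentially"
    and law: "real_distribution \<nu>" "integrable \<nu> (\<lambda>u. u)" "(LINT u|\<nu>. u) = 0"
    and prob: "\<And>k. prob_space (M k)"
    and noise: "\<And>k. iid_noise (M k) \<nu> (n k) (d k) (s k) (t k)"
    and U: "\<And>k. orthogonal_mat (d k) (U k)"
    and x: "\<And>k i \<omega> j. i \<in> {1..n k} \<Longrightarrow> \<omega> \<in> space (M k) \<Longrightarrow> j < d k \<Longrightarrow>
              x k i \<omega> j = (\<Sum>l<d k. U k j l * s k i \<omega> l) + \<mu>P k j"
    and y: "\<And>k i \<omega> j. i \<in> {1..n k} \<Longrightarrow> \<omega> \<in> space (M k) \<Longrightarrow> j < d k \<Longrightarrow>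
              y k i \<omega> j = (\<Sum>l<d k. U k j l * t k i \<omega> l) + \<mu>Q k j"
    and moments: "\<And>m. m \<in> {2..6} \<Longrightarrow> integrable \<nu> (\<lambda>u. (u - (LINT v|\<nu>. v)) ^ m)"
    and variance: "0 < \<sigma>" "(LINT u|\<nu>. (u - (LINT v|\<nu>. v))\<^sup>2) = \<sigma>\<^sup>2"
    and bandwidth: "\<And>k. 0 < \<gamma> k" "\<gamma> \<in> \<Omega>(\<lambda>k. sqrt (real (d k)))"
    and level: "0 < \<alpha>" "\<alpha> < 1"
    and snr: "\<And>k. \<Psi> k = signal_to_noise (d k) \<sigma> (\<mu>P k) (\<mu>Q k)" "\<And>k. 0 < \<Psi> k"
      "\<Psi> \<in> o(\<lambda>k. real (d k) powr (1/2))"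
  shows "(\<exists>c C. 0 < c \<and> c \<le> C \<and> (\<exists>c' :: nat \<Rightarrow> real. (\<forall>k. c' k \<in> {c..C}) \<and>
           (\<lambda>k. mmd_rejection_prob (M k) \<alpha> (n k) (d k) (\<gamma> k) (x k) (y k) -
                std_normal_cdf (c' k * (sqrt (real (n k)) * (\<Psi> k)\<^sup>2 / sqrt (real (d k)))
                  - normal_upper_quantile \<alpha>)) \<longlonglongrightarrow> 0))
       \<and> (filterlim (\<lambda>k. sqrt (real (n k)) * (\<Psi> k)\<^sup>2 / sqrt (real (d k))) at_top sequentially \<longrightarrow>
           (\<lambda>k. mmd_rejection_prob (M k) \<alpha> (n k) (d k) (\<gamma> k) (x k) (y k)) \<longlonglongrightarrow> 1)"
proof -
  interpret coordinate_law \<nu> \<sigma>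
  proof (rule coordinate_law.intro)
    show "real_distribution \<nu>" "(LINT u|\<nu>. u) = 0" "0 < \<sigma>" by fact+
    show "integrable \<nu> (\<lambda>u. u ^ 6)" using moments[of 6] law(3) by simp
    show "(LINT u|\<nu>. u\<^sup>2) = \<sigma>\<^sup>2" using variance(2) law(3) by simp
  qed
  define e where "e k l = (\<Sum>j<d k. U k j l * (\<mu>P k j - \<mu>Q k j))" for k l
  define E2 where "E2 k = (\<Sum>l<d k. (e k l)\<^sup>2)" for k
  define g where "g k = 1 / (\<gamma> k)\<^sup>2" for k
  define q where "q k = E2 k / d k" for k
  define r where "r k = sqrt (n k) * (\<Psi> k)\<^sup>2 / sqrt (d k)" for k
  define pow where "pow k = mmd_rejection_prob (M k) \<alpha> (n k) (d k) (\<gamma> k) (x k) (y k)" for k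
  define z where "z = normal_upper_quantile \<alpha>"
  have dpos: "0 < real (d k)" for k using d(1)[of k] by simp
  have g: "0 < g k" for k using bandwidth(1)[of k] by (simp add: g_def)
  have E2: "E2 k = \<sigma>\<^sup>2 * (\<Psi> k)\<^sup>2" for k
  proof -
    have "E2 k = (\<Sum>j<d k. (\<Sum>l<d k. U k j l * e k l)\<^sup>2)"
      unfolding E2_def by (rule orthogonal_mat_isometry[OF U, symmetric])
    also have "\<dots> = (\<Sum>j<d k. (\<mu>P k j - \<mu>Q k j)\<^sup>2)"
      unfolding e_def by (intro sum.cong refl) (simp add: orthogonal_mat_preimage[OF U, of _ k "\<lambda>j. \<mu>P k j - \<mu>Q k j"])
    also have "\<dots> = \<sigma>\<^sup>2 * (\<Psi> k)\<^sup>2"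
      using variance(1) by (simp add: snr(1) signal_to_noise_def L2_set_def power_divide sum_nonneg)
    finally show ?thesis .
  qed
  have E2_pos: "0 < E2 k" for k using variance(1) snr(2)[of k] by (simp add: E2)
  have q_pos: "0 < q k" for k using E2_pos dpos by (simp add: q_def)
  have r_pos: "0 < r k" for k using n(1)[of k] dpos[of k] snr(2)[of k] by (simp add: r_def)
  have d_real: "filterlim (\<lambda>k. real (d k)) at_top sequentially"
    by (rule filterlim_compose[OF filterlim_real_sequentially d(2)])
  obtain K where K: "0 < K" "\<forall>\<^sub>F k in sequentially. g k * d k \<le> K"
  proof -
    obtain b where b: "0 < b" "\<forall>\<^sub>F k in sequentially. norm (\<gamma> k) \<ge> b * norm (sqrt (real (d k)))"
      using landau_omega.bigE[OF bandwidth(2)] by blast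
    have "\<forall>\<^sub>F k in sequentially. g k * d k \<le> 1 / b\<^sup>2"
      using b(2)
    proof eventually_elim
      case (elim k)
      then have "b * sqrt (d k) \<le> \<gamma> k" using bandwidth(1)[of k] by simp
      then have "(b * sqrt (d k))\<^sup>2 \<le> (\<gamma> k)\<^sup>2" using b(1) by (intro power_mono) auto
      then have "b\<^sup>2 * d k \<le> (\<gamma> k)\<^sup>2" by (simp add: power_mult_distrib)
      then show ?case using b(1) bandwidth(1)[of k] by (simp add: g_def field_simps)
    qed
    then show ?thesis using that[of "1 / b\<^sup>2"] b(1) by simp
  qed
  have q_lim: "q \<longlonglongrightarrow> 0"
  proof -
    have "(\<lambda>k. \<Psi> k / real (d k) powr (1 / 2)) \<longlonglongrightarrow> 0" by (rule smalloD_tendsto[OF snr(3)])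
    then have "(\<lambda>k. \<sigma>\<^sup>2 * (\<Psi> k / sqrt (d k))\<^sup>2) \<longlonglongrightarrow> \<sigma>\<^sup>2 * 0\<^sup>2"
      by (intro tendsto_intros) (simp add: powr_half_sqrt)
    then show ?thesis by (simp add: q_def[abs_def] E2 power_divide)
  qed
  have inv_d: "(\<lambda>k. 1 / real (d k)) \<longlonglongrightarrow> 0"
    by (intro tendsto_divide_0[OF tendsto_const] filterlim_at_top_imp_at_infinity d_real)
  have inv_sqrt_d: "(\<lambda>k. 1 / sqrt (real (d k))) \<longlonglongrightarrow> 0"
    by (intro tendsto_divide_0[OF tendsto_const] filterlim_at_top_imp_at_infinity
        filterlim_compose[OF sqrt_at_top d_real])
  have err_lim: "(\<lambda>k. rel_error K (d k) (q k)) \<longlonglongrightarrow> 0"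
  proof -
    have third: "(3 * sqrt (d k * sq_var) * sq_var + sq_abs3) / d k
        = 3 * sqrt sq_var * sq_var * (1 / sqrt (d k)) + sq_abs3 * (1 / d k)" for k
      using dpos[of k] by (simp add: real_sqrt_mult field_simps)
    have "(\<lambda>k. rel_error K (d k) (q k)) \<longlonglongrightarrow> (16 * \<sigma>\<^sup>2 * 0 + 4 * K\<^sup>2 * 0\<^sup>2 * (sq_var + 8 * \<sigma>\<^sup>2 * 0)
       + 4 * exp (2 * (2 * K * \<sigma>\<^sup>2 + K * 0)) * (8 * K * (3 * sqrt sq_var * sq_var * 0 + sq_abs3 * 0) + 32 * \<sigma>\<^sup>2 * 0))
       / (2 * \<sigma> ^ 4)"
      unfolding rel_error_def third by (intro tendsto_intros q_lim inv_d inv_sqrt_d) (use variance(1) in simp)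
    then show ?thesis by simp
  qed
  have err_pos: "0 < rel_error K (d k) (q k)" for k
  proof -
    have "0 < 16 * \<sigma>\<^sup>2 * q k" using variance(1) q_pos by simp
    moreover have "0 \<le> 4 * K\<^sup>2 * (q k)\<^sup>2 * (sq_var + 8 * \<sigma>\<^sup>2 * q k)"
      using sq_var_nonneg q_pos[of k] by simp
    moreover have "0 \<le> 4 * exp (2 * (2 * K * \<sigma>\<^sup>2 + K * q k)) *
        (8 * K * ((3 * sqrt (d k * sq_var) * sq_var + sq_abs3) / d k) + 32 * \<sigma>\<^sup>2 * q k)"
    proof -
      have "0 \<le> sq_abs3" by (simp add: sq_abs3_def)
      then show ?thesis using sq_var_nonneg q_pos[of k] K(1) by simp
    qed
    ultimately show ?thesis unfolding rel_error_def using variance(1)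
      by (intro divide_pos_pos add_pos_nonneg) simp_all
  qed
  \<comment> \<open>The constants of the mean bounds, divided by \<open>4 \<surd>2\<close>; the factor \<open>1 / \<tau>\<close> in the upper bound is at most \<open>exp (2 \<sigma>\<^sup>2 K)\<close>.\<close>
  define lo where "lo = 1 / (8 * sqrt 2)"
  define hi where "hi = exp (2 * \<sigma>\<^sup>2 * K) / (2 * sqrt 2)"
  define ratio where "ratio k = sqrt (n k / 2) * (mmd_mean (d k) (g k) (e k) / mmd_scale (d k) (g k)) / r k" for k
  have ratio_bounds: "ratio k \<in> {lo..hi}"
    if gd: "g k * d k \<le> K" and gs: "32 * g k * \<sigma>\<^sup>2 \<le> 1" and gE: "g k * E2 k \<le> 1 / 2" for k
  proof -
    define \<tau> where "\<tau> = exp (- (g k * (2 * \<sigma>\<^sup>2 * d k)))"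
    have \<tau>: "0 < \<tau>" "1 / \<tau> \<le> exp (2 * \<sigma>\<^sup>2 * K)"
    proof -
      have "2 * \<sigma>\<^sup>2 * (g k * d k) \<le> 2 * \<sigma>\<^sup>2 * K" by (rule mult_left_mono[OF gd]) simp
      then show "0 < \<tau>" "1 / \<tau> \<le> exp (2 * \<sigma>\<^sup>2 * K)" by (simp_all add: \<tau>_def exp_minus inverse_eq_divide mult_ac)
    qed
    have mean: "\<tau> * (g k * E2 k) / 2 \<le> mmd_mean (d k) (g k) (e k)" "mmd_mean (d k) (g k) (e k) \<le> 2 * (g k * E2 k)"
      using mmd_mean_bounds[OF g gs, of "e k" "d k"] gE unfolding \<tau>_def E2_def by auto
    have eq: "ratio k = mmd_mean (d k) (g k) (e k) / (4 * sqrt 2 * \<tau> * (g k * E2 k))"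
    proof -
      have "mmd_scale (d k) (g k) = 4 * g k * \<tau> * \<sigma>\<^sup>2 * sqrt (d k)" by (simp add: mmd_scale_def \<tau>_def)
      then show ?thesis
        unfolding ratio_def r_def E2 using n(1)[of k] dpos[of k] snr(2)[of k] variance(1) \<tau>(1) g[of k]
        by (simp add: real_sqrt_divide field_simps)
    qed
    have pos: "0 < 4 * sqrt 2 * \<tau> * (g k * E2 k)" using \<tau>(1) g E2_pos by simp
    have "lo = (\<tau> * (g k * E2 k) / 2) / (4 * sqrt 2 * \<tau> * (g k * E2 k))"
      unfolding lo_def using \<tau>(1) g[of k] E2_pos[of k] by (simp add: field_simps)
    also have "\<dots> \<le> ratio k" unfolding eq by (rule divide_right_mono[OF mean(1)]) (use pos in simp)
    finally have "lo \<le> ratio k" .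
    moreover have "ratio k \<le> 2 * (g k * E2 k) / (4 * sqrt 2 * \<tau> * (g k * E2 k))"
      unfolding eq by (rule divide_right_mono[OF mean(2)]) (use pos in simp)
    moreover have "2 * (g k * E2 k) / (4 * sqrt 2 * \<tau> * (g k * E2 k)) = (1 / \<tau>) / (2 * sqrt 2)"
      using \<tau>(1) g[of k] E2_pos[of k] by (simp add: field_simps)
    moreover have "(1 / \<tau>) / (2 * sqrt 2) \<le> hi" unfolding hi_def by (rule divide_right_mono[OF \<tau>(2)]) simp
    ultimately show ?thesis by simp
  qed
  have "\<forall>\<^sub>F k in sequentially. g k * d k \<le> K \<and> 32 * g k * \<sigma>\<^sup>2 \<le> 1 \<and> g k * E2 k \<le> 1 / 2"
  proof -
    have "(\<lambda>k. 32 * K * \<sigma>\<^sup>2 * (1 / d k)) \<longlonglongrightarrow> 32 * K * \<sigma>\<^sup>2 * 0" by (intro tendsto_intros inv_d)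
    then have 1: "\<forall>\<^sub>F k in sequentially. 32 * K * \<sigma>\<^sup>2 * (1 / d k) < 1" by (rule order_tendstoD) simp
    have "(\<lambda>k. K * q k) \<longlonglongrightarrow> K * 0" by (intro tendsto_intros q_lim)
    then have 2: "\<forall>\<^sub>F k in sequentially. K * q k < 1 / 2" by (rule order_tendstoD) simp
    show ?thesis using K(2) 1 2
    proof eventually_elim
      case (elim k)
      have "g k \<le> K * (1 / d k)" using elim(1) dpos[of k] by (simp add: field_simps)
      then have "32 * \<sigma>\<^sup>2 * g k \<le> 32 * \<sigma>\<^sup>2 * (K * (1 / d k))" by (rule mult_left_mono) simp
      then have "32 * g k * \<sigma>\<^sup>2 \<le> 1" using elim(2) by (simp add: mult_ac)
      moreover have "g k * E2 k \<le> 1 / 2"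
      proof -
        have "g k * E2 k = (g k * d k) * q k" using dpos[of k] by (simp add: q_def)
        also have "\<dots> \<le> K * q k" using q_pos[of k] by (intro mult_right_mono[OF elim(1)]) simp
        finally show ?thesis using elim(3) by simp
      qed
      ultimately show ?case using elim(1) by simp
    qed
  qed
  then obtain k0 where k0: "\<And>k. k0 \<le> k \<Longrightarrow> g k * d k \<le> K \<and> 32 * g k * \<sigma>\<^sup>2 \<le> 1 \<and> g k * E2 k \<le> 1 / 2"
    unfolding eventually_sequentially by blast
  \<comment> \<open>The estimates hold from \<open>k0\<close> on; earlier terms do not influence the limit and receive an arbitrary admissible value.\<close>
  define c' where "c' k = (if k0 \<le> k then ratio k else lo)" for k
  have lo: "0 < lo" by (simp add: lo_def)
  have c': "c' k \<in> {lo..hi}" for k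
  proof -
    have "lo \<le> hi" using ratio_bounds[of k0] k0[of k0] by auto
    then show ?thesis using ratio_bounds[of k] k0[of k] by (auto simp: c'_def)
  qed
  have "(\<lambda>k. pow (k + k0) - std_normal_cdf (c' (k + k0) * r (k + k0) - z)) \<longlonglongrightarrow> 0"
  proof -
    have "(\<lambda>k. pow (k + k0) - std_normal_cdf (sqrt (n (k + k0) / 2) *
        (mmd_mean (d (k + k0)) (1 / (\<gamma> (k + k0))\<^sup>2) (e (k + k0)) / mmd_scale (d (k + k0)) (1 / (\<gamma> (k + k0))\<^sup>2)) - z))
      \<longlonglongrightarrow> 0"
      unfolding pow_def z_def
    proof (rule power_limit[where K=K and q="\<lambda>k. q (k + k0)"])
      show "filterlim (\<lambda>k. n (k + k0)) at_top sequentially"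
        using filterlim_compose[OF n(3) filterlim_add_const_nat_at_top] .
      show "1 / (\<gamma> (k + k0))\<^sup>2 * d (k + k0) \<le> K" for k using k0[of "k + k0"] by (simp add: g_def)
      show "q (k + k0) = (\<Sum>l<d (k + k0). (e (k + k0) l)\<^sup>2) / d (k + k0)" for k by (simp add: q_def E2_def)
      show "(\<lambda>k. rel_error K (d (k + k0)) (q (k + k0))) \<longlonglongrightarrow> 0"
        by (rule LIMSEQ_ignore_initial_segment[OF err_lim])
    qed (rule n d(1) prob noise U x y bandwidth e_def err_pos; assumption?)+
    moreover have "c' (k + k0) * r (k + k0) = sqrt (n (k + k0) / 2) *
        (mmd_mean (d (k + k0)) (1 / (\<gamma> (k + k0))\<^sup>2) (e (k + k0)) / mmd_scale (d (k + k0)) (1 / (\<gamma> (k + k0))\<^sup>2))" for k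
      using r_pos[of "k + k0"] by (simp add: c'_def ratio_def g_def)
    ultimately show ?thesis by simp
  qed
  then have lim: "(\<lambda>k. pow k - std_normal_cdf (c' k * r k - z)) \<longlonglongrightarrow> 0" by (rule LIMSEQ_offset)
  have "pow \<longlonglongrightarrow> 1" if "filterlim r at_top sequentially"
  proof -
    have "filterlim (\<lambda>k. c' k * r k - z) at_top sequentially"
    proof (rule filterlim_at_top_mono)
      show "filterlim (\<lambda>k. - z + lo * r k) at_top sequentially"
        by (intro filterlim_tendsto_add_at_top[OF tendsto_const] filterlim_tendsto_pos_mult_at_top[OF tendsto_const lo] that)
      show "\<forall>\<^sub>F k in sequentially. - z + lo * r k \<le> c' k * r k - z"
        using c' r_pos by (intro always_eventually allI) (simp add: mult_right_mono less_imp_le)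
    qed
    then have "(\<lambda>k. std_normal_cdf (c' k * r k - z)) \<longlonglongrightarrow> 1"
      by (rule filterlim_compose[OF std_normal_cdf_at_top])
    from tendsto_add[OF lim this] show ?thesis by simp
  qed
  moreover have "\<exists>c C. 0 < c \<and> c \<le> C \<and> (\<exists>c' :: nat \<Rightarrow> real. (\<forall>k. c' k \<in> {c..C}) \<and>
      (\<lambda>k. pow k - std_normal_cdf (c' k * r k - z)) \<longlonglongrightarrow> 0)"
    using lo c' lim by (intro exI[of _ lo] exI[of _ hi] conjI exI[of _ c']) (auto dest: order_trans)
  ultimately show ?thesis unfolding pow_def[abs_def] r_def[abs_def] z_def by blast
qed

end
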